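(* (a) There is a polynomial-time kernelization algorithm for Diamond-free Edge Deletion which, given an instance $(G,k)$, either correctly declares that $(G,k)$ is a no-instance or outputs an instance $(G',k')$ of Diamond-free Edge Deletion that is a yes-instance if and only if $(G,k)$ is, with $|V(G')| = O(k^3)$ and $k'\leq k$. (b) For every fixed integer $t\geq 4$, there is a polynomial-time kernelization algorithm for $\{$Diamond, $K_t\}$-free Edge Deletion which, given an instance $(G,k)$, either correctly declares that $(G,k)$ is a no-instance or outputs an equivalent instance $(G',k')$ of the same problem with $|V(G')| = O(k^2)$ and $k'\leq k$.
   Context: All graphs are finite, simple and undirected. A diamond is the graph obtained from $K_4$ by deleting one edge. For a graph $G$ and $F\subseteq E(G)$, $G-F$ is obtained by deleting the edges in $F$. Diamond-free Edge Deletion: given a graph $G$ and an integer $k$, decide whether there is $F\subseteq E(G)$ with $|F|\leq k$ such that $G-F$ has no induced subgraph isomorphic to a diamond. For a fixed integer $t\geq 4$, $\{$Diamond, $K_t\}$-free Edge Deletion: given $(G,k)$, decide whether there is $F\subseteq E(G)$ with $|F|\leq k$ such that $G-F$ has no induced diamond and no $K_t$ subgraph. A kernelization algorithm runs in time polynomial in $|G|+k$ and maps an instance to an equivalent instance (yes-instance iff the original is). *)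

theory Defs
  imports
    "HOL-Library.Ramsey"
    "HOL-Library.Landau_Symbols"
    "HOL-Computational_Algebra.Polynomial"
begin

section \<open>Graphs\<close>

datatype 'a graph = Graph (verts: "'a set") (edges: "'a set set")

definition simple_graph :: "'a graph \<Rightarrow> bool" where
  "simple_graph G \<longleftrightarrow> finite (verts G) \<and> edges G \<subseteq> nsets (verts G) 2"

definition graph_size :: "'a graph \<Rightarrow> nat" where
  "graph_size G = card (verts G) + card (edges G)"

definition delete_edges :: "'a graph \<Rightarrow> 'a set set \<Rightarrow> 'a graph" where
  "delete_edges G F = Graph (verts G) (edges G - F)"

definition induced_subgraph :: "'a graph \<Rightarrow> 'a set \<Rightarrow> 'a graph" where
  "induced_subgraph G W = Graph W {e \<in> edges G. e \<subseteq> W}"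

definition subgraph :: "'a graph \<Rightarrow> 'a graph \<Rightarrow> bool" where
  "subgraph H G \<longleftrightarrow> simple_graph H \<and> verts H \<subseteq> verts G \<and> edges H \<subseteq> edges G"

definition graph_iso :: "'a graph \<Rightarrow> 'b graph \<Rightarrow> bool" where
  "graph_iso G H \<longleftrightarrow>
     (\<exists>h. bij_betw h (verts G) (verts H) \<and>
          (\<forall>u\<in>verts G. \<forall>v\<in>verts G. {u, v} \<in> edges G \<longleftrightarrow> {h u, h v} \<in> edges H))"

definition complete_graph :: "nat \<Rightarrow> nat graph" where
  "complete_graph t = Graph {..<t} (nsets {..<t} 2)"

definition diamond :: "nat graph" where
  "diamond = delete_edges (complete_graph 4) {{0, 1}}"

definition diamond_free :: "'a graph \<Rightarrow> bool" where
  "diamond_free G \<longleftrightarrow> \<not> (\<exists>W\<subseteq>verts G. graph_iso (induced_subgraph G W) diamond)"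

definition complete_free :: "nat \<Rightarrow> 'a graph \<Rightarrow> bool" where
  "complete_free t G \<longleftrightarrow> \<not> (\<exists>H. subgraph H G \<and> graph_iso H (complete_graph t))"

definition diamond_free_edge_deletion :: "'a graph \<Rightarrow> nat \<Rightarrow> bool" where
  "diamond_free_edge_deletion G k \<longleftrightarrow>
     (\<exists>F\<subseteq>edges G. card F \<le> k \<and> diamond_free (delete_edges G F))"

definition diamond_complete_free_edge_deletion :: "nat \<Rightarrow> 'a graph \<Rightarrow> nat \<Rightarrow> bool" where
  "diamond_complete_free_edge_deletion t G k \<longleftrightarrow>
     (\<exists>F\<subseteq>edges G. card F \<le> k \<and>
        diamond_free (delete_edges G F) \<and> complete_free t (delete_edges G F))"

section \<open>Machine model\<close>

text \<open>
  A structured random access machine. A memory cell is addressed by a name together with a tuple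
  of indices; scalars are cells with the empty tuple, arrays of any dimension use longer tuples.
  Every command and every test costs one unit of time. Expressions have a size that is fixed by
  the program, and the only arithmetic is addition and truncated subtraction (no multiplication),
  so a computation of \<open>t\<close> steps only creates numbers with \<open>O(t)\<close> more bits than the input and
  the program have. Running times are therefore polynomially related to those of Turing machines.
\<close>

type_synonym state = "string \<Rightarrow> nat list \<Rightarrow> nat"

datatype aexp = N nat | Cell string "aexp list" | Plus aexp aexp | Minus aexp aexp

fun aval :: "aexp \<Rightarrow> state \<Rightarrow> nat" where
  "aval (N n) s = n"
| "aval (Cell x es) s = s x (map (\<lambda>e. aval e s) es)"
| "aval (Plus a b) s = aval a s + aval b s"
| "aval (Minus a b) s = aval a s - aval b s"

datatype bexp = Less aexp aexp | Neg bexp | Conj bexp bexp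

fun bval :: "bexp \<Rightarrow> state \<Rightarrow> bool" where
  "bval (Less a b) s \<longleftrightarrow> aval a s < aval b s"
| "bval (Neg b) s \<longleftrightarrow> \<not> bval b s"
| "bval (Conj a b) s \<longleftrightarrow> bval a s \<and> bval b s"

datatype com =
    Skip
  | Assign string "aexp list" aexp
  | Seq com com
  | Cond bexp com com
  | While bexp com

definition store :: "state \<Rightarrow> string \<Rightarrow> nat list \<Rightarrow> nat \<Rightarrow> state" where
  "store s x is v = s(x := (s x)(is := v))"

text \<open>\<open>exec c s t s'\<close>: started in \<open>s\<close>, the program \<open>c\<close> halts in \<open>s'\<close> after exactly \<open>t\<close> steps.\<close>

inductive exec :: "com \<Rightarrow> state \<Rightarrow> nat \<Rightarrow> state \<Rightarrow> bool" where
  Skip: "exec Skip s 1 s"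
| Assign: "exec (Assign x es a) s 1 (store s x (map (\<lambda>e. aval e s) es) (aval a s))"
| Seq: "exec c1 s1 t1 s2 \<Longrightarrow> exec c2 s2 t2 s3 \<Longrightarrow> exec (Seq c1 c2) s1 (t1 + t2) s3"
| CondTrue: "bval b s \<Longrightarrow> exec c1 s t s' \<Longrightarrow> exec (Cond b c1 c2) s (1 + t) s'"
| CondFalse: "\<not> bval b s \<Longrightarrow> exec c2 s t s' \<Longrightarrow> exec (Cond b c1 c2) s (1 + t) s'"
| WhileFalse: "\<not> bval b s \<Longrightarrow> exec (While b c) s 1 s"
| WhileTrue: "bval b s1 \<Longrightarrow> exec c s1 t1 s2 \<Longrightarrow> exec (While b c) s2 t2 s3 \<Longrightarrow>
    exec (While b c) s1 (1 + t1 + t2) s3"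

inductive_cases SkipE: "exec Skip s t s'"
inductive_cases AssignE: "exec (Assign x es a) s t s'"
inductive_cases SeqE: "exec (Seq c1 c2) s t s'"
inductive_cases CondE: "exec (Cond b c1 c2) s t s'"
inductive_cases WhileE: "exec (While b c) s t s'"

lemma exec_deterministic:
  "exec c s t s' \<Longrightarrow> exec c s u s'' \<Longrightarrow> u = t \<and> s'' = s'"
proof (induction arbitrary: u s'' rule: exec.induct)
  case (Skip s)
  then show ?case by (auto elim: SkipE)
next
  case (Assign x es a s)
  then show ?case by (auto elim: AssignE)
next
  case (Seq c1 s1 t1 s2 c2 t2 s3)
  from Seq.prems obtain u1 u2 r where "exec c1 s1 u1 r" "exec c2 r u2 s''" "u = u1 + u2"
    by (rule SeqE)
  with Seq.IH show ?case by metis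
next
  case (CondTrue b s c1 t s' c2)
  from CondTrue.prems CondTrue.hyps(1) obtain v where "exec c1 s v s''" "u = 1 + v"
    by (cases rule: CondE) auto
  with CondTrue.IH show ?case by metis
next
  case (CondFalse b s c2 t s' c1)
  from CondFalse.prems CondFalse.hyps(1) obtain v where "exec c2 s v s''" "u = 1 + v"
    by (cases rule: CondE) auto
  with CondFalse.IH show ?case by metis
next
  case (WhileFalse b s c)
  from WhileFalse.prems WhileFalse.hyps show ?case by (cases rule: WhileE) auto
next
  case (WhileTrue b s1 c t1 s2 t2 s3)
  from WhileTrue.prems WhileTrue.hyps(1) obtain u1 u2 r
    where "exec c s1 u1 r" "exec (While b c) r u2 s''" "u = 1 + u1 + u2"
    by (cases rule: WhileE) auto
  with WhileTrue.IH show ?case by metis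
qed

section \<open>Kernelization\<close>

text \<open>
  An instance is stored as the number of vertices, the parameter and the adjacency matrix; the
  vertices are numbered from \<open>0\<close>.
\<close>

definition stores_instance :: "state \<Rightarrow> nat graph \<Rightarrow> nat \<Rightarrow> bool" where
  "stores_instance s G k \<longleftrightarrow>
     simple_graph G \<and> verts G = {..<s ''n'' []} \<and> s ''k'' [] = k \<and>
     (\<forall>u\<in>verts G. \<forall>v\<in>verts G. s ''adj'' [u, v] = of_bool ({u, v} \<in> edges G))"

definition input_state :: "nat graph \<Rightarrow> nat \<Rightarrow> state" where
  "input_state G k =
     (\<lambda>x is. if x = ''n'' \<and> is = [] then card (verts G)
             else if x = ''k'' \<and> is = [] then k
             else if x = ''adj'' \<and> (\<exists>u v. is = [u, v] \<and> {u, v} \<in> edges G) then 1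
             else 0)"

lemma stores_instance_input_state:
  "simple_graph G \<Longrightarrow> verts G = {..<n} \<Longrightarrow> stores_instance (input_state G k) G k"
  by (auto simp: stores_instance_def input_state_def)

text \<open>
  The program \<open>c\<close> is a polynomial-time kernelization for the problem \<open>P\<close> whose output graphs have
  at most \<open>f k\<close> vertices. A nonzero cell \<open>''no''\<close> on halting declares the input a no-instance.
\<close>

definition kernelization :: "(nat graph \<Rightarrow> nat \<Rightarrow> bool) \<Rightarrow> (nat \<Rightarrow> nat) \<Rightarrow> com \<Rightarrow> bool" where
  "kernelization P f c \<longleftrightarrow>
     (\<exists>p :: nat poly. \<forall>n G k. simple_graph G \<and> verts G = {..<n} \<longrightarrow>
        (\<exists>t s. exec c (input_state G k) t s \<and> t \<le> poly p (graph_size G + k) \<and>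
          (if s ''no'' [] \<noteq> 0 then \<not> P G k
           else \<exists>G' k'. stores_instance s G' k' \<and> (P G' k' \<longleftrightarrow> P G k) \<and>
                  card (verts G') \<le> f k \<and> k' \<le> k)))"

end

theory Submission
  imports Defs
begin

text \<open>
  Call \<open>K(uv) = {u, v} \<union> (N(u) \<inter> N(v))\<close> the hull of an edge, and a vertex \<open>w\<close> of a clique \<open>K\<close> simplicial
  at \<open>K\<close> if every triangle containing an edge from \<open>w\<close> into \<open>K\<close> lies in \<open>K\<close>. Two rules are applied
  exhaustively. If the non-edges inside \<open>N(u) \<inter> N(v)\<close> contain a matching of size greater than \<open>k\<close>, then
  the diamonds it yields share only the edge \<open>uv\<close>, which must therefore be deleted. If the hull \<open>K\<close> of
  an edge is a clique all of whose vertices are simplicial (and smaller than \<open>K\<^sub>t\<close>), or, for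
  diamonds only, if it has at least \<open>2k + 4\<close> simplicial vertices, then the edges from one simplicial
  vertex into \<open>K\<close> may be dropped.

  For a reduced yes-instance take a maximal packing of at most \<open>k\<close> edge-disjoint obstructions and let
  \<open>V\<close> be its vertex set, of size \<open>O(k)\<close>. Outside \<open>V\<close> every neighbourhood is a disjoint union of
  cliques. Because of the second rule, every non-isolated vertex outside \<open>V\<close> belongs to a clique of
  \<open>N(x) - V\<close> that meets \<open>N(y)\<close>, for adjacent \<open>x, y \<in> V\<close>. By the first rule there are at most
  \<open>2k + 1\<close> such cliques if \<open>xy\<close> is one of the \<open>O(k)\<close> packed edges, and otherwise there is at most one. This
  gives \<open>O(k\<^sup>2)\<close> cliques, each of size less than \<open>t\<close>, or with \<open>O(k)\<close> vertices up to \<open>O(k\<^sup>2)\<close>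
  exceptional vertices in total when only diamonds are forbidden.
\<close>

section \<open>Edge sets\<close>

text \<open>Both problems depend on the edge set alone, so graphs become edge sets and every rule
  only deletes edges. A vertex is disposed of by losing its edges; the size bound counts vertices
  lying on an edge, and the others are cut off at the end. A maximum matching is never computed. The
  at most \<open>2 * k\<close> vertices of a greedy matching with at most \<open>k\<close> pairs
  meet every non-edge of the common neighbourhood; with one vertex of the remaining clique this
  gives \<open>2k + 1\<close>. The graph outside \<open>V\<close> is rigid because an obstruction
  contains both ends of a packed edge, hence two vertices of \<open>V\<close>. If only diamonds are
  forbidden, the cliques to be counted have no a priori size bound, so most of their vertices must
  be shown simplicial. A vertex \<open>v\<close> could fail only through a triangle with two
  vertices of \<open>V\<close>. Then \<open>v\<close> lies in a clique counted for these two, and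
  unless \<open>v\<close> itself represents that clique, its representative shows that the triangle
  stays in the hull. The exceptional vertices are these representatives.\<close>

definition simple_edges :: "'a set set \<Rightarrow> bool" where
  "simple_edges E \<longleftrightarrow> finite E \<and> (\<forall>e\<in>E. card e = 2)"

definition common_nbrs :: "'a set set \<Rightarrow> 'a \<Rightarrow> 'a \<Rightarrow> 'a set" where
  "common_nbrs E u v = {z. {u, z} \<in> E \<and> {v, z} \<in> E}"

definition diamond_at :: "'a set set \<Rightarrow> 'a \<Rightarrow> 'a \<Rightarrow> 'a \<Rightarrow> 'a \<Rightarrow> bool" where
  "diamond_at E a b c d \<longleftrightarrow> a \<noteq> b \<and> {a, b} \<notin> E \<and>
     {a, c} \<in> E \<and> {a, d} \<in> E \<and> {b, c} \<in> E \<and> {b, d} \<in> E \<and> {c, d} \<in> E"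

definition is_clique :: "'a set set \<Rightarrow> 'a set \<Rightarrow> bool" where
  "is_clique E K \<longleftrightarrow> (\<forall>a\<in>K. \<forall>b\<in>K. a \<noteq> b \<longrightarrow> {a, b} \<in> E)"

text \<open>The value \<open>t = 0\<close> stands for the problem without a forbidden clique.\<close>

definition obstruction_free :: "nat \<Rightarrow> 'a set set \<Rightarrow> bool" where
  "obstruction_free t E \<longleftrightarrow> (\<nexists>a b c d. diamond_at E a b c d) \<and>
     (t \<noteq> 0 \<longrightarrow> (\<nexists>S. card S = t \<and> is_clique E S))"

definition solvable :: "nat \<Rightarrow> 'a set set \<Rightarrow> nat \<Rightarrow> bool" where
  "solvable t E k \<longleftrightarrow> (\<exists>F\<subseteq>E. card F \<le> k \<and> obstruction_free t (E - F))"

definition edge_hull :: "'a set set \<Rightarrow> 'a \<Rightarrow> 'a \<Rightarrow> 'a set" where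
  "edge_hull E u v = insert u (insert v (common_nbrs E u v))"

definition simplicial_verts :: "'a set set \<Rightarrow> 'a set \<Rightarrow> 'a set" where
  "simplicial_verts E K = {w \<in> K. \<forall>a\<in>K. a \<noteq> w \<longrightarrow> common_nbrs E w a \<subseteq> K}"

definition detach :: "'a set set \<Rightarrow> 'a \<Rightarrow> 'a set \<Rightarrow> 'a set set" where
  "detach E w K = E - {{w, a} |a. a \<in> K}"

lemma simple_edges_subset: "simple_edges E \<Longrightarrow> E' \<subseteq> E \<Longrightarrow> simple_edges E'"
  unfolding simple_edges_def by (meson finite_subset subsetD)

lemma edge_neq: "simple_edges E \<Longrightarrow> {a, b} \<in> E \<Longrightarrow> a \<noteq> b"
  unfolding simple_edges_def by fastforce

lemma edge_commute: "{a, b} \<in> E \<longleftrightarrow> {b, a} \<in> E"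
  by (simp add: insert_commute)

lemma simple_edges_finite: "simple_edges E \<Longrightarrow> finite (\<Union>E)"
  unfolding simple_edges_def by (metis card.infinite finite_Union zero_neq_numeral)

lemma obstruction_freeD_clique:
  "obstruction_free t E \<Longrightarrow> t \<noteq> 0 \<Longrightarrow> card S = t \<Longrightarrow> \<not> is_clique E S"
  unfolding obstruction_free_def by blast

lemma obstruction_freeD_diamond: "obstruction_free t E \<Longrightarrow> \<not> diamond_at E a b c d"
  unfolding obstruction_free_def by blast

lemma is_cliqueD: "is_clique E K \<Longrightarrow> a \<in> K \<Longrightarrow> b \<in> K \<Longrightarrow> a \<noteq> b \<Longrightarrow> {a, b} \<in> E"
  unfolding is_clique_def by blast

lemma is_clique_mono: "is_clique E K \<Longrightarrow> E \<subseteq> E' \<Longrightarrow> is_clique E' K"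
  unfolding is_clique_def by blast

section \<open>Reduction rules\<close>

text \<open>Each pair of \<open>M\<close> spans a diamond together with \<open>u\<close> and
  \<open>v\<close>. If \<open>{u, v}\<close> is kept, \<open>F\<close> must contain an edge from
  \<open>u\<close> or \<open>v\<close> to that pair, and disjoint pairs require different
  edges.\<close>

lemma sunflower_edge:
  assumes E: "simple_edges E" and uv: "{u, v} \<in> E" "{u, v} \<notin> F" and F: "finite F"
    and free: "obstruction_free t (E - F)"
    and M: "\<And>p. p \<in> M \<Longrightarrow> card p = 2 \<and> p \<notin> E \<and> p \<subseteq> common_nbrs E u v"
    and disj: "\<And>p q. p \<in> M \<Longrightarrow> q \<in> M \<Longrightarrow> p \<noteq> q \<Longrightarrow> p \<inter> q = {}"
  shows "card M \<le> card F"
proof -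
  have "\<exists>e\<in>F. \<exists>x\<in>p. e = {u, x} \<or> e = {v, x}" if p: "p \<in> M" for p
  proof -
    obtain a b where ab: "p = {a, b}" "a \<noteq> b" using M[OF p] by (meson card_2_iff)
    have "\<not> diamond_at (E - F) a b u v" using free by (rule obstruction_freeD_diamond)
    then show ?thesis using M[OF p] uv ab unfolding diamond_at_def common_nbrs_def
      by (auto simp: insert_commute)
  qed
  then obtain g where g: "\<And>p. p \<in> M \<Longrightarrow> g p \<in> F \<and> (\<exists>x\<in>p. g p = {u, x} \<or> g p = {v, x})"
    by metis
  have "inj_on g M"
  proof (rule inj_onI, rule ccontr)
    fix p q assume pq: "p \<in> M" "q \<in> M" "g p = g q" "p \<noteq> q"
    obtain x where x: "x \<in> p" "g p = {u, x} \<or> g p = {v, x}" using g pq(1) by blast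
    obtain y where y: "y \<in> q" "g p = {u, y} \<or> g p = {v, y}" using g[OF pq(2)] pq(3) by auto
    \<comment> \<open>\<open>x\<close> and \<open>y\<close> differ from \<open>u\<close> and
      \<open>v\<close>, so an edge chosen for both pairs determines its end in either of
      them.\<close>
    have "{u, x} \<in> E" "{v, x} \<in> E" "{u, y} \<in> E" "{v, y} \<in> E"
      using M pq x y unfolding common_nbrs_def by blast+
    then have "x \<noteq> u" "x \<noteq> v" "y \<noteq> u" "y \<noteq> v" using edge_neq[OF E] by blast+
    then have "x = y" using x y by (auto simp: doubleton_eq_iff)
    then show False using disj[OF pq(1,2,4)] x y by blast
  qed
  then show ?thesis using card_inj_on_le[of g M F] g F by blast
qed

lemma solvable_forced_edge:
  assumes E: "simple_edges E" and uv: "{u, v} \<in> E"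
    and M: "\<And>p. p \<in> M \<Longrightarrow> card p = 2 \<and> p \<notin> E \<and> p \<subseteq> common_nbrs E u v"
    and disj: "\<And>p q. p \<in> M \<Longrightarrow> q \<in> M \<Longrightarrow> p \<noteq> q \<Longrightarrow> p \<inter> q = {}"
    and k: "k < card M"
  shows "solvable t E k \<longleftrightarrow> k > 0 \<and> solvable t (E - {{u, v}}) (k - 1)"
proof
  assume "solvable t E k"
  then obtain F where F: "F \<subseteq> E" "card F \<le> k" "obstruction_free t (E - F)"
    unfolding solvable_def by blast
  have fF: "finite F" using F(1) E unfolding simple_edges_def by (meson finite_subset)
  have uvF: "{u, v} \<in> F"
    using sunflower_edge[OF E uv _ fF F(3) M disj] k F(2) by fastforce
  then have "card F > 0" "card (F - {{u, v}}) = card F - 1" using fF by (auto simp: card_gt_0_iff)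
  moreover have "E - {{u, v}} - (F - {{u, v}}) = E - F" using uvF by blast
  ultimately show "k > 0 \<and> solvable t (E - {{u, v}}) (k - 1)"
    unfolding solvable_def using F by (intro conjI exI[of _ "F - {{u, v}}"]) auto
next
  assume "k > 0 \<and> solvable t (E - {{u, v}}) (k - 1)"
  then obtain F where F: "F \<subseteq> E - {{u, v}}" "card F \<le> k - 1"
      "obstruction_free t (E - {{u, v}} - F)" and k0: "k > 0"
    unfolding solvable_def by blast
  have "card (insert {u, v} F) \<le> k" using F(2) k0 card_insert_le_m1[of k F "{u, v}"] by simp
  moreover have "E - {{u, v}} - F = E - insert {u, v} F" by blast
  ultimately show "solvable t E k" unfolding solvable_def using F(1,3) uv
    by (intro exI[of _ "insert {u, v} F"]) (metis Diff_subset insert_subset subset_trans)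
qed

lemma simplicialD:
  "w \<in> simplicial_verts E K \<Longrightarrow> a \<in> K \<Longrightarrow> a \<noteq> w \<Longrightarrow> {w, z} \<in> E \<Longrightarrow> {a, z} \<in> E \<Longrightarrow> z \<in> K"
  unfolding simplicial_verts_def common_nbrs_def by blast

lemma mem_detach: "{a, b} \<in> detach E w K \<longleftrightarrow> {a, b} \<in> E \<and> \<not> (a = w \<and> b \<in> K) \<and> \<not> (b = w \<and> a \<in> K)"
  unfolding detach_def by (auto simp: doubleton_eq_iff)

lemma detach_subset: "detach E w K \<subseteq> E"
  unfolding detach_def by blast

text \<open>A diamond that exists only after detaching has lost the edge between its two nonadjacent
  vertices, which are therefore \<open>w\<close> and some vertex of \<open>K\<close>. A common
  neighbour of these two lies outside \<open>K\<close>, since its edge to \<open>w\<close> survived;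
  this contradicts that \<open>w\<close> is simplicial. No clique is created by deleting
  edges.\<close>

lemma solvable_detachI:
  assumes E: "simple_edges E" and w: "w \<in> simplicial_verts E K" and sol: "solvable t E k"
  shows "solvable t (detach E w K) k"
proof -
  obtain F where F: "F \<subseteq> E" "card F \<le> k" "obstruction_free t (E - F)"
    using sol unfolding solvable_def by blast
  define E1 where "E1 = detach E w K"
  define F1 where "F1 = F \<inter> E1"
  have fF: "finite F" using F(1) E unfolding simple_edges_def by (meson finite_subset)
  have mem1: "{a, b} \<in> E1 - F1 \<longleftrightarrow> {a, b} \<in> E - F \<and> \<not> (a = w \<and> b \<in> K) \<and> \<not> (b = w \<and> a \<in> K)" for a b
    unfolding F1_def E1_def using mem_detach[of a b E w K] by blast
  have "\<not> diamond_at (E1 - F1) a b c d" for a b c d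
  proof
    assume D: "diamond_at (E1 - F1) a b c d"
    have "\<not> diamond_at (E - F) a b c d" using F(3) by (rule obstruction_freeD_diamond)
    then have "a = w \<and> b \<in> K \<or> b = w \<and> a \<in> K"
      using D unfolding diamond_at_def mem1 by blast
    then show False
    proof
      assume "a = w \<and> b \<in> K"
      moreover have "{w, c} \<in> E" "{b, c} \<in> E" "b \<noteq> w" "c \<notin> K"
        using D calculation unfolding diamond_at_def mem1 by auto
      ultimately show False using simplicialD[OF w] by blast
    next
      assume "b = w \<and> a \<in> K"
      moreover have "{w, c} \<in> E" "{a, c} \<in> E" "a \<noteq> w" "c \<notin> K"
        using D calculation unfolding diamond_at_def mem1 by auto
      ultimately show False using simplicialD[OF w] by blast
    qed
  qed
  moreover have "\<not> is_clique (E1 - F1) S" if "t \<noteq> 0" "card S = t" for S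
    using obstruction_freeD_clique[OF F(3) that] is_clique_mono[of "E1 - F1" S "E - F"]
    unfolding F1_def E1_def using detach_subset[of E w K] by blast
  ultimately have "obstruction_free t (E1 - F1)" unfolding obstruction_free_def by blast
  moreover have "card F1 \<le> k" unfolding F1_def using F(2) card_mono[OF fF] by (meson inf_le1 le_trans)
  ultimately show ?thesis unfolding solvable_def E1_def[symmetric] by (intro exI[of _ F1]) (auto simp: F1_def)
qed


text \<open>The deleted edges inside \<open>K\<close> are put back. As every triangle with an edge
  in \<open>K\<close> lies in \<open>K\<close>, a diamond using such an edge would lie in
  \<open>K\<close>, where no edge is missing. Hence a diamond avoids the edges of \<open>K\<close>
  and is already present in the detached graph. A clique with two vertices in \<open>K\<close> lies
  in \<open>K\<close>, which is too small to be forbidden.\<close>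

lemma solvable_undetach_isolated:
  assumes t: "t = 0 \<or> 3 \<le> t \<and> card K < t" and K: "is_clique E K" "simplicial_verts E K = K"
    and fin: "finite K" and w: "w \<in> K" and E: "simple_edges E"
    and sol: "solvable t (detach E w K) k"
  shows "solvable t E k"
proof -
  define E1 where "E1 = detach E w K"
  obtain F where F: "F \<subseteq> E1" "card F \<le> k" "obstruction_free t (E1 - F)"
    using sol unfolding solvable_def E1_def by blast
  define F' where "F' = {e \<in> F. \<not> e \<subseteq> K}"
  have closed: "z \<in> K" if "{a, z} \<in> E - F'" "{b, z} \<in> E - F'" "a \<in> K" "b \<in> K" "a \<noteq> b" for a b z
    using simplicialD[of a E K b z] that K(2) by simp
  have outside: "{a, b} \<in> E - F' \<longleftrightarrow> {a, b} \<in> E1 - F" if "\<not> (a \<in> K \<and> b \<in> K)" for a b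
    using that w unfolding F'_def E1_def Diff_iff mem_detach[of a b E w K] by auto
  have inside: "{a, b} \<in> E - F'" if "a \<in> K" "b \<in> K" "a \<noteq> b" for a b
    using that K(1) unfolding F'_def is_clique_def by auto
  have "\<not> diamond_at (E - F') a b c d" for a b c d
  proof
    assume D: "diamond_at (E - F') a b c d"
    have neq: "c \<noteq> d" "a \<noteq> c" "a \<noteq> d" "b \<noteq> c" "b \<noteq> d"
      using D edge_neq[OF E] unfolding diamond_at_def by blast+
    have adj: "{a, c} \<in> E - F'" "{a, d} \<in> E - F'" "{b, c} \<in> E - F'" "{b, d} \<in> E - F'"
      "{c, d} \<in> E - F'" "{c, a} \<in> E - F'" "{d, a} \<in> E - F'" "{c, b} \<in> E - F'" "{d, b} \<in> E - F'"
      "{d, c} \<in> E - F'"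
      using D unfolding diamond_at_def by (simp_all add: insert_commute)
    have ab: "\<not> (a \<in> K \<and> b \<in> K)" using D inside unfolding diamond_at_def by blast
    have cd: "\<not> (c \<in> K \<and> d \<in> K)" using closed[of c _ d] adj neq ab by blast
    have "\<not> (a \<in> K \<and> c \<in> K)" using closed[of a d c] adj neq cd by blast
    moreover have "\<not> (a \<in> K \<and> d \<in> K)" using closed[of a c d] adj neq cd by blast
    moreover have "\<not> (b \<in> K \<and> c \<in> K)" using closed[of b d c] adj neq cd by blast
    moreover have "\<not> (b \<in> K \<and> d \<in> K)" using closed[of b c d] adj neq cd by blast
    ultimately have "diamond_at (E1 - F) a b c d"
      using D ab cd outside[of a b] outside[of a c] outside[of a d] outside[of b c] outside[of b d]
        outside[of c d] unfolding diamond_at_def by blast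
    then show False using obstruction_freeD_diamond[OF F(3)] by blast
  qed
  moreover have "\<not> is_clique (E - F') S" if S: "t \<noteq> 0" "card S = t" for S
  proof
    assume C: "is_clique (E - F') S"
    show False
    proof (cases "\<exists>a\<in>S. \<exists>b\<in>S. a \<noteq> b \<and> a \<in> K \<and> b \<in> K")
      case True
      then obtain a b where ab: "a \<in> S" "b \<in> S" "a \<noteq> b" "a \<in> K" "b \<in> K" by blast
      have "z \<in> K" if z: "z \<in> S" for z
      proof (cases "z = a \<or> z = b")
        case False
        then show ?thesis using closed[of a z b] is_cliqueD[OF C] ab z by metis
      qed (use ab in auto)
      then have "card S \<le> card K" using fin by (meson card_mono subsetI)
      then show False using t S by linarith
    next
      case False
      then have "is_clique (E1 - F) S" using is_cliqueD[OF C] outside unfolding is_clique_def by metis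
      then show False using obstruction_freeD_clique[OF F(3) S] by blast
    qed
  qed
  ultimately have "obstruction_free t (E - F')" unfolding obstruction_free_def by blast
  moreover have "F' \<subseteq> E" using F(1) detach_subset[of E w K] unfolding F'_def E1_def by blast
  moreover have "finite F" using F(1) detach_subset[of E w K] E unfolding E1_def simple_edges_def
    by (meson finite_subset)
  then have "card F' \<le> card F" unfolding F'_def by (intro card_mono) auto
  ultimately show ?thesis unfolding solvable_def using F(2) le_trans by blast
qed

lemma card_Union_edges_le:
  assumes "simple_edges F"
  shows "card (\<Union>F) \<le> 2 * card F"
proof -
  have "card (\<Union>F) \<le> (\<Sum>e\<in>F. card e)" using card_Union_le_sum_card by blast
  also have "\<dots> = (\<Sum>e\<in>F. 2)" using assms unfolding simple_edges_def by (intro sum.cong) auto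
  finally show ?thesis by simp
qed

text \<open>
  A solution of the detached instance misses some vertex \<open>v\<close> simplicial at \<open>K\<close>. Deleting an edge
  inside \<open>K\<close> would force at least \<open>card K - 3\<close> further deletions because of \<open>v\<close>, so \<open>K\<close> survives,
  and \<open>v\<close> can play the role of \<open>w\<close> in any diamond.
\<close>

lemma solvable_undetach_many_simplicial:
  assumes K: "is_clique E K" and fin: "finite K" and w: "w \<in> simplicial_verts E K"
    and many: "2 * k + 4 \<le> card (simplicial_verts E K)" and E: "simple_edges E"
    and sol: "solvable 0 (detach E w K) k"
  shows "solvable 0 E k"
proof -
  define E1 where "E1 = detach E w K"
  define S where "S = simplicial_verts E K"
  obtain F where F: "F \<subseteq> E1" "card F \<le> k" "obstruction_free 0 (E1 - F)"
    using sol unfolding solvable_def E1_def by blast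
  note nodia = obstruction_freeD_diamond[OF F(3)]
  have E1E: "E1 \<subseteq> E" unfolding E1_def by (rule detach_subset)
  have sF: "simple_edges F" using F(1) E1E simple_edges_subset[OF E] by blast
  have fF: "finite F" using sF unfolding simple_edges_def by blast
  have SK: "S \<subseteq> K" unfolding S_def simplicial_verts_def by blast
  have wK: "w \<in> K" using w SK S_def by blast
  \<comment> \<open>The edges of \<open>F\<close> cover at most \<open>2 * k\<close> vertices and
    \<open>w\<close> is one more, so a simplicial vertex remains.\<close>
  have "card (insert w (\<Union>F)) \<le> Suc (card (\<Union>F))" by (rule card_insert_le_m1) auto
  also have "\<dots> < card S" using card_Union_edges_le[OF sF] F(2) many unfolding S_def by linarith
  finally have "\<not> S \<subseteq> insert w (\<Union>F)"
    using card_mono[of "insert w (\<Union>F)" S] simple_edges_finite[OF sF] by fastforce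
  then obtain v where v: "v \<in> S" "v \<noteq> w" "v \<notin> \<Union>F" by blast
  have vK: "v \<in> K" using v SK by blast
  have Kadj: "{a, b} \<in> E1" if "a \<in> K" "b \<in> K" "a \<noteq> b" "a \<noteq> w" "b \<noteq> w" for a b
    using that K unfolding E1_def mem_detach is_clique_def by blast
  have vadj: "{v, a} \<in> E1 - F" "{a, v} \<in> E1 - F" if "a \<in> K" "a \<noteq> v" "a \<noteq> w" for a
    using Kadj[OF vK that(1)] that v by (auto simp: insert_commute)
  \<comment> \<open>If \<open>{a, b}\<close> were deleted, then for every \<open>c\<close> in
    \<open>K\<close> other than \<open>a\<close>, \<open>b\<close>, \<open>v\<close>,
    \<open>w\<close> the diamond on \<open>a\<close>, \<open>b\<close>, \<open>c\<close>,
    \<open>v\<close> would force \<open>{a, c}\<close> or \<open>{b, c}\<close> into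
    \<open>F\<close>. Together with \<open>{a, b}\<close> these are at least
    \<open>card K - 3\<close> edges, more than \<open>k\<close> because \<open>card K\<close> is at
    least \<open>2 * k + 4\<close>.\<close>
  have intact: "{a, b} \<notin> F" if ab: "a \<in> K" "b \<in> K" for a b
  proof
    assume abF: "{a, b} \<in> F"
    then have "{a, b} \<in> E1" using F(1) by blast
    then have ne: "a \<noteq> b" "a \<noteq> w" "b \<noteq> w" "a \<noteq> v" "b \<noteq> v"
      using edge_neq[OF E] E1E ab v abF unfolding E1_def mem_detach by blast+
    define R where "R = K - {a, b, v, w}"
    have "\<exists>e\<in>F. e = {a, c} \<or> e = {b, c}" if c: "c \<in> R" for c
    proof -
      have "\<not> diamond_at (E1 - F) a b c v" using nodia .
      then show ?thesis using vadj[of a] vadj[of b] vadj[of c] abF ne c ab Kadj[of a c] Kadj[of b c]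
        unfolding diamond_at_def R_def by blast
    qed
    then obtain g where g: "\<And>c. c \<in> R \<Longrightarrow> g c \<in> F \<and> (g c = {a, c} \<or> g c = {b, c})" by metis
    have "inj_on g R" using g unfolding R_def by (intro inj_onI) (metis DiffD2 doubleton_eq_iff insertCI)
    have "{a, b} \<notin> g ` R" using g ne unfolding R_def by (auto simp: doubleton_eq_iff)
    then have "card (g ` R) < card F" using psubset_card_mono[OF fF, of "g ` R"] g abF by blast
    then have "card R < card F" using card_image[OF \<open>inj_on g R\<close>] by simp
    moreover have "card K - card {a, b, v, w} \<le> card R" unfolding R_def by (rule diff_card_le_card_Diff) simp
    moreover have "card {a, b, v, w} \<le> 4" by (simp add: card_insert_if)
    moreover have "card S \<le> card K" using SK fin by (rule card_mono[rotated])
    ultimately show False using many F(2) unfolding S_def by linarith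
  qed
  have lift: "{a, b} \<in> E1 - F" if "{a, b} \<in> E - F" "a \<noteq> w" "b \<noteq> w" for a b
    using that unfolding E1_def Diff_iff mem_detach by blast
  have KF: "{a, b} \<in> E - F" if "a \<in> K" "b \<in> K" "a \<noteq> b" for a b
    using intact that K unfolding is_clique_def by blast
  have wcl: "z \<in> K" if "{w, a} \<in> E" "{w, z} \<in> E" "{a, z} \<in> E" "a \<in> K" for a z
    using simplicialD[OF w] edge_neq[OF E that(1)] that by blast
  \<comment> \<open>Here \<open>w\<close> is one of the two nonadjacent vertices. Since
    \<open>q\<close> lies outside \<open>K\<close> and \<open>v\<close> is simplicial,
    \<open>v\<close> is adjacent to \<open>r\<close> and \<open>s\<close> but not to
    \<open>q\<close>, so it can replace \<open>w\<close>.\<close>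
  have tip: False if D: "diamond_at (E - F) w q r s" and r: "r \<in> K" for q r s
  proof -
    have e: "{w, r} \<in> E" "{w, s} \<in> E" "{r, s} \<in> E" "{q, r} \<in> E" "{q, s} \<in> E" "q \<noteq> w" "{w, q} \<notin> E - F"
      "{s, q} \<in> E" "{r, q} \<in> E"
      using D unfolding diamond_at_def by (auto simp: insert_commute)
    have s: "s \<in> K" using wcl[of r s] e r by blast
    have qK: "q \<notin> K" using KF[of w q] e wK by blast
    have ne: "r \<noteq> s" "r \<noteq> w" "s \<noteq> w" using edge_neq[OF E] e by blast+
    have vr: "v \<noteq> r" using simplicialD[of v E K s q] v e s qK ne S_def by blast
    have vs: "v \<noteq> s" using simplicialD[of v E K r q] v e r qK ne S_def by blast
    have vq: "{v, q} \<notin> E" using simplicialD[of v E K r q] v e r qK vr S_def by blast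
    have "diamond_at (E1 - F) v q r s"
      using D lift[of q r] lift[of q s] lift[of r s] vadj[of r] vadj[of s] ne e r s vr vs vq qK vK E1E
      unfolding diamond_at_def by blast
    then show False using nodia by blast
  qed
  \<comment> \<open>Here \<open>w\<close> is adjacent to all other vertices of the diamond. One
    further vertex in \<open>K\<close> pulls the whole diamond into \<open>K\<close>, which is still
    a clique after deleting \<open>F\<close>.\<close>
  have centre: False if D: "diamond_at (E - F) p q w s" and "p \<in> K \<or> q \<in> K \<or> s \<in> K" for p q s
  proof -
    have e: "{w, p} \<in> E" "{w, q} \<in> E" "{w, s} \<in> E" "{p, s} \<in> E" "{s, p} \<in> E" "{q, s} \<in> E" "{s, q} \<in> E"
      using D unfolding diamond_at_def by (auto simp: insert_commute)
    have "s \<in> K" using that(2) wcl[of p s] wcl[of q s] e by blast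
    then have "p \<in> K" "q \<in> K" using wcl[of s p] wcl[of s q] e by blast+
    then show False using KF[of p q] D unfolding diamond_at_def by blast
  qed
  have "\<not> diamond_at (E - F) a b c d" for a b c d
  proof
    assume D: "diamond_at (E - F) a b c d"
    then have D': "diamond_at (E - F) b a c d" "diamond_at (E - F) a b d c" "diamond_at (E - F) b a d c"
      unfolding diamond_at_def by (auto simp: insert_commute)
    have "\<not> diamond_at (E1 - F) a b c d" using nodia .
    moreover have "{p, q} \<in> E1 - F" if "{p, q} \<in> E - F" "\<not> (p = w \<and> q \<in> K)" "\<not> (q = w \<and> p \<in> K)" for p q
      using that unfolding E1_def Diff_iff mem_detach by blast
    ultimately have "(a = w \<or> b = w) \<and> (c \<in> K \<or> d \<in> K) \<or> (c = w \<or> d = w) \<and> (a \<in> K \<or> b \<in> K) \<or>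
        c = w \<and> d \<in> K \<or> d = w \<and> c \<in> K"
      using D E1E unfolding diamond_at_def by blast
    then show False using D D' tip centre by blast
  qed
  then have "obstruction_free 0 (E - F)" unfolding obstruction_free_def by blast
  then show ?thesis unfolding solvable_def using F(1,2) E1E by blast
qed

section \<open>Size of reduced yes-instances\<close>

lemma exists_maximal_independent:
  assumes "finite A"
  shows "\<exists>I\<subseteq>A. (\<forall>a\<in>I. \<forall>b\<in>I. {a, b} \<notin> E \<or> a = b) \<and> (\<forall>c\<in>A. \<exists>r\<in>I. r = c \<or> {r, c} \<in> E)"
proof -
  define P where "P = {I. I \<subseteq> A \<and> (\<forall>a\<in>I. \<forall>b\<in>I. {a, b} \<notin> E \<or> a = b)}"
  have "finite P" unfolding P_def using assms by simp
  moreover have "{} \<in> P" unfolding P_def by simp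
  ultimately obtain I where I: "I \<in> P" "\<And>J. J \<in> P \<Longrightarrow> I \<subseteq> J \<Longrightarrow> I = J"
    using finite_has_maximal[of P] by blast
  have "\<exists>r\<in>I. r = c \<or> {r, c} \<in> E" if c: "c \<in> A" for c
  proof (rule ccontr)
    assume no: "\<not> ?thesis"
    then have "insert c I \<in> P" using I(1) c unfolding P_def by (auto simp: insert_commute)
    then show False using I(2)[of "insert c I"] no by blast
  qed
  then show ?thesis using I(1) unfolding P_def by blast
qed

text \<open>
  \<open>V\<close> and \<open>X\<close> are the vertices and the edges covered by a maximal packing of edge-disjoint
  obstructions.
\<close>

locale reduced_packing =
  fixes E :: "'a set set" and t k :: nat and V :: "'a set" and X :: "'a set set"
  assumes E: "simple_edges E" and XE: "X \<subseteq> E" and XV: "\<Union>X \<subseteq> V" and finV: "finite V"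
    and hit_diamond: "diamond_at E a b c d \<Longrightarrow> \<exists>e\<in>X. e \<subseteq> {a, b, c, d}"
    and hit_clique: "t \<noteq> 0 \<Longrightarrow> card S = t \<Longrightarrow> is_clique E S \<Longrightarrow> \<exists>e\<in>X. e \<subseteq> S"
    and cover: "{u, v} \<in> E \<Longrightarrow> \<exists>U. finite U \<and> card U \<le> 2 * k \<and> is_clique E (common_nbrs E u v - U)"
    and not_isolated: "{u, v} \<in> E \<Longrightarrow> is_clique E (edge_hull E u v) \<Longrightarrow>
      simplicial_verts E (edge_hull E u v) = edge_hull E u v \<Longrightarrow> t \<noteq> 0 \<and> t \<le> card (edge_hull E u v)"
    and few_simplicial: "t = 0 \<Longrightarrow> {u, v} \<in> E \<Longrightarrow> is_clique E (edge_hull E u v) \<Longrightarrow>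
      card (simplicial_verts E (edge_hull E u v)) \<le> 2 * k + 3"
begin

section \<open>Structure of the graph outside the packing\<close>

lemma finN: "finite (common_nbrs E u v)"
proof -
  have "common_nbrs E u v \<subseteq> \<Union>E" unfolding common_nbrs_def by blast
  then show ?thesis using simple_edges_finite[OF E] finite_subset by blast
qed

text \<open>Packed edges have both ends in \<open>V\<close>, so an obstruction cannot meet
  \<open>V\<close> in fewer than two vertices. All arguments about the outside rest on this.\<close>

lemma hitE:
  assumes "e \<in> X" "e \<subseteq> Q"
  obtains x y where "x \<noteq> y" "{x, y} \<in> X" "x \<in> V" "y \<in> V" "x \<in> Q" "y \<in> Q"
proof -
  have "card e = 2" using assms XE E unfolding simple_edges_def by blast
  then obtain x y where "e = {x, y}" "x \<noteq> y" by (meson card_2_iff)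
  then show ?thesis using that[of x y] assms XV by blast
qed

text \<open>The diamond on \<open>p\<close>, \<open>q\<close>, \<open>a\<close>, \<open>b\<close>
  would contain a packed edge; it avoids \<open>a\<close> and \<open>b\<close>, so it could only be
  the non-edge \<open>{p, q}\<close>.\<close>

lemma outside_nbrs_clique:
  assumes "{a, b} \<in> E" "a \<notin> V" "b \<notin> V"
  shows "is_clique E (common_nbrs E a b)"
  unfolding is_clique_def
proof (intro ballI impI, rule ccontr)
  fix p q assume pq: "p \<in> common_nbrs E a b" "q \<in> common_nbrs E a b" "p \<noteq> q" "{p, q} \<notin> E"
  then have "diamond_at E p q a b" using assms(1) unfolding diamond_at_def common_nbrs_def
    by (simp add: insert_commute)
  then obtain e where "e \<in> X" "e \<subseteq> {p, q, a, b}" using hit_diamond by blast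
  then obtain x y where "x \<noteq> y" "{x, y} \<in> X" "x \<in> V" "y \<in> V" "x \<in> {p, q, a, b}" "y \<in> {p, q, a, b}"
    by (rule hitE)
  then have "{x, y} = {p, q}" "{x, y} \<in> E" using assms XE by auto
  then show False using pq by simp
qed

lemma outside_hull_clique:
  assumes "{a, b} \<in> E" "a \<notin> V" "b \<notin> V"
  shows "is_clique E (edge_hull E a b)"
  unfolding is_clique_def
proof (intro ballI impI)
  fix p q assume pq: "p \<in> edge_hull E a b" "q \<in> edge_hull E a b" "p \<noteq> q"
  have mem: "z = a \<or> z = b \<or> z \<in> common_nbrs E a b \<and> {a, z} \<in> E \<and> {b, z} \<in> E"
    if "z \<in> edge_hull E a b" for z
    using that unfolding edge_hull_def common_nbrs_def by simp
  show "{p, q} \<in> E"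
    using mem[OF pq(1)] mem[OF pq(2)] pq(3) assms(1) is_cliqueD[OF outside_nbrs_clique[OF assms]]
    by (metis insert_commute)
qed

lemma outside_nbrs_adj:
  "{a, b} \<in> E \<Longrightarrow> a \<notin> V \<Longrightarrow> b \<notin> V \<Longrightarrow> {a, p} \<in> E \<Longrightarrow> {b, p} \<in> E \<Longrightarrow> {a, q} \<in> E \<Longrightarrow> {b, q} \<in> E \<Longrightarrow>
    p \<noteq> q \<Longrightarrow> {p, q} \<in> E"
  using is_cliqueD[OF outside_nbrs_clique[of a b], of p q] unfolding common_nbrs_def by simp

lemma outside_clique_near:
  assumes K: "is_clique E K" and ab: "a \<in> K" "b \<in> K" "a \<noteq> b" "a \<notin> V" "b \<notin> V"
    and z: "{a, z} \<in> E" "{b, z} \<in> E" and y: "y \<in> K"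
  shows "y = z \<or> {y, z} \<in> E"
proof (cases "y = a \<or> y = b")
  case True
  then show ?thesis using z by metis
next
  case False
  then have "{a, y} \<in> E" "{b, y} \<in> E" using is_cliqueD[OF K _ y] ab by metis+
  then show ?thesis using outside_nbrs_adj[of a b y z] is_cliqueD[OF K ab(1-3)] ab z by metis
qed

text \<open>Transitivity is the form in which the splitting of a neighbourhood into cliques outside
  \<open>V\<close> is used. A violation is a diamond whose only vertex in \<open>V\<close> can be
  \<open>x\<close>.\<close>

lemma nbhd_outside_trans:
  assumes "{x, a} \<in> E" "{x, b} \<in> E" "{x, c} \<in> E" "a \<notin> V" "b \<notin> V" "c \<notin> V"
    "{a, b} \<in> E" "{b, c} \<in> E" "a \<noteq> c"
  shows "{a, c} \<in> E"
proof (rule ccontr)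
  assume "{a, c} \<notin> E"
  then have "diamond_at E a c x b" using assms unfolding diamond_at_def by (simp add: insert_commute)
  then obtain e where "e \<in> X" "e \<subseteq> {a, c, x, b}" using hit_diamond by blast
  then obtain p q where "p \<noteq> q" "{p, q} \<in> X" "p \<in> V" "q \<in> V" "p \<in> {a, c, x, b}" "q \<in> {a, c, x, b}"
    by (rule hitE)
  then show False using assms by auto
qed

text \<open>Of the diamond on \<open>a\<close>, \<open>b\<close>, \<open>x\<close>, \<open>y\<close>
  only \<open>x\<close> and \<open>y\<close> can be in \<open>V\<close>, so its packed edge would be
  \<open>{x, y}\<close>. An unpacked edge thus accounts for a single clique.\<close>

lemma unpacked_edge_adj:
  assumes "{x, y} \<in> E" "{x, y} \<notin> X" "a \<notin> V" "b \<notin> V" "a \<noteq> b"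
    "a \<in> common_nbrs E x y" "b \<in> common_nbrs E x y"
  shows "{a, b} \<in> E"
proof (rule ccontr)
  assume "{a, b} \<notin> E"
  then have "diamond_at E a b x y" using assms unfolding diamond_at_def common_nbrs_def
    by (simp add: insert_commute)
  then obtain e where "e \<in> X" "e \<subseteq> {a, b, x, y}" using hit_diamond by blast
  then obtain p q where "p \<noteq> q" "{p, q} \<in> X" "p \<in> V" "q \<in> V" "p \<in> {a, b, x, y}" "q \<in> {a, b, x, y}"
    by (rule hitE)
  then have "{p, q} = {x, y}" "{p, q} \<in> X" using assms by auto
  then show False using assms by simp
qed

lemma clique_card_less:
  assumes "t \<noteq> 0" "is_clique E Q" "Q \<inter> V \<subseteq> {x}"
  shows "card Q < t"
proof (rule ccontr)
  assume "\<not> card Q < t"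
  then obtain S where S: "S \<subseteq> Q" "card S = t" by (meson not_le obtain_subset_with_card_n)
  then have "is_clique E S" using assms(2) unfolding is_clique_def by blast
  then obtain e where "e \<in> X" "e \<subseteq> S" using hit_clique assms(1) S(2) by blast
  then obtain p q where "p \<noteq> q" "{p, q} \<in> X" "p \<in> V" "q \<in> V" "p \<in> S" "q \<in> S"
    by (rule hitE)
  then show False using assms(3) S(1) by blast
qed

text \<open>By \<open>nbhd_outside_trans\<close> these are representatives, one for each clique of
  N(x) - V that meets N(y). The choice is fixed once because the exceptional vertices are defined
  through it.\<close>

definition indep :: "'a \<Rightarrow> 'a \<Rightarrow> 'a set" where
  "indep x y = (SOME I. I \<subseteq> common_nbrs E x y - V \<and> (\<forall>a\<in>I. \<forall>b\<in>I. {a, b} \<notin> E \<or> a = b) \<and>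
  (\<forall>c\<in>common_nbrs E x y - V. \<exists>r\<in>I. r = c \<or> {r, c} \<in> E))"

lemma indep_props:
  "indep x y \<subseteq> common_nbrs E x y - V \<and> (\<forall>a\<in>indep x y. \<forall>b\<in>indep x y. {a, b} \<notin> E \<or> a = b) \<and>
  (\<forall>c\<in>common_nbrs E x y - V. \<exists>r\<in>indep x y. r = c \<or> {r, c} \<in> E)"
proof -
  have "finite (common_nbrs E x y - V)" using finN by blast
  then show ?thesis unfolding indep_def by (rule someI_ex[OF exists_maximal_independent])
qed

lemma indepD: "r \<in> indep x y \<Longrightarrow> {x, r} \<in> E \<and> {y, r} \<in> E \<and> r \<notin> V"
  using indep_props[of x y] unfolding common_nbrs_def by auto

lemma indep_dominates:
  assumes "{x, c} \<in> E" "{y, c} \<in> E" "c \<notin> V"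
  obtains r where "r \<in> indep x y" "r = c \<or> {r, c} \<in> E"
proof -
  have "c \<in> common_nbrs E x y - V" using assms unfolding common_nbrs_def by simp
  then show ?thesis using indep_props[of x y] that by metis
qed

lemma indep_finite: "finite (indep x y)"
  using indep_props[of x y] finN[of x y] finite_subset[of "indep x y"] by (metis finite_Diff)

text \<open>\<open>U\<close> holds at most \<open>2 * k\<close> members, and the clique left after
  removing \<open>U\<close> at most one more.\<close>

lemma card_indep:
  assumes "{x, y} \<in> E"
  shows "card (indep x y) \<le> 2 * k + 1"
proof -
  obtain U where U: "finite U" "card U \<le> 2 * k" "is_clique E (common_nbrs E x y - U)"
    using cover[OF assms] by blast
  have "\<forall>a\<in>indep x y - U. \<forall>b\<in>indep x y - U. a = b"
    using indep_props[of x y] U(3) unfolding is_clique_def by blast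
  then have "card (indep x y - U) \<le> 1" by (metis card_le_Suc0_iff_eq One_nat_def finite_Diff indep_finite)
  moreover have "card (indep x y) \<le> card (U \<union> (indep x y - U))"
    using U(1) indep_finite by (intro card_mono) auto
  moreover have "\<dots> \<le> card U + card (indep x y - U)" by (rule card_Un_le)
  ultimately show ?thesis using U(2) by linarith
qed

lemma card_indep_unpacked:
  assumes "{x, y} \<in> E" "{x, y} \<notin> X"
  shows "card (indep x y) \<le> 1"
proof -
  have "\<forall>a\<in>indep x y. \<forall>b\<in>indep x y. a = b"
    using indep_props[of x y] unpacked_edge_adj[OF assms] by blast
  then show ?thesis by (metis card_le_Suc0_iff_eq One_nat_def indep_finite)
qed

text \<open>An anchor names a clique by its representative and the edge inside \<open>V\<close> that
  makes it count. The pairs are ordered: the clique lives in the neighbourhood of the first vertex,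
  while the second only has to touch it.\<close>

definition anchors :: "(('a \<times> 'a) \<times> 'a) set" where
  "anchors = (SIGMA p:{(x, y). x \<in> V \<and> y \<in> V \<and> {x, y} \<in> E}. indep (fst p) (snd p))"

lemma mem_anchors: "((x, y), r) \<in> anchors \<longleftrightarrow> x \<in> V \<and> y \<in> V \<and> {x, y} \<in> E \<and> r \<in> indep x y"
  unfolding anchors_def by auto

lemma finite_pairs: "finite {(x, y). x \<in> V \<and> y \<in> V \<and> P x y}"
  by (rule finite_subset[of _ "V \<times> V"]) (use finV in auto)

lemma finite_anchors: "finite anchors"
  unfolding anchors_def using finite_pairs indep_finite by (intro finite_SigmaI) auto

lemma card_anchors: "card anchors \<le> card V ^ 2 + card {(x, y). {x, y} \<in> X} * (2 * k + 1)"
proof -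
  let ?A = "{(x, y). x \<in> V \<and> y \<in> V \<and> {x, y} \<in> E}" and ?B = "{(x, y). {x, y} \<in> X}"
  have BA: "?B \<subseteq> ?A" using XE XV by blast
  have finA: "finite ?A" using finite_pairs .
  have "card anchors = (\<Sum>p\<in>?A. card (indep (fst p) (snd p)))"
    unfolding anchors_def using finA indep_finite by (subst card_SigmaI) auto
  also have "\<dots> = (\<Sum>p\<in>?A - ?B. card (indep (fst p) (snd p))) + (\<Sum>p\<in>?B. card (indep (fst p) (snd p)))"
    using sum.subset_diff[OF BA finA] .
  also have "\<dots> \<le> card (?A - ?B) * 1 + card ?B * (2 * k + 1)"
  proof (intro add_mono)
    show "(\<Sum>p\<in>?A - ?B. card (indep (fst p) (snd p))) \<le> card (?A - ?B) * 1"
      using sum_bounded_above[of "?A - ?B" "\<lambda>p. card (indep (fst p) (snd p))" 1] card_indep_unpacked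
      by auto
    show "(\<Sum>p\<in>?B. card (indep (fst p) (snd p))) \<le> card ?B * (2 * k + 1)"
      using sum_bounded_above[of "?B" "\<lambda>p. card (indep (fst p) (snd p))" "2 * k + 1"]
        card_indep[OF subsetD[OF XE]] by auto
  qed
  also have "card (?A - ?B) \<le> card (V \<times> V)" using finV by (intro card_mono) auto
  finally show ?thesis by (simp add: card_cartesian_product power2_eq_square)
qed

text \<open>If \<open>r\<close> is a neighbour of \<open>x\<close> outside \<open>V\<close>, this is
  the whole clique of N(x) - V that contains \<open>r\<close>.\<close>

definition cell :: "'a \<Rightarrow> 'a \<Rightarrow> 'a set" where
  "cell x r = insert r (common_nbrs E x r - V)"

lemma finite_cell: "finite (cell x r)"
  unfolding cell_def using finN by simp

lemma cellD: "c \<in> cell x r \<Longrightarrow> {x, r} \<in> E \<Longrightarrow> r \<notin> V \<Longrightarrow> {x, c} \<in> E \<and> c \<notin> V \<and> (c = r \<or> {r, c} \<in> E)"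
  unfolding cell_def common_nbrs_def by auto

lemma cell_adj:
  assumes "a \<in> cell x r" "b \<in> cell x r" "a \<noteq> b" "{x, r} \<in> E" "r \<notin> V"
  shows "{a, b} \<in> E"
proof -
  have a: "{x, a} \<in> E" "a \<notin> V" "a = r \<or> {a, r} \<in> E" and b: "{x, b} \<in> E" "b \<notin> V" "b = r \<or> {r, b} \<in> E"
    using cellD[OF assms(1,4,5)] cellD[OF assms(2,4,5)] by (simp_all add: insert_commute)
  then show ?thesis using nbhd_outside_trans[OF a(1) assms(4) b(1) a(2) assms(5) b(2)] assms(3) by metis
qed

text \<open>The hull of a suitable edge at an uncovered \<open>v\<close> would be removable by the
  second rule. If \<open>v\<close> has no neighbour in \<open>V\<close>, any edge at
  \<open>v\<close> will do. Otherwise take an edge to some \<open>x\<close> in \<open>V\<close>: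
  since \<open>v\<close> is uncovered, no vertex of its clique around \<open>x\<close> has a common
  neighbour with \<open>x\<close> in \<open>V\<close>, so the hull meets \<open>V\<close> only in
  \<open>x\<close> and is closed under triangles.\<close>

lemma covered_by_anchors:
  assumes v: "v \<in> \<Union>E" "v \<notin> V"
  shows "\<exists>x y r. ((x, y), r) \<in> anchors \<and> v \<in> cell x r"
proof (rule ccontr)
  assume no: "\<not> ?thesis"
  \<comment> \<open>In a reduced instance a clique hull consisting of simplicial vertices must have
    at least \<open>t\<close> vertices, which is impossible when it meets \<open>V\<close> in at
    most one vertex.\<close>
  have isolated: False if e: "{p, q} \<in> E" and cl: "is_clique E (edge_hull E p q)"
    and clo: "\<And>a b z. a \<in> edge_hull E p q \<Longrightarrow> b \<in> edge_hull E p q \<Longrightarrow> a \<noteq> b \<Longrightarrow> {a, z} \<in> E \<Longrightarrow>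
      {b, z} \<in> E \<Longrightarrow> z \<in> edge_hull E p q"
    and V: "edge_hull E p q \<inter> V \<subseteq> {x}" for p q x
  proof -
    have "simplicial_verts E (edge_hull E p q) = edge_hull E p q"
      unfolding simplicial_verts_def using clo unfolding common_nbrs_def by blast
    then have "t \<noteq> 0 \<and> t \<le> card (edge_hull E p q)" using not_isolated[OF e cl] by blast
    then show False using clique_card_less[OF _ cl V] by linarith
  qed
  obtain e where "e \<in> E" "v \<in> e" using v by blast
  then obtain w where vw: "{v, w} \<in> E" using E unfolding simple_edges_def
    by (metis card_2_iff insert_commute insertE singletonD)
  show False
  proof (cases "\<exists>x\<in>V. {v, x} \<in> E")
    case False
    then have wV: "w \<notin> V" using vw by blast
    have mem: "z \<in> edge_hull E v w \<longleftrightarrow> z = v \<or> z = w \<or> {v, z} \<in> E \<and> {w, z} \<in> E" for z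
      unfolding edge_hull_def common_nbrs_def by blast
    have outV: "z \<notin> V" if "z \<in> edge_hull E v w" for z
      using that False wV v(2) unfolding mem by blast
    have cl: "is_clique E (edge_hull E v w)"
      using outside_hull_clique[OF vw v(2) wV] .
    show False
    proof (rule isolated[OF vw cl])
      fix a b z
      assume ab: "a \<in> edge_hull E v w" "b \<in> edge_hull E v w" "a \<noteq> b" and z: "{a, z} \<in> E" "{b, z} \<in> E"
      note near = outside_clique_near[OF cl ab outV[OF ab(1)] outV[OF ab(2)] z]
      show "z \<in> edge_hull E v w" using near[of v] near[of w] unfolding mem by metis
    next
      show "edge_hull E v w \<inter> V \<subseteq> {v}" using outV by blast
    qed
  next
    case True
    then obtain x where x: "x \<in> V" "{v, x} \<in> E" "{x, v} \<in> E" by (metis insert_commute)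
    have mem: "z \<in> edge_hull E v x \<longleftrightarrow> z = v \<or> z = x \<or> {v, z} \<in> E \<and> {x, z} \<in> E" for z
      unfolding edge_hull_def common_nbrs_def by blast
    \<comment> \<open>If \<open>c\<close>, in the clique of \<open>v\<close> around
      \<open>x\<close>, were adjacent to \<open>y\<close>, the representative dominating
      \<open>c\<close> would anchor this clique and cover \<open>v\<close>.\<close>
    have no_anchor: False if h: "y \<in> V" "{x, y} \<in> E" "{x, c} \<in> E" "{y, c} \<in> E" "c \<notin> V"
      "c = v \<or> {c, v} \<in> E" for y c
    proof -
      obtain r where r: "r \<in> indep x y" "r = c \<or> {r, c} \<in> E" by (rule indep_dominates[OF h(3-5)])
      have rE: "{x, r} \<in> E" "r \<notin> V" using indepD[OF r(1)] by blast+
      have "r = v \<or> {r, v} \<in> E"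
        using nbhd_outside_trans[of x r c v] rE h x(3) v(2) r(2) by metis
      then have "v \<in> cell x r" unfolding cell_def common_nbrs_def using x v by auto
      moreover have "((x, y), r) \<in> anchors" using r(1) x(1) h(1,2) unfolding mem_anchors by blast
      ultimately show False using no by blast
    qed
    have outV: "z \<notin> V" if "z \<in> edge_hull E v x" "z \<noteq> x" for z
    proof
      assume zV: "z \<in> V"
      then have "{v, z} \<in> E" "{x, z} \<in> E" using that v(2) unfolding mem by blast+
      then show False using no_anchor[OF zV, of v] x(3) v(2) by (simp add: insert_commute)
    qed
    have cl: "is_clique E (edge_hull E v x)"
      unfolding is_clique_def
    proof (intro ballI impI)
      fix a b assume ab: "a \<in> edge_hull E v x" "b \<in> edge_hull E v x" "a \<noteq> b"
      show "{a, b} \<in> E"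
      proof (cases "a = v \<or> a = x \<or> b = v \<or> b = x")
        case True
        then show ?thesis using ab x unfolding mem by (metis insert_commute)
      next
        case False
        then have "{x, a} \<in> E" "{x, b} \<in> E" "{a, v} \<in> E" "{v, b} \<in> E" "a \<notin> V" "b \<notin> V"
          using ab outV unfolding mem by (auto simp: insert_commute)
        then show ?thesis using nbhd_outside_trans[of x a v b] x(3) v(2) ab(3) by metis
      qed
    qed
    have at_x: "z \<in> edge_hull E v x" if b: "b \<in> edge_hull E v x" "b \<noteq> x" and z: "{x, z} \<in> E" "{b, z} \<in> E"
      for b z
    proof (rule ccontr)
      assume nz: "z \<notin> edge_hull E v x"
      have bV: "b \<notin> V" and xb: "{x, b} \<in> E" "b = v \<or> {v, b} \<in> E"
        using outV b x(3) unfolding mem by metis+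
      show False
      proof (cases "z \<in> V")
        case True
        then show False using no_anchor[of z b] z xb bV by (simp add: insert_commute)
      next
        case False
        then have "z = v \<or> {v, z} \<in> E"
          using nbhd_outside_trans[of x v b z] z xb bV x(3) v(2) by metis
        then show False using nz z unfolding mem by metis
      qed
    qed
    show False
    proof (rule isolated[OF x(2) cl])
      fix a b z
      assume ab: "a \<in> edge_hull E v x" "b \<in> edge_hull E v x" "a \<noteq> b" and z: "{a, z} \<in> E" "{b, z} \<in> E"
      show "z \<in> edge_hull E v x"
      proof (cases "a = x \<or> b = x")
        case True
        then show ?thesis using at_x[of a z] at_x[of b z] ab z by metis
      next
        case False
        then have abV: "a \<notin> V" "b \<notin> V" using outV ab by metis+
        note near = outside_clique_near[OF cl ab abV z]
        show ?thesis using near[of v] near[of x] unfolding mem by metis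
      qed
    next
      show "edge_hull E v x \<inter> V \<subseteq> {x}" using outV by blast
    qed
  qed
qed

text \<open>\<open>W\<close> absorbs exceptional vertices, so that \<open>m\<close> has to bound
  only the rest of each cell.\<close>

lemma card_verts_le:
  assumes N: "\<And>x y r. ((x, y), r) \<in> anchors \<Longrightarrow> card (cell x r - W) \<le> m" and W: "finite W"
  shows "card (\<Union>E) \<le> card V + card W + card anchors * m"
proof -
  let ?C = "\<Union>a\<in>anchors. cell (fst (fst a)) (snd a) - W"
  have fC: "finite ?C" using finite_anchors finite_cell by blast
  have "v \<in> V \<union> W \<union> ?C" if vE: "v \<in> \<Union>E" for v
  proof (rule ccontr)
    assume n: "v \<notin> V \<union> W \<union> ?C"
    then have "v \<notin> V" "v \<notin> W" by simp_all
    obtain x y r where "((x, y), r) \<in> anchors" "v \<in> cell x r"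
      using covered_by_anchors[OF vE \<open>v \<notin> V\<close>] by metis
    then show False using n \<open>v \<notin> W\<close> by force
  qed
  then have "\<Union>E \<subseteq> V \<union> W \<union> ?C" by (rule subsetI)
  then have "card (\<Union>E) \<le> card (V \<union> W \<union> ?C)"
    using finV W fC by (intro card_mono) simp_all
  also have "\<dots> \<le> card V + card W + card ?C"
    by (meson add_le_mono1 card_Un_le le_trans)
  also have "card ?C \<le> (\<Sum>a\<in>anchors. card (cell (fst (fst a)) (snd a) - W))"
    by (rule card_UN_le[OF finite_anchors])
  also have "\<dots> \<le> card anchors * m"
    using sum_bounded_above[of anchors "\<lambda>a. card (cell (fst (fst a)) (snd a) - W)" m] N by force
  finally show ?thesis by simp
qed

lemma card_verts_clique_bounded:
  assumes t: "t \<noteq> 0"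
  shows "card (\<Union>E) \<le> card V + card anchors * t"
proof -
  have "card (cell x r - {}) \<le> t" if a: "((x, y), r) \<in> anchors" for x y r
  proof -
    have r: "{x, r} \<in> E" "r \<notin> V" using a indepD unfolding mem_anchors by blast+
    have "is_clique E (cell x r)" unfolding is_clique_def using cell_adj r by blast
    moreover have "cell x r \<inter> V \<subseteq> {x}" using cellD r by blast
    ultimately show ?thesis using clique_card_less[OF t] by (simp add: less_imp_le)
  qed
  then show ?thesis using card_verts_le[of "{}" t] by simp
qed

text \<open>Let \<open>u\<close> be a common neighbour of \<open>v\<close> and some \<open>a\<close>
  in the hull. If \<open>a\<close> or \<open>u\<close> is outside \<open>V\<close>, adjacency
  propagates from \<open>v\<close> to \<open>r\<close> and \<open>c\<close> by the clique structure.
  If both are in \<open>V\<close>, then \<open>v\<close> belongs to a clique represented for the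
  edge \<open>{a, u}\<close>. By \<open>nv\<close> the representative is a vertex other than
  \<open>v\<close>; it lies in the hull by the earlier case and, being outside \<open>V\<close>, can
  take the place of \<open>a\<close>.\<close>

lemma cell_simplicial:
  assumes r: "{x, r} \<in> E" "r \<notin> V" "x \<in> V" and c: "c \<in> cell x r" "c \<noteq> r" and v: "v \<in> cell x r" "v \<noteq> r"
    and nv: "\<And>y z. y \<in> V \<Longrightarrow> z \<in> V \<Longrightarrow> {y, z} \<in> E \<Longrightarrow> v \<notin> indep y z"
  shows "v \<in> simplicial_verts E (edge_hull E r c)"
proof -
  let ?K = "edge_hull E r c"
  have mem: "z \<in> ?K \<longleftrightarrow> z = r \<or> z = c \<or> {r, z} \<in> E \<and> {c, z} \<in> E" for z
    unfolding edge_hull_def common_nbrs_def by blast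
  have cD: "{x, c} \<in> E" "c \<notin> V" "{r, c} \<in> E" using cellD[OF c(1) r(1,2)] c by blast+
  have vD: "{x, v} \<in> E" "v \<notin> V" "{r, v} \<in> E" "c = v \<or> {c, v} \<in> E"
    using cellD[OF v(1) r(1,2)] v cell_adj[OF c(1) v(1) _ r(1,2)] by blast+
  have cl: "is_clique E ?K"
    using outside_hull_clique[OF cD(3) r(2) cD(2)] .
  have vK: "v \<in> ?K" using vD unfolding mem by blast
  have memI: "z \<in> ?K" if "z = r \<or> {r, z} \<in> E" "z = c \<or> {c, z} \<in> E" for z
    using that cD edge_commute[of c r E] unfolding mem by blast
  have rv: "{v, r} \<in> E" using vD(3) by (simp add: insert_commute)
  have Kadj: "{a, b} \<in> E" if "a \<in> ?K" "b \<in> ?K" "a \<noteq> b" for a b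
    using cl that unfolding is_clique_def by blast
  have rK: "r \<in> ?K" "c \<in> ?K" unfolding mem by blast+
  have "u \<in> ?K" if a: "a \<in> ?K" "a \<noteq> v" and u: "{v, u} \<in> E" "{a, u} \<in> E" for a u
  proof -
    have out: "u \<in> ?K" if a': "a' \<in> ?K" "a' \<noteq> v" "a' \<notin> V" and u': "{a', u} \<in> E" for a'
    proof -
      have "y = u \<or> {y, u} \<in> E" if "y \<in> ?K" for y
        using outside_clique_near[OF cl vK a'(1) _ vD(2) a'(3) u(1) u' that] a'(2) by metis
      then show ?thesis using memI rK by metis
    qed
    show ?thesis
    proof (cases "a \<in> V")
      case False
      then show ?thesis using out[of a] a u by blast
    next
      case aV: True
      \<comment> \<open>For \<open>a\<close> in \<open>V\<close>, the vertices \<open>y\<close>,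
        \<open>v\<close>, \<open>z\<close> all belong to one clique of N(a) - V.\<close>
      have across: "y = z \<or> {y, z} \<in> E" if y: "y \<in> ?K" "y \<notin> V" and z: "z \<notin> V" "{a, z} \<in> E" "{v, z} \<in> E" for y z
      proof -
        have ay: "{a, y} \<in> E" using Kadj a y aV by blast
        have av: "{a, v} \<in> E" using Kadj a vK by blast
        show ?thesis
        proof (cases "y = v")
          case False
          then have "{y, v} \<in> E" using Kadj y vK by blast
          then show ?thesis using nbhd_outside_trans[of a y v z] ay av z y vD by blast
        qed (use z in blast)
      qed
      have inK: "z \<in> ?K" if "z \<notin> V" "{a, z} \<in> E" "{v, z} \<in> E" for z
        using memI[of z] across[of r z] across[of c z] that rK r cD by blast
      show ?thesis
      proof (cases "u \<in> V")
        case False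
        then show ?thesis using inK u by blast
      next
        case uV: True
        have av: "{a, v} \<in> E" "{u, v} \<in> E" using Kadj a vK u by (auto simp: insert_commute)
        obtain r' where r': "r' \<in> indep a u" "r' = v \<or> {r', v} \<in> E"
          using indep_dominates[OF av vD(2)] by blast
        have "r' \<noteq> v" using nv[OF aV uV u(2)] r'(1) by blast
        then have r'v: "{v, r'} \<in> E" using r'(2) by (simp add: insert_commute)
        have r'D: "{a, r'} \<in> E" "{u, r'} \<in> E" "r' \<notin> V" using indepD[OF r'(1)] by blast+
        have "r' \<in> ?K" using inK r'D r'v by blast
        then show ?thesis using out[of r'] r'D \<open>r' \<noteq> v\<close> by (simp add: insert_commute)
      qed
    qed
  qed
  then show ?thesis using vK unfolding simplicial_verts_def common_nbrs_def by blast
qed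

text \<open>\<open>W\<close> is taken to be the set of all representatives. The rest of a cell
  consists of simplicial vertices of one hull, at most \<open>2 * k + 3\<close> of them; the
  representatives cost at most one vertex more per anchor.\<close>

lemma card_verts_diamond:
  assumes t: "t = 0"
  shows "card (\<Union>E) \<le> card V + card anchors * (2 * k + 4)"
proof -
  let ?R = "snd ` anchors"
  have "card (cell x r - ?R) \<le> 2 * k + 3" if a: "((x, y), r) \<in> anchors" for x y r
  proof (cases "cell x r - ?R = {}")
    case False
    then obtain c where c: "c \<in> cell x r" "c \<notin> ?R" by blast
    have rR: "r \<in> ?R" using a by force
    have r: "{x, r} \<in> E" "r \<notin> V" "x \<in> V" using a indepD unfolding mem_anchors by blast+
    have "c \<noteq> r" using c rR by blast
    have rc: "{r, c} \<in> E" "c \<notin> V" using cellD[OF c(1) r(1,2)] \<open>c \<noteq> r\<close> by blast+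
    have "cell x r - ?R \<subseteq> simplicial_verts E (edge_hull E r c)"
    proof
      fix v assume v: "v \<in> cell x r - ?R"
      then have "v \<noteq> r" using rR by blast
      moreover have "v \<notin> indep y z" if "y \<in> V" "z \<in> V" "{y, z} \<in> E" for y z
        using v that mem_anchors[of y z v] by force
      ultimately show "v \<in> simplicial_verts E (edge_hull E r c)"
        using cell_simplicial[OF r c(1) \<open>c \<noteq> r\<close>] v by blast
    qed
    moreover have "finite (simplicial_verts E (edge_hull E r c))"
      unfolding simplicial_verts_def edge_hull_def using finN by simp
    ultimately have "card (cell x r - ?R) \<le> card (simplicial_verts E (edge_hull E r c))"
      by (metis card_mono)
    also have "is_clique E (edge_hull E r c)"
      using outside_hull_clique[OF rc(1) r(2) rc(2)] .
    then have "card (simplicial_verts E (edge_hull E r c)) \<le> 2 * k + 3"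
      using few_simplicial[OF t rc(1)] by blast
    finally show ?thesis .
  next
    case True
    show ?thesis unfolding True by simp
  qed
  then have "card (\<Union>E) \<le> card V + card ?R + card anchors * (2 * k + 3)"
    using card_verts_le[of ?R "2 * k + 3"] finite_anchors by blast
  moreover have "card ?R \<le> card anchors" using finite_anchors by (rule card_image_le)
  ultimately show ?thesis by (simp add: algebra_simps)
qed

end

section \<open>Obstructions and maximal packings\<close>

definition obstruction :: "nat \<Rightarrow> 'a set set \<Rightarrow> 'a set \<Rightarrow> bool" where
  "obstruction t E Q \<longleftrightarrow> (\<exists>a b c d. diamond_at E a b c d \<and> Q = {a, b, c, d}) \<or>
     t \<noteq> 0 \<and> card Q = t \<and> is_clique E Q"

lemma obstruction_hit:
  assumes Q: "obstruction t E Q" and F: "obstruction_free t (E - F)"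
  shows "\<exists>e\<in>F. e \<in> E \<and> e \<subseteq> Q"
  using Q unfolding obstruction_def
proof
  assume "\<exists>a b c d. diamond_at E a b c d \<and> Q = {a, b, c, d}"
  then obtain a b c d where D: "diamond_at E a b c d" "Q = {a, b, c, d}" by metis
  have "\<not> diamond_at (E - F) a b c d" using obstruction_freeD_diamond[OF F] .
  then obtain p q where "{p, q} \<in> F" "{p, q} \<in> E" "{p, q} \<subseteq> Q" using D unfolding diamond_at_def by auto
  then show ?thesis by metis
next
  assume K: "t \<noteq> 0 \<and> card Q = t \<and> is_clique E Q"
  then have "\<not> is_clique (E - F) Q" using obstruction_freeD_clique[OF F] by metis
  then obtain p q where "{p, q} \<in> F" "{p, q} \<in> E" "{p, q} \<subseteq> Q" using K unfolding is_clique_def by auto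
  then show ?thesis by metis
qed

lemma obstruction_has_edge:
  assumes "obstruction t E Q" "t = 0 \<or> 4 \<le> t"
  shows "\<exists>e\<in>E. e \<subseteq> Q"
  using assms(1) unfolding obstruction_def
proof
  assume "\<exists>a b c d. diamond_at E a b c d \<and> Q = {a, b, c, d}"
  then show ?thesis unfolding diamond_at_def by auto
next
  assume K: "t \<noteq> 0 \<and> card Q = t \<and> is_clique E Q"
  then have "2 \<le> card Q" using assms(2) by linarith
  then obtain S where S: "S \<subseteq> Q" "card S = 2" by (meson obtain_subset_with_card_n)
  then obtain x y where "S = {x, y}" "x \<noteq> y" by (meson card_2_iff)
  then have "{x, y} \<in> E" "{x, y} \<subseteq> Q" using S K is_cliqueD[of E Q x y] by auto
  then show ?thesis by metis
qed

lemma obstruction_subset: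
  assumes "obstruction t E Q" "t = 0 \<or> 4 \<le> t"
  shows "Q \<subseteq> \<Union>E"
  using assms(1) unfolding obstruction_def
proof
  assume "\<exists>a b c d. diamond_at E a b c d \<and> Q = {a, b, c, d}"
  then obtain a b c d where D: "diamond_at E a b c d" "Q = {a, b, c, d}" by metis
  then have "{a, c} \<in> E" "{b, d} \<in> E" unfolding diamond_at_def by simp_all
  then have "{a, c} \<subseteq> \<Union>E" "{b, d} \<subseteq> \<Union>E" by (metis Union_upper)+
  then show ?thesis using D(2) by simp
next
  assume K: "t \<noteq> 0 \<and> card Q = t \<and> is_clique E Q"
  show ?thesis
  proof
    fix a assume a: "a \<in> Q"
    have "Q \<noteq> {a}" using K assms(2) by auto
    then obtain b where "b \<in> Q" "b \<noteq> a" using a by auto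
    then have "{b, a} \<in> E" using K a is_cliqueD by metis
    then show "a \<in> \<Union>E" by auto
  qed
qed

lemma card_obstruction: "obstruction t E Q \<Longrightarrow> card Q \<le> max 4 t"
  unfolding obstruction_def by (auto simp: card_insert_if)

text \<open>Members of the packing share no edge, so a solution spends a separate edge on each and
  there are at most \<open>k\<close> of them. Each has at most \<open>s\<close> vertices and
  therefore at most \<open>s\<^sup>2\<close> ordered pairs.\<close>

lemma exists_packing:
  assumes E: "simple_edges E" and t: "t = 0 \<or> 4 \<le> t" and sol: "solvable t E k"
  defines "s \<equiv> max 4 t"
  shows "\<exists>V X. X \<subseteq> E \<and> \<Union>X \<subseteq> V \<and> finite V \<and> (\<forall>Q. obstruction t E Q \<longrightarrow> (\<exists>e\<in>X. e \<subseteq> Q)) \<and>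
    card V \<le> s * k \<and> card {(x, y). {x, y} \<in> X} \<le> s\<^sup>2 * k"
proof -
  obtain F where F: "F \<subseteq> E" "card F \<le> k" "obstruction_free t (E - F)"
    using sol unfolding solvable_def by metis
  have fF: "finite F" using F(1) E unfolding simple_edges_def by (metis finite_subset)
  define Obs where "Obs = {Q. obstruction t E Q}"
  define Fam where "Fam = {P. P \<subseteq> Obs \<and> (\<forall>Q\<in>P. \<forall>Q'\<in>P. Q \<noteq> Q' \<longrightarrow> \<not> (\<exists>e\<in>E. e \<subseteq> Q \<and> e \<subseteq> Q'))}"
  have "Obs \<subseteq> Pow (\<Union>E)" unfolding Obs_def using obstruction_subset[OF _ t] by auto
  then have fObs: "finite Obs" using simple_edges_finite[OF E] by (metis finite_Pow_iff finite_subset)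
  then have "finite Fam" unfolding Fam_def by simp
  moreover have "{} \<in> Fam" unfolding Fam_def by simp
  ultimately obtain P where P: "P \<in> Fam" "\<And>P'. P' \<in> Fam \<Longrightarrow> P \<subseteq> P' \<Longrightarrow> P = P'"
    using finite_has_maximal[of Fam] by (metis empty_iff)
  have PObs: "obstruction t E Q" if "Q \<in> P" for Q using P(1) that unfolding Fam_def Obs_def by auto
  have Pdisj: "Q = Q'" if "Q \<in> P" "Q' \<in> P" "e \<in> E" "e \<subseteq> Q" "e \<subseteq> Q'" for Q Q' e
  proof -
    have "\<forall>Q\<in>P. \<forall>Q'\<in>P. Q \<noteq> Q' \<longrightarrow> \<not> (\<exists>e\<in>E. e \<subseteq> Q \<and> e \<subseteq> Q')"
      using P(1) unfolding Fam_def by simp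
    then show ?thesis using that by metis
  qed
  have fP: "finite P" using P(1) fObs unfolding Fam_def by (auto intro: finite_subset)
  have fQ: "finite Q" if "Q \<in> P" for Q
    using obstruction_subset[OF PObs[OF that] t] simple_edges_finite[OF E] by (rule finite_subset)
  define V where "V = \<Union>P"
  define X where "X = {e \<in> E. \<exists>Q\<in>P. e \<subseteq> Q}"
  have hit: "\<exists>e\<in>X. e \<subseteq> Q" if Q: "obstruction t E Q" for Q
  proof (rule ccontr)
    assume no: "\<not> ?thesis"
    \<comment> \<open>An obstruction containing no packed edge could be added to the packing. It is
      not a member already, because it contains some edge, which would then be packed.\<close>
    obtain e where "e \<in> E" "e \<subseteq> Q" using obstruction_has_edge[OF Q t] by metis
    then have "Q \<notin> P" using no unfolding X_def by auto
    have "insert Q P \<in> Fam" using P(1) Q no unfolding Fam_def Obs_def X_def by auto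
    then show False using P(2)[of "insert Q P"] \<open>Q \<notin> P\<close> by auto
  qed
  obtain g where g: "\<And>Q. Q \<in> P \<Longrightarrow> g Q \<in> F \<and> g Q \<in> E \<and> g Q \<subseteq> Q"
    using obstruction_hit[OF PObs F(3)] by metis
  have "inj_on g P" using g Pdisj by (intro inj_onI) metis
  moreover have "g ` P \<subseteq> F" using g by auto
  ultimately have cP: "card P \<le> k" using card_inj_on_le[OF _ _ fF] F(2) by (metis le_trans)
  have cQ: "card Q \<le> s" if "Q \<in> P" for Q
    using card_obstruction[OF PObs[OF that]] unfolding s_def .
  have "card V \<le> (\<Sum>Q\<in>P. card Q)" unfolding V_def by (rule card_Union_le_sum_card)
  also have "\<dots> \<le> card P * s" using sum_bounded_above[of P card s] cQ by simp
  also have "\<dots> \<le> s * k" using mult_le_mono1[OF cP, of s] by (simp only: mult.commute)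
  finally have cV: "card V \<le> s * k" .
  have "{(x, y). {x, y} \<in> X} \<subseteq> (\<Union>Q\<in>P. Q \<times> Q)" unfolding X_def by auto
  then have "card {(x, y). {x, y} \<in> X} \<le> card (\<Union>Q\<in>P. Q \<times> Q)" using fP fQ by (intro card_mono) auto
  also have "\<dots> \<le> (\<Sum>Q\<in>P. card (Q \<times> Q))" by (rule card_UN_le[OF fP])
  also have "\<dots> \<le> card P * s\<^sup>2"
    using sum_bounded_above[of P "\<lambda>Q. card (Q \<times> Q)" "s\<^sup>2"] cQ
    by (simp add: card_cartesian_product power2_eq_square mult_le_mono)
  also have "\<dots> \<le> s\<^sup>2 * k" using mult_le_mono1[OF cP, of "s\<^sup>2"] by (simp only: mult.commute)
  finally have cX: "card {(x, y). {x, y} \<in> X} \<le> s\<^sup>2 * k" .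
  have "finite V" unfolding V_def using fP fQ by simp
  moreover have "X \<subseteq> E" "\<Union>X \<subseteq> V" unfolding X_def V_def by auto
  ultimately show ?thesis using hit cV cX by (intro exI[of _ V] exI[of _ X]) simp
qed

section \<open>Reduced instances and the size of the kernel\<close>

definition detachable :: "nat \<Rightarrow> 'a set set \<Rightarrow> nat \<Rightarrow> 'a set \<Rightarrow> bool" where
  "detachable t E k K \<longleftrightarrow> is_clique E K \<and>
     (simplicial_verts E K = K \<and> (t = 0 \<or> card K < t) \<or> t = 0 \<and> 2 * k + 4 \<le> card (simplicial_verts E K))"

text \<open>The first rule is recorded through the set \<open>U\<close> and not through the absence
  of a large matching: this is what the vertices of a greedy matching with at most \<open>k\<close>
  pairs certify, and it is all that the counting needs.\<close>

definition reduced_at :: "nat \<Rightarrow> 'a set set \<Rightarrow> nat \<Rightarrow> 'a \<Rightarrow> 'a \<Rightarrow> bool" where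
  "reduced_at t E k u v \<longleftrightarrow> ({u, v} \<in> E \<longrightarrow>
     (\<exists>U. finite U \<and> card U \<le> 2 * k \<and> is_clique E (common_nbrs E u v - U)) \<and>
     \<not> detachable t E k (edge_hull E u v))"

text \<open>With \<open>s = max 4 t\<close> there are at most
  \<open>4 * s\<^sup>2 * k\<^sup>2\<close> anchors. For diamonds alone,
  \<open>64 * k\<^sup>2\<close> anchors with \<open>2 * k + 4\<close> vertices each and
  \<open>4 * k\<close> vertices of \<open>V\<close> give coefficients 128 + 256 + 4 = 388. Otherwise
  \<open>4 * t ^ 3 * k\<^sup>2\<close> vertices in cells and \<open>t * k\<close> in
  \<open>V\<close> are absorbed by the factor 5.\<close>

definition kernel_bound :: "nat \<Rightarrow> nat \<Rightarrow> nat" where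
  "kernel_bound t k = (if t = 0 then 388 * k ^ 3 else 5 * t ^ 3 * k ^ 2)"

lemma kernel_bound_mono: "k \<le> k' \<Longrightarrow> kernel_bound t k \<le> kernel_bound t k'"
  unfolding kernel_bound_def by (simp add: power_mono)

lemma solvable_detach:
  assumes E: "simple_edges E" and t: "t = 0 \<or> 4 \<le> t" and K: "detachable t E k K" "finite K"
    and w: "w \<in> simplicial_verts E K"
  shows "solvable t (detach E w K) k \<longleftrightarrow> solvable t E k"
proof
  have wK: "w \<in> K" using w unfolding simplicial_verts_def by simp
  assume "solvable t (detach E w K) k"
  then show "solvable t E k"
    using K(1) solvable_undetach_isolated[OF _ _ _ K(2) wK E] t
      solvable_undetach_many_simplicial[OF _ K(2) w _ E]
    unfolding detachable_def by fastforce
qed (rule solvable_detachI[OF E w])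

lemma reduced_card_verts:
  assumes E: "simple_edges E" and t: "t = 0 \<or> 4 \<le> t" and sol: "solvable t E k"
    and red: "\<And>u v. reduced_at t E k u v"
  shows "card (\<Union>E) \<le> kernel_bound t k"
proof -
  define s where "s = max 4 t"
  obtain V X where VX: "X \<subseteq> E" "\<Union>X \<subseteq> V" "finite V" "\<And>Q. obstruction t E Q \<Longrightarrow> \<exists>e\<in>X. e \<subseteq> Q"
    "card V \<le> s * k" "card {(x, y). {x, y} \<in> X} \<le> s\<^sup>2 * k"
    using exists_packing[OF E t sol] unfolding s_def by metis
  interpret reduced_packing E t k V X
  proof
    show "simple_edges E" "X \<subseteq> E" "\<Union>X \<subseteq> V" "finite V" by fact+
    show "\<exists>e\<in>X. e \<subseteq> {a, b, c, d}" if "diamond_at E a b c d" for a b c d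
      using VX(4) that unfolding obstruction_def by metis
    show "\<exists>e\<in>X. e \<subseteq> S" if "t \<noteq> 0" "card S = t" "is_clique E S" for S
      using VX(4) that unfolding obstruction_def by metis
    show "\<exists>U. finite U \<and> card U \<le> 2 * k \<and> is_clique E (common_nbrs E u v - U)" if "{u, v} \<in> E" for u v
      using red that unfolding reduced_at_def by metis
    show "t \<noteq> 0 \<and> t \<le> card (edge_hull E u v)" if "{u, v} \<in> E" "is_clique E (edge_hull E u v)"
      "simplicial_verts E (edge_hull E u v) = edge_hull E u v" for u v
      using red[of u v] that unfolding reduced_at_def detachable_def by force
    show "card (simplicial_verts E (edge_hull E u v)) \<le> 2 * k + 3" if "t = 0" "{u, v} \<in> E"
      "is_clique E (edge_hull E u v)" for u v
      using red[of u v] that unfolding reduced_at_def detachable_def by force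
  qed
  have "card anchors \<le> card V ^ 2 + card {(x, y). {x, y} \<in> X} * (2 * k + 1)" by (rule card_anchors)
  also have "\<dots> \<le> (s * k)\<^sup>2 + (s\<^sup>2 * k) * (2 * k + 1)"
    using VX(5,6) by (intro add_mono power_mono mult_le_mono1) auto
  also have "\<dots> = s\<^sup>2 * (k * (3 * k + 1))" by (simp add: power2_eq_square algebra_simps)
  also have "\<dots> \<le> s\<^sup>2 * (4 * k\<^sup>2)" by (cases k) (auto simp: power2_eq_square algebra_simps)
  finally have anc: "card anchors \<le> s\<^sup>2 * (4 * k\<^sup>2)" .
  show ?thesis
  proof (cases "t = 0")
    case True
    have "card (\<Union>E) \<le> 4 * k + 64 * k\<^sup>2 * (2 * k + 4)"
    proof -
      have "card anchors * (2 * k + 4) \<le> 64 * k\<^sup>2 * (2 * k + 4)"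
        using anc True unfolding s_def by (intro mult_le_mono1) simp
      moreover have "card V \<le> 4 * k" using VX(5) True unfolding s_def by simp
      ultimately show ?thesis using card_verts_diamond[OF True] by linarith
    qed
    also have "\<dots> \<le> 388 * k ^ 3"
      by (cases k) (auto simp: power2_eq_square power3_eq_cube algebra_simps)
    finally show ?thesis using True unfolding kernel_bound_def by simp
  next
    case False
    then have s: "s = t" using t unfolding s_def by simp
    have "card (\<Union>E) \<le> t * k + t\<^sup>2 * (4 * k\<^sup>2) * t"
      using card_verts_clique_bounded[OF False] VX(5) mult_le_mono1[OF anc, of t] unfolding s by linarith
    also have "t\<^sup>2 * (4 * k\<^sup>2) * t = 4 * t ^ 3 * k\<^sup>2" by (simp add: power2_eq_square power3_eq_cube)
    also have "t * k \<le> t ^ 3 * k\<^sup>2"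
      using False by (intro mult_le_mono) (auto simp: power2_eq_square power3_eq_cube)
    finally show ?thesis using False unfolding kernel_bound_def by (simp add: mult.assoc mult.commute)
  qed
qed

section \<open>For-programs\<close>

text \<open>
  All loops run up to the value of the cell \<open>''N''\<close>, which no program may change. Hence every
  program terminates within a number of steps that is polynomial in that value.
\<close>

datatype prog =
    PSkip
  | PAsg string "aexp list" aexp
  | PSeq prog prog
  | PIf bexp prog prog
  | PFor string prog

fun mods :: "prog \<Rightarrow> string set" where
  "mods PSkip = {}"
| "mods (PAsg x es a) = {x}"
| "mods (PSeq p q) = mods p \<union> mods q"
| "mods (PIf b p q) = mods p \<union> mods q"
| "mods (PFor x p) = insert x (mods p)"

fun wf_prog :: "prog \<Rightarrow> bool" where
  "wf_prog PSkip \<longleftrightarrow> True"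
| "wf_prog (PAsg x es a) \<longleftrightarrow> x \<noteq> ''N''"
| "wf_prog (PSeq p q) \<longleftrightarrow> wf_prog p \<and> wf_prog q"
| "wf_prog (PIf b p q) \<longleftrightarrow> wf_prog p \<and> wf_prog q"
| "wf_prog (PFor x p) \<longleftrightarrow> x \<noteq> ''N'' \<and> x \<notin> mods p \<and> wf_prog p"

primrec iter_loop :: "(state \<Rightarrow> state) \<Rightarrow> string \<Rightarrow> nat \<Rightarrow> state \<Rightarrow> state" where
  "iter_loop f x 0 s = store s x [] 0"
| "iter_loop f x (Suc i) s = store (f (iter_loop f x i s)) x [] (Suc i)"

fun den :: "prog \<Rightarrow> state \<Rightarrow> state" where
  "den PSkip s = s"
| "den (PAsg x es a) s = store s x (map (\<lambda>e. aval e s) es) (aval a s)"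
| "den (PSeq p q) s = den q (den p s)"
| "den (PIf b p q) s = (if bval b s then den p s else den q s)"
| "den (PFor x p) s = iter_loop (den p) x (s ''N'' []) s"

fun compile :: "prog \<Rightarrow> com" where
  "compile PSkip = Skip"
| "compile (PAsg x es a) = Assign x es a"
| "compile (PSeq p q) = Seq (compile p) (compile q)"
| "compile (PIf b p q) = Cond b (compile p) (compile q)"
| "compile (PFor x p) = Seq (Assign x [] (N 0))
     (While (Less (Cell x []) (Cell ''N'' []))
       (Seq (compile p) (Assign x [] (Plus (Cell x []) (N 1)))))"

text \<open>A bound in terms of the value of \<open>''N''\<close>: a conditional is charged for both
  branches, and a round of a loop for its test, its body and the increment.\<close>

fun time_poly :: "prog \<Rightarrow> nat poly" where
  "time_poly PSkip = 1"
| "time_poly (PAsg x es a) = 1"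
| "time_poly (PSeq p q) = time_poly p + time_poly q"
| "time_poly (PIf b p q) = 1 + time_poly p + time_poly q"
| "time_poly (PFor x p) = [:2:] + [:0, 1:] * (time_poly p + [:2:])"

lemma store_apply: "store s x is v y js = (if y = x \<and> js = is then v else s y js)"
  by (simp add: store_def)

lemma store_other: "y \<noteq> x \<Longrightarrow> store s x is v y = s y"
  by (simp add: store_def)

lemma den_frame: "y \<notin> mods p \<Longrightarrow> den p s y = s y"
proof (induction p arbitrary: s)
  case (PFor x p)
  have "iter_loop (den p) x i s y = s y" for i
    by (induction i) (use PFor in \<open>auto simp: store_other\<close>)
  then show ?case by simp
qed (auto simp: store_other)

lemma wf_prog_mods: "wf_prog p \<Longrightarrow> ''N'' \<notin> mods p"
  by (induction p) auto

lemma iter_loop_frame: "y \<noteq> x \<Longrightarrow> y \<notin> mods p \<Longrightarrow> iter_loop (den p) x i s y = s y"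
  by (induction i) (auto simp: store_other den_frame)

lemma iter_loop_index: "iter_loop f x i s x [] = i"
  by (cases i) (simp_all add: store_apply)

lemma exec_compile:
  "wf_prog p \<Longrightarrow> \<exists>t. exec (compile p) s t (den p s) \<and> t \<le> poly (time_poly p) (s ''N'' [])"
proof (induction p arbitrary: s)
  case PSkip
  then show ?case using exec.Skip by fastforce
next
  case (PAsg x es a)
  show ?case using exec.Assign[of x es a s] by fastforce
next
  case (PSeq p q)
  obtain t1 where t1: "exec (compile p) s t1 (den p s)" "t1 \<le> poly (time_poly p) (s ''N'' [])"
    using PSeq by auto
  obtain t2 where t2: "exec (compile q) (den p s) t2 (den q (den p s))"
    "t2 \<le> poly (time_poly q) (den p s ''N'' [])" using PSeq by auto
  have "den p s ''N'' = s ''N''" using PSeq.prems wf_prog_mods den_frame by auto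
  then show ?case using exec.Seq[OF t1(1) t2(1)] t1(2) t2(2) by (intro exI[of _ "t1 + t2"]) auto
next
  case (PIf b p q)
  show ?case
  proof (cases "bval b s")
    case True
    obtain t where "exec (compile p) s t (den p s)" "t \<le> poly (time_poly p) (s ''N'' [])"
      using PIf by auto
    then show ?thesis using exec.CondTrue[OF True, of "compile p" t "den p s" "compile q"] True
      by (intro exI[of _ "1 + t"]) auto
  next
    case False
    obtain t where "exec (compile q) s t (den q s)" "t \<le> poly (time_poly q) (s ''N'' [])"
      using PIf by auto
    then show ?thesis using exec.CondFalse[OF False, of "compile q" t "den q s" "compile p"] False
      by (intro exI[of _ "1 + t"]) auto
  qed
next
  case (PFor x p)
  define B where "B = s ''N'' []"
  define T where "T = poly (time_poly p) B"
  let ?g = "Less (Cell x []) (Cell ''N'' [])"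
  let ?c = "Seq (compile p) (Assign x [] (Plus (Cell x []) (N 1)))"
  let ?s = "\<lambda>i. iter_loop (den p) x i s"
  have N: "?s i ''N'' [] = B" for i
    using iter_loop_frame[of "''N''" x p i s] PFor.prems wf_prog_mods B_def by auto
  \<comment> \<open>\<open>j\<close> is the number of rounds still to be run; the final 1 pays for
    the test that fails.\<close>
  have loop: "i + j = B \<Longrightarrow> \<exists>t. exec (While ?g ?c) (?s i) t (?s B) \<and> t \<le> j * (T + 2) + 1" for i j
  proof (induction j arbitrary: i)
    case 0
    then show ?case using exec.WhileFalse[of ?g "?s i" ?c] N iter_loop_index[of "den p" x i s] by auto
  next
    case (Suc j)
    have g: "bval ?g (?s i)" using N iter_loop_index[of "den p" x i s] Suc.prems by simp
    obtain t1 where t1: "exec (compile p) (?s i) t1 (den p (?s i))" "t1 \<le> T"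
      using PFor.IH[of "?s i"] PFor.prems N T_def by auto
    have "den p (?s i) x [] = i" using den_frame[of x p "?s i"] PFor.prems iter_loop_index[of "den p" x i s] by simp
    then have "exec (Assign x [] (Plus (Cell x []) (N 1))) (den p (?s i)) 1 (?s (Suc i))"
      using exec.Assign[of x "[]" "Plus (Cell x []) (N 1)" "den p (?s i)"] by simp
    then have c: "exec ?c (?s i) (t1 + 1) (?s (Suc i))" by (rule exec.Seq[OF t1(1)])
    obtain t2 where t2: "exec (While ?g ?c) (?s (Suc i)) t2 (?s B)" "t2 \<le> j * (T + 2) + 1"
      using Suc.IH[of "Suc i"] Suc.prems by auto
    show ?case using exec.WhileTrue[OF g c t2(1)] t1(2) t2(2)
      by (intro exI[of _ "1 + (t1 + 1) + t2"]) auto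
  qed
  obtain t where t: "exec (While ?g ?c) (?s 0) t (?s B)" "t \<le> B * (T + 2) + 1" using loop[of 0 B] by auto
  have "exec (Assign x [] (N 0)) s 1 (?s 0)" using exec.Assign[of x "[]" "N 0" s] by simp
  then have "exec (compile (PFor x p)) s (1 + t) (den (PFor x p) s)"
    using exec.Seq[OF _ t(1), of "Assign x [] (N 0)" s 1] unfolding B_def by simp
  then show ?case using t(2) B_def T_def by (intro exI[of _ "1 + t"]) auto
qed

lemma poly_nat_mono: "m \<le> n \<Longrightarrow> poly p m \<le> poly p (n :: nat)"
  by (induction p) (auto intro: add_mono mult_mono)

text \<open>The proof rule for loops. The step may assume that every name outside the body and the
  counter still has its initial value, so invariants need to mention only what the body
  changes.\<close>

lemma for_invariant:
  assumes x: "x \<notin> mods p" and B: "s ''N'' [] = B"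
    and init: "Inv 0 (store s x [] 0)"
    and step: "\<And>i s'. i < B \<Longrightarrow> s' x [] = i \<Longrightarrow> (\<And>y. y \<noteq> x \<Longrightarrow> y \<notin> mods p \<Longrightarrow> s' y = s y) \<Longrightarrow> Inv i s' \<Longrightarrow>
      Inv (Suc i) (store (den p s') x [] (Suc i))"
  shows "Inv B (den (PFor x p) s)"
proof -
  have "i \<le> B \<Longrightarrow> Inv i (iter_loop (den p) x i s)" for i
  proof (induction i)
    case (Suc i)
    then show ?case
      using step[of i "iter_loop (den p) x i s"] iter_loop_index iter_loop_frame by simp
  qed (use init in simp)
  then show ?thesis using B by simp
qed

section \<open>Derived expressions and the storage of edge sets\<close>

definition Var :: "string \<Rightarrow> aexp" where "Var x = Cell x []"
definition Pos :: "aexp \<Rightarrow> bexp" where "Pos a = Less (N 0) a"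
definition Eql :: "aexp \<Rightarrow> aexp \<Rightarrow> bexp" where "Eql a b = Conj (Neg (Less a b)) (Neg (Less b a))"
definition Disj :: "bexp \<Rightarrow> bexp \<Rightarrow> bexp" where "Disj a b = Neg (Conj (Neg a) (Neg b))"
definition Arr :: "string \<Rightarrow> string \<Rightarrow> aexp" where "Arr m x = Cell m [Var x]"
definition Adj :: "string \<Rightarrow> string \<Rightarrow> aexp" where "Adj x y = Cell ''adj'' [Var x, Var y]"

lemma aval_bval_derived [simp]:
  "aval (Var x) s = s x []" "bval (Pos a) s \<longleftrightarrow> aval a s \<noteq> 0" "bval (Eql a b) s \<longleftrightarrow> aval a s = aval b s"
  "bval (Disj b1 b2) s \<longleftrightarrow> bval b1 s \<or> bval b2 s" "aval (Arr m x) s = s m [s x []]"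
  "aval (Adj x y) s = s ''adj'' [s x [], s y []]"
  by (auto simp: Var_def Pos_def Eql_def Disj_def Arr_def Adj_def)

text \<open>No vertex set is recorded, since isolated vertices do not affect solvability. That all
  edges lie below \<open>''N''\<close> lets loops up to that value see the whole graph.\<close>

definition represents :: "state \<Rightarrow> nat set set \<Rightarrow> nat \<Rightarrow> bool" where
  "represents s E k \<longleftrightarrow> (\<forall>x y. s ''adj'' [x, y] = of_bool ({x, y} \<in> E)) \<and> s ''k'' [] = k \<and>
     simple_edges E \<and> \<Union>E \<subseteq> {..<s ''N'' []}"

lemma represents_cong:
  "represents s E k \<Longrightarrow> s' ''adj'' = s ''adj'' \<Longrightarrow> s' ''k'' = s ''k'' \<Longrightarrow> s' ''N'' = s ''N'' \<Longrightarrow> represents s' E k"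
  unfolding represents_def by simp

lemma represents_adj: "represents s E k \<Longrightarrow> s ''adj'' [x, y] = of_bool ({x, y} \<in> E)"
  unfolding represents_def by simp

lemma represents_lt: "represents s E k \<Longrightarrow> {x, y} \<in> E \<Longrightarrow> x < s ''N'' [] \<and> y < s ''N'' []"
  unfolding represents_def by auto

section \<open>Greedy matching in the complement of a common neighbourhood\<close>

definition match_step :: prog where
  "match_step = PIf (Conj (Pos (Adj ''u'' ''a'')) (Conj (Pos (Adj ''v'' ''a'')) (Conj (Pos (Adj ''u'' ''b''))
     (Conj (Pos (Adj ''v'' ''b'')) (Conj (Neg (Pos (Adj ''a'' ''b''))) (Conj (Neg (Eql (Var ''a'') (Var ''b'')))
     (Conj (Neg (Pos (Arr ''used'' ''a''))) (Neg (Pos (Arr ''used'' ''b''))))))))))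
     (PSeq (PAsg ''used'' [Var ''a''] (N 1)) (PSeq (PAsg ''used'' [Var ''b''] (N 1))
       (PAsg ''cnt'' [] (Plus (Var ''cnt'') (N 1)))))
     PSkip"

definition match_init :: prog where
  "match_init = PFor ''a'' (PAsg ''used'' [Var ''a''] (N 0))"

definition match_prog :: prog where
  "match_prog = PSeq (PAsg ''cnt'' [] (N 0)) (PSeq match_init (PFor ''a'' (PFor ''b'' match_step)))"

lemma match_mods [simp]:
  "mods match_step = {''used'', ''cnt''}" "mods match_init = {''a'', ''used''}"
  "mods match_prog = {''a'', ''b'', ''used'', ''cnt''}"
  by (auto simp: match_step_def match_init_def match_prog_def)

definition nonedge_matching :: "nat set set \<Rightarrow> nat \<Rightarrow> nat \<Rightarrow> nat set set \<Rightarrow> bool" where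
  "nonedge_matching E u v M \<longleftrightarrow> finite M \<and>
     (\<forall>p\<in>M. card p = 2 \<and> p \<notin> E \<and> p \<subseteq> common_nbrs E u v) \<and> (\<forall>p\<in>M. \<forall>q\<in>M. p \<noteq> q \<longrightarrow> p \<inter> q = {})"

text \<open>\<open>done\<close> holds for the pairs already examined; for these the greedy matching
  is maximal. The array \<open>''used''\<close> stores the vertices matched so far.\<close>

definition match_inv :: "nat set set \<Rightarrow> nat \<Rightarrow> nat \<Rightarrow> nat \<Rightarrow> (nat \<Rightarrow> nat \<Rightarrow> bool) \<Rightarrow> state \<Rightarrow> bool" where
  "match_inv E u v B done s \<longleftrightarrow> (\<exists>M. nonedge_matching E u v M \<and> card M = s ''cnt'' [] \<and>
     (\<forall>x<B. s ''used'' [x] \<noteq> 0 \<longleftrightarrow> x \<in> \<Union>M) \<and>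
     (\<forall>a b. done a b \<and> a \<in> common_nbrs E u v \<and> b \<in> common_nbrs E u v \<and> a \<noteq> b \<and> {a, b} \<notin> E \<longrightarrow>
        a \<in> \<Union>M \<or> b \<in> \<Union>M))"

lemma match_inv_cong:
  "match_inv E u v B D s \<Longrightarrow> s' ''cnt'' = s ''cnt'' \<Longrightarrow> s' ''used'' = s ''used'' \<Longrightarrow>
    (\<And>a b. D' a b \<Longrightarrow> a < B \<Longrightarrow> b < B \<Longrightarrow> D a b) \<Longrightarrow> common_nbrs E u v \<subseteq> {..<B} \<Longrightarrow> match_inv E u v B D' s'"
  unfolding match_inv_def by (auto simp: subset_iff) metis

lemma match_step_correct:
  assumes R: "represents s E k" and B: "s ''N'' [] = B" and inv: "match_inv E (s ''u'' []) (s ''v'' []) B D s"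
    and ab: "a = s ''a'' []" "b = s ''b'' []" "a < B" "b < B"
  shows "match_inv E (s ''u'' []) (s ''v'' []) B (\<lambda>x y. D x y \<or> x = a \<and> y = b) (den match_step s)"
proof -
  let ?u = "s ''u'' []" and ?v = "s ''v'' []"
  let ?C = "common_nbrs E ?u ?v"
  obtain M where M: "nonedge_matching E ?u ?v M" "card M = s ''cnt'' []"
    "\<And>x. x < B \<Longrightarrow> s ''used'' [x] \<noteq> 0 \<longleftrightarrow> x \<in> \<Union>M"
    "\<And>x y. D x y \<Longrightarrow> x \<in> ?C \<Longrightarrow> y \<in> ?C \<Longrightarrow> x \<noteq> y \<Longrightarrow> {x, y} \<notin> E \<Longrightarrow> x \<in> \<Union>M \<or> y \<in> \<Union>M"
    using inv unfolding match_inv_def by metis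
  note adj = represents_adj[OF R]
  let ?c = "a \<in> ?C \<and> b \<in> ?C \<and> {a, b} \<notin> E \<and> a \<noteq> b \<and> a \<notin> \<Union>M \<and> b \<notin> \<Union>M"
  have den: "den match_step s = (if ?c then
      store (store (store s ''used'' [a] 1) ''used'' [b] 1) ''cnt'' [] (s ''cnt'' [] + 1) else s)"
    unfolding match_step_def using ab M(3)[of a] M(3)[of b] by (auto simp: adj store_apply common_nbrs_def)
  show ?thesis
  proof (cases ?c)
    case True
    let ?M = "insert {a, b} M"
    have "{a, b} \<notin> M" using True by blast
    then have "card ?M = Suc (card M)" using M(1) unfolding nonedge_matching_def by simp
    moreover have "nonedge_matching E ?u ?v ?M"
      using M(1) True unfolding nonedge_matching_def by auto
    ultimately show ?thesis
      unfolding den match_inv_def using True M(2-4)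
      by (intro exI[of _ ?M] conjI) (auto simp: store_apply)
  next
    case False
    have "x \<in> \<Union>M \<or> y \<in> \<Union>M" if "D x y \<or> x = a \<and> y = b" "x \<in> ?C" "y \<in> ?C" "x \<noteq> y" "{x, y} \<notin> E" for x y
      using that M(4)[of x y] False by metis
    then have "match_inv E ?u ?v B (\<lambda>x y. D x y \<or> x = a \<and> y = b) s"
      unfolding match_inv_def using M(1-3) by metis
    moreover have "den match_step s = s" using den unfolding if_not_P[OF False] .
    ultimately show ?thesis by simp
  qed
qed

lemma common_nbrs_lt: "represents s E k \<Longrightarrow> common_nbrs E u v \<subseteq> {..<s ''N'' []}"
  using represents_lt[of s E k u] unfolding common_nbrs_def by auto

text \<open>Once all pairs have been examined, the matching is maximal, so its vertices meet every
  non-edge and the remaining common neighbours form a clique.\<close>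

lemma match_prog_correct:
  assumes R: "represents s E k"
  shows "\<exists>M. nonedge_matching E (s ''u'' []) (s ''v'' []) M \<and> card M = den match_prog s ''cnt'' [] \<and>
    is_clique E (common_nbrs E (s ''u'' []) (s ''v'' []) - \<Union>M)"
proof -
  let ?u = "s ''u'' []" and ?v = "s ''v'' []"
  define B where "B = s ''N'' []"
  let ?C = "common_nbrs E ?u ?v"
  have CB: "?C \<subseteq> {..<B}" unfolding B_def by (rule common_nbrs_lt[OF R])
  define s1 where "s1 = den match_init (den (PAsg ''cnt'' [] (N 0)) s)"
  have frame: "s1 y = s y" if "y \<notin> {''a'', ''used'', ''cnt''}" for y
    unfolding s1_def using that den_frame[of y match_init] by (simp add: store_other)
  have cnt: "s1 ''cnt'' [] = 0" unfolding s1_def using den_frame[of "''cnt''" match_init] by (simp add: store_apply)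
  have used: "\<forall>x<B. s1 ''used'' [x] = 0"
    unfolding s1_def match_init_def
    by (rule for_invariant[where Inv = "\<lambda>i s'. \<forall>x<i. s' ''used'' [x] = 0" and B = B])
      (auto simp: store_apply B_def less_Suc_eq)
  have inv0: "match_inv E ?u ?v B (\<lambda>x y. x < (0::nat)) s1"
    unfolding match_inv_def nonedge_matching_def using cnt used by (intro exI[of _ "{}"]) simp
  have "match_inv E ?u ?v B (\<lambda>x y. x < B) (den (PFor ''a'' (PFor ''b'' match_step)) s1)"
  proof (rule for_invariant[where Inv = "\<lambda>i. match_inv E ?u ?v B (\<lambda>x y. x < i)" and B = B])
    show "s1 ''N'' [] = B" using frame B_def by simp
    show "match_inv E ?u ?v B (\<lambda>x y. x < 0) (store s1 ''a'' [] 0)"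
      using match_inv_cong[OF inv0, of "store s1 ''a'' [] 0"] CB by (simp add: store_other)
    fix i s2
    assume i: "i < B" "s2 ''a'' [] = i" and fr: "\<And>y. y \<noteq> ''a'' \<Longrightarrow> y \<notin> mods (PFor ''b'' match_step) \<Longrightarrow> s2 y = s1 y"
      and inv: "match_inv E ?u ?v B (\<lambda>x y. x < i) s2"
    have fr2: "s2 y = s y" if "y \<notin> {''a'', ''b'', ''used'', ''cnt''}" for y
      using that fr frame by simp
    have "match_inv E ?u ?v B (\<lambda>x y. x < i \<or> x = i \<and> y < B) (den (PFor ''b'' match_step) s2)"
    proof (rule for_invariant[where Inv = "\<lambda>j. match_inv E ?u ?v B (\<lambda>x y. x < i \<or> x = i \<and> y < j)" and B = B])
      show "s2 ''N'' [] = B" using fr2 B_def by simp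
      show "match_inv E ?u ?v B (\<lambda>x y. x < i \<or> x = i \<and> y < 0) (store s2 ''b'' [] 0)"
        using match_inv_cong[OF inv, of "store s2 ''b'' [] 0"] CB by (simp add: store_other)
      fix j s3
      assume j: "j < B" "s3 ''b'' [] = j" and fr': "\<And>y. y \<noteq> ''b'' \<Longrightarrow> y \<notin> mods match_step \<Longrightarrow> s3 y = s2 y"
        and inv3: "match_inv E ?u ?v B (\<lambda>x y. x < i \<or> x = i \<and> y < j) s3"
      have fr3: "s3 y = s y" if "y \<notin> {''a'', ''b'', ''used'', ''cnt''}" for y
        using that fr2 fr' by simp
      have R3: "represents s3 E k" by (rule represents_cong[OF R]) (simp_all add: fr3)
      have a3: "s3 ''a'' [] = i" using fr' i by simp
      have "match_inv E ?u ?v B (\<lambda>x y. (x < i \<or> x = i \<and> y < j) \<or> x = i \<and> y = j) (den match_step s3)"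
      proof -
        have eq: "s3 ''u'' = s ''u''" "s3 ''v'' = s ''v''" "s3 ''N'' [] = B" using fr3 B_def by simp_all
        show ?thesis
          using match_step_correct[OF R3 eq(3), unfolded eq(1,2), OF inv3 a3[symmetric] j(2)[symmetric] i(1) j(1)] .
      qed
      then show "match_inv E ?u ?v B (\<lambda>x y. x < i \<or> x = i \<and> y < Suc j) (store (den match_step s3) ''b'' [] (Suc j))"
        by (rule match_inv_cong) (use CB in \<open>auto simp: store_other less_Suc_eq\<close>)
    qed simp
    then show "match_inv E ?u ?v B (\<lambda>x y. x < Suc i) (store (den (PFor ''b'' match_step) s2) ''a'' [] (Suc i))"
      by (rule match_inv_cong) (use CB in \<open>auto simp: store_other less_Suc_eq\<close>)
  qed simp
  moreover have "den (PFor ''a'' (PFor ''b'' match_step)) s1 = den match_prog s"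
    unfolding match_prog_def s1_def by (simp only: den.simps)
  ultimately obtain M where M: "nonedge_matching E ?u ?v M" "card M = den match_prog s ''cnt'' []"
    "\<And>x y. x < B \<Longrightarrow> x \<in> ?C \<Longrightarrow> y \<in> ?C \<Longrightarrow> x \<noteq> y \<Longrightarrow> {x, y} \<notin> E \<Longrightarrow> x \<in> \<Union>M \<or> y \<in> \<Union>M"
    unfolding match_inv_def by auto
  moreover have "is_clique E (?C - \<Union>M)" unfolding is_clique_def using M(3) CB by blast
  ultimately show ?thesis by metis
qed

section \<open>Simplicial vertices of the hull of an edge\<close>

definition hull_prog :: prog where
  "hull_prog = PFor ''a'' (PIf (Disj (Eql (Var ''a'') (Var ''u'')) (Disj (Eql (Var ''a'') (Var ''v''))
      (Conj (Pos (Adj ''u'' ''a'')) (Pos (Adj ''v'' ''a'')))))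
     (PAsg ''hull'' [Var ''a''] (N 1)) (PAsg ''hull'' [Var ''a''] (N 0)))"

definition nbrs_prog :: prog where
  "nbrs_prog = PFor ''z'' (PIf (Conj (Pos (Adj ''a'' ''z'')) (Conj (Pos (Adj ''b'' ''z'')) (Neg (Pos (Arr ''hull'' ''z'')))))
     (PAsg ''simplicial'' [] (N 0)) PSkip)"

definition test_prog :: prog where
  "test_prog = PFor ''b'' (PIf (Conj (Pos (Arr ''hull'' ''b'')) (Neg (Eql (Var ''a'') (Var ''b''))))
     (PSeq (PIf (Pos (Adj ''a'' ''b'')) PSkip (PAsg ''clique'' [] (N 0))) nbrs_prog) PSkip)"

text \<open>Counting \<open>''cK''\<close> and \<open>''cS''\<close> reduces the question whether
  all vertices are simplicial to a comparison of numbers. \<open>''w''\<close> keeps the last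
  simplicial vertex found; any of them would serve.\<close>

definition count_prog :: prog where
  "count_prog = PSeq (PAsg ''clique'' [] (N 1)) (PSeq (PAsg ''cK'' [] (N 0)) (PSeq (PAsg ''cS'' [] (N 0))
     (PFor ''a'' (PIf (Pos (Arr ''hull'' ''a''))
       (PSeq (PAsg ''simplicial'' [] (N 1)) (PSeq (PAsg ''cK'' [] (Plus (Var ''cK'') (N 1))) (PSeq test_prog
         (PIf (Pos (Var ''simplicial''))
           (PSeq (PAsg ''cS'' [] (Plus (Var ''cS'') (N 1))) (PAsg ''w'' [] (Var ''a''))) PSkip))))
       PSkip))))"

lemma hull_mods [simp]:
  "mods hull_prog = {''a'', ''hull''}" "mods nbrs_prog = {''z'', ''simplicial''}"
  "mods test_prog = {''b'', ''z'', ''simplicial'', ''clique''}"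
  "mods count_prog = {''a'', ''b'', ''z'', ''simplicial'', ''clique'', ''cK'', ''cS'', ''w''}"
  by (auto simp: hull_prog_def nbrs_prog_def test_prog_def count_prog_def)

lemma hull_prog_correct:
  assumes R: "represents s E k"
  shows "\<forall>x<s ''N'' []. den hull_prog s ''hull'' [x] = of_bool (x \<in> edge_hull E (s ''u'' []) (s ''v'' []))"
  unfolding hull_prog_def
proof (rule for_invariant[where B = "s ''N'' []" and
    Inv = "\<lambda>i s'. \<forall>x<i. s' ''hull'' [x] = of_bool (x \<in> edge_hull E (s ''u'' []) (s ''v'' []))"])
  fix i s'
  assume i: "s' ''a'' [] = i" and inv: "\<forall>x<i. s' ''hull'' [x] = of_bool (x \<in> edge_hull E (s ''u'' []) (s ''v'' []))"
    and fr: "\<And>y. y \<noteq> ''a'' \<Longrightarrow> y \<notin> mods (PIf (Disj (Eql (Var ''a'') (Var ''u'')) (Disj (Eql (Var ''a'') (Var ''v''))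
      (Conj (Pos (Adj ''u'' ''a'')) (Pos (Adj ''v'' ''a'')))))
     (PAsg ''hull'' [Var ''a''] (N 1)) (PAsg ''hull'' [Var ''a''] (N 0))) \<Longrightarrow> s' y = s y"
  have eq: "s' ''u'' = s ''u''" "s' ''v'' = s ''v''" "s' ''adj'' = s ''adj''" using fr by simp_all
  show "\<forall>x<Suc i. store (den (PIf (Disj (Eql (Var ''a'') (Var ''u'')) (Disj (Eql (Var ''a'') (Var ''v''))
      (Conj (Pos (Adj ''u'' ''a'')) (Pos (Adj ''v'' ''a'')))))
     (PAsg ''hull'' [Var ''a''] (N 1)) (PAsg ''hull'' [Var ''a''] (N 0))) s') ''a'' [] (Suc i) ''hull'' [x] =
      of_bool (x \<in> edge_hull E (s ''u'' []) (s ''v'' []))"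
    using inv by (auto simp: store_apply eq i represents_adj[OF R] edge_hull_def common_nbrs_def less_Suc_eq)
qed simp_all

lemma nbrs_prog_correct:
  assumes R: "represents s E k" and K: "\<forall>x<s ''N'' []. s ''hull'' [x] = of_bool (x \<in> K)"
  shows "den nbrs_prog s ''simplicial'' [] \<noteq> 0 \<longleftrightarrow>
    s ''simplicial'' [] \<noteq> 0 \<and> common_nbrs E (s ''a'' []) (s ''b'' []) \<subseteq> K"
proof -
  let ?a = "s ''a'' []" and ?b = "s ''b'' []"
  have "den nbrs_prog s ''simplicial'' [] \<noteq> 0 \<longleftrightarrow> s ''simplicial'' [] \<noteq> 0 \<and>
      (\<forall>z<s ''N'' []. z \<in> common_nbrs E ?a ?b \<longrightarrow> z \<in> K)"
    unfolding nbrs_prog_def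
  proof (rule for_invariant[where B = "s ''N'' []" and Inv = "\<lambda>i s'. s' ''simplicial'' [] \<noteq> 0 \<longleftrightarrow>
      s ''simplicial'' [] \<noteq> 0 \<and> (\<forall>z<i. z \<in> common_nbrs E ?a ?b \<longrightarrow> z \<in> K)"], goal_cases)
    case (4 i s')
    have eq: "s' ''a'' = s ''a''" "s' ''b'' = s ''b''" "s' ''adj'' = s ''adj''" "s' ''hull'' = s ''hull''"
      using 4(3) by simp_all
    show ?case using 4(1,2,4) K
      by (auto simp: store_apply eq represents_adj[OF R] common_nbrs_def less_Suc_eq)
  qed (simp_all add: store_apply)
  then show ?thesis using common_nbrs_lt[OF R, of ?a ?b] by auto
qed

lemma test_prog_correct:
  assumes R: "represents s E k" and K: "\<forall>x<s ''N'' []. s ''hull'' [x] = of_bool (x \<in> K)"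
    and KB: "K \<subseteq> {..<s ''N'' []}"
  defines "a \<equiv> s ''a'' []"
  shows "(den test_prog s ''clique'' [] \<noteq> 0 \<longleftrightarrow> s ''clique'' [] \<noteq> 0 \<and> (\<forall>b\<in>K. a \<noteq> b \<longrightarrow> {a, b} \<in> E)) \<and>
    (den test_prog s ''simplicial'' [] \<noteq> 0 \<longleftrightarrow>
      s ''simplicial'' [] \<noteq> 0 \<and> (\<forall>b\<in>K. a \<noteq> b \<longrightarrow> common_nbrs E a b \<subseteq> K))"
proof -
  let ?Inv = "\<lambda>i s'. (s' ''clique'' [] \<noteq> 0 \<longleftrightarrow> s ''clique'' [] \<noteq> 0 \<and> (\<forall>b<i. b \<in> K \<longrightarrow> a \<noteq> b \<longrightarrow> {a, b} \<in> E)) \<and>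
    (s' ''simplicial'' [] \<noteq> 0 \<longleftrightarrow>
      s ''simplicial'' [] \<noteq> 0 \<and> (\<forall>b<i. b \<in> K \<longrightarrow> a \<noteq> b \<longrightarrow> common_nbrs E a b \<subseteq> K))"
  have "?Inv (s ''N'' []) (den test_prog s)"
    unfolding test_prog_def
  proof (rule for_invariant[where B = "s ''N'' []" and Inv = ?Inv], goal_cases)
    case (4 i s')
    have eq: "s' ''a'' = s ''a''" "s' ''N'' = s ''N''" "s' ''adj'' = s ''adj''" "s' ''k'' = s ''k''"
      "s' ''hull'' = s ''hull''" using 4(3) by simp_all
    define s2 where "s2 = den (PIf (Pos (Adj ''a'' ''b'')) PSkip (PAsg ''clique'' [] (N 0))) s'"
    have eq2: "s2 y = s' y" if "y \<noteq> ''clique''" for y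
      unfolding s2_def using that by (simp add: store_other)
    have cl2: "s2 ''clique'' [] \<noteq> 0 \<longleftrightarrow> s' ''clique'' [] \<noteq> 0 \<and> {a, i} \<in> E"
      unfolding s2_def using 4(2) by (simp add: store_apply eq represents_adj[OF R] a_def)
    have R2: "represents s2 E k" by (rule represents_cong[OF R]) (simp_all add: eq eq2)
    have "den nbrs_prog s2 ''simplicial'' [] \<noteq> 0 \<longleftrightarrow> s' ''simplicial'' [] \<noteq> 0 \<and> common_nbrs E a i \<subseteq> K"
      using nbrs_prog_correct[OF R2, of K] K 4(2) by (simp add: eq eq2 a_def)
    moreover have "den nbrs_prog s2 ''clique'' = s2 ''clique''" by (rule den_frame) simp
    moreover have "den (PIf (Conj (Pos (Arr ''hull'' ''b'')) (Neg (Eql (Var ''a'') (Var ''b''))))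
     (PSeq (PIf (Pos (Adj ''a'' ''b'')) PSkip (PAsg ''clique'' [] (N 0))) nbrs_prog) PSkip) s' =
      (if i \<in> K \<and> a \<noteq> i then den nbrs_prog s2 else s')"
      unfolding s2_def using K 4(1,2) by (simp add: eq a_def)
    ultimately show ?case using 4(4) cl2 by (auto simp: store_apply less_Suc_eq)
  qed (simp_all add: store_apply)
  then show ?thesis using KB by auto
qed

lemma card_less_Suc_if: "card {a \<in> A. a < Suc i} = card {a \<in> A. a < i} + (if i \<in> A then 1 else 0)"
proof -
  have "{a \<in> A. a < Suc i} = (if i \<in> A then insert i {a \<in> A. a < i} else {a \<in> A. a < i})"
    by (auto simp: less_Suc_eq)
  moreover have "finite {a \<in> A. a < i}" by simp
  ultimately show ?thesis by simp
qed

lemma count_prog_correct: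
  assumes R: "represents s E k" and K: "\<forall>x<s ''N'' []. s ''hull'' [x] = of_bool (x \<in> K)"
    and KB: "K \<subseteq> {..<s ''N'' []}"
  defines "S \<equiv> simplicial_verts E K"
  shows "(den count_prog s ''clique'' [] \<noteq> 0 \<longleftrightarrow> is_clique E K) \<and> den count_prog s ''cK'' [] = card K \<and>
    den count_prog s ''cS'' [] = card S \<and> (card S \<noteq> 0 \<longrightarrow> den count_prog s ''w'' [] \<in> S)"
proof -
  define s1 where "s1 = store (store (store s ''clique'' [] 1) ''cK'' [] 0) ''cS'' [] 0"
  let ?Inv = "\<lambda>i s'. (s' ''clique'' [] \<noteq> 0 \<longleftrightarrow> (\<forall>a<i. a \<in> K \<longrightarrow> (\<forall>b\<in>K. a \<noteq> b \<longrightarrow> {a, b} \<in> E))) \<and>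
    s' ''cK'' [] = card {a \<in> K. a < i} \<and> s' ''cS'' [] = card {a \<in> S. a < i} \<and>
    (card {a \<in> S. a < i} \<noteq> 0 \<longrightarrow> s' ''w'' [] \<in> S)"
  let ?body = "PIf (Pos (Arr ''hull'' ''a''))
       (PSeq (PAsg ''simplicial'' [] (N 1)) (PSeq (PAsg ''cK'' [] (Plus (Var ''cK'') (N 1))) (PSeq test_prog
         (PIf (Pos (Var ''simplicial''))
           (PSeq (PAsg ''cS'' [] (Plus (Var ''cS'') (N 1))) (PAsg ''w'' [] (Var ''a''))) PSkip)))) PSkip"
  have "?Inv (s ''N'' []) (den (PFor ''a'' ?body) s1)"
  proof (rule for_invariant[where B = "s ''N'' []" and Inv = ?Inv], goal_cases)
    case (4 i s')
    have eq: "s' ''N'' = s ''N''" "s' ''adj'' = s ''adj''" "s' ''k'' = s ''k''" "s' ''hull'' = s ''hull''"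
      using 4(3) by (simp_all add: s1_def store_other)
    show ?case
    proof (cases "i \<in> K")
      case False
      then have d: "den ?body s' = s'" using K 4(1,2) by (simp add: eq)
      have "i \<notin> S" using False unfolding S_def simplicial_verts_def by simp
      then show ?thesis unfolding d using 4(4) False by (simp add: store_apply card_less_Suc_if All_less_Suc)
    next
      case True
      define s2 where "s2 = store (store s' ''simplicial'' [] 1) ''cK'' [] (s' ''cK'' [] + 1)"
      define s3 where "s3 = den test_prog s2"
      have eq2: "s2 y = s' y" if "y \<notin> {''simplicial'', ''cK''}" for y
        using that unfolding s2_def by (simp add: store_other)
      have eq3: "s3 y = s2 y" if "y \<notin> {''b'', ''z'', ''simplicial'', ''clique''}" for y
        unfolding s3_def using that by (intro den_frame) simp
      have R2: "represents s2 E k" by (rule represents_cong[OF R]) (simp_all add: eq eq2)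
      have t: "s3 ''clique'' [] \<noteq> 0 \<longleftrightarrow> s' ''clique'' [] \<noteq> 0 \<and> (\<forall>b\<in>K. i \<noteq> b \<longrightarrow> {i, b} \<in> E)"
        "s3 ''simplicial'' [] \<noteq> 0 \<longleftrightarrow> (\<forall>b\<in>K. i \<noteq> b \<longrightarrow> common_nbrs E i b \<subseteq> K)"
        using test_prog_correct[OF R2, of K] K KB 4(2) unfolding s3_def
        by (simp_all add: eq eq2) (simp_all add: s2_def store_apply)
      have iS: "s3 ''simplicial'' [] \<noteq> 0 \<longleftrightarrow> i \<in> S"
        unfolding t(2) S_def simplicial_verts_def using True by auto
      have cK: "s3 ''cK'' [] = s' ''cK'' [] + 1" using eq3 unfolding s2_def by (simp add: store_apply)
      have oth: "s3 ''cS'' = s' ''cS''" "s3 ''w'' = s' ''w''" "s3 ''a'' = s' ''a''" using eq2 eq3 by simp_all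
      have d: "den ?body s' = (if i \<in> S then store (store s3 ''cS'' [] (s' ''cS'' [] + 1)) ''w'' [] i else s3)"
      proof -
        have "den ?body s' = den (PIf (Pos (Var ''simplicial''))
           (PSeq (PAsg ''cS'' [] (Plus (Var ''cS'') (N 1))) (PAsg ''w'' [] (Var ''a''))) PSkip) s3"
          using K 4(1,2) True unfolding s3_def s2_def by (simp add: eq store_apply)
        then show ?thesis using iS 4(2) by (simp add: oth store_apply)
      qed
      show ?thesis unfolding d using 4(4) True t(1) cK
        by (auto simp: store_apply card_less_Suc_if All_less_Suc oth)
    qed
  qed (simp_all add: store_apply s1_def)
  moreover have "den count_prog s = den (PFor ''a'' ?body) s1"
    unfolding count_prog_def s1_def by (simp only: den.simps aval.simps list.map)
  moreover have "{a \<in> K. a < s ''N'' []} = K" "{a \<in> S. a < s ''N'' []} = S"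
    using KB unfolding S_def simplicial_verts_def by auto
  moreover have "(\<forall>a<s ''N'' []. a \<in> K \<longrightarrow> (\<forall>b\<in>K. a \<noteq> b \<longrightarrow> {a, b} \<in> E)) \<longleftrightarrow> is_clique E K"
    using KB unfolding is_clique_def by auto
  ultimately show ?thesis by simp
qed

definition detach_prog :: prog where
  "detach_prog = PFor ''a'' (PIf (Pos (Arr ''hull'' ''a''))
     (PSeq (PAsg ''adj'' [Var ''w'', Var ''a''] (N 0)) (PAsg ''adj'' [Var ''a'', Var ''w''] (N 0))) PSkip)"

lemma detach_mods [simp]: "mods detach_prog = {''a'', ''adj''}"
  by (auto simp: detach_prog_def)

lemma detach_prog_correct:
  assumes R: "represents s E k" and K: "\<forall>x<s ''N'' []. s ''hull'' [x] = of_bool (x \<in> K)"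
    and KB: "K \<subseteq> {..<s ''N'' []}"
  shows "represents (den detach_prog s) (detach E (s ''w'' []) K) k"
proof -
  let ?w = "s ''w'' []"
  let ?Inv = "\<lambda>i s'. \<forall>x y. s' ''adj'' [x, y] =
    of_bool ({x, y} \<in> E \<and> \<not> (x = ?w \<and> y \<in> K \<and> y < i) \<and> \<not> (y = ?w \<and> x \<in> K \<and> x < i))"
  have "?Inv (s ''N'' []) (den detach_prog s)"
    unfolding detach_prog_def
  proof (rule for_invariant[where B = "s ''N'' []" and Inv = ?Inv], goal_cases)
    case (4 i s')
    have eq: "s' ''w'' = s ''w''" "s' ''hull'' = s ''hull''" using 4(3) by simp_all
    show ?case using 4(1,2,4) K by (auto simp: store_apply eq less_Suc_eq)
  qed (simp_all add: store_apply represents_adj[OF R])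
  then have "\<forall>x y. den detach_prog s ''adj'' [x, y] = of_bool ({x, y} \<in> detach E ?w K)"
    using KB unfolding mem_detach by (auto simp: subset_iff)
  moreover have "den detach_prog s ''k'' = s ''k''" "den detach_prog s ''N'' = s ''N''"
    by (rule den_frame, simp)+
  ultimately show ?thesis using R detach_subset[of E ?w K] simple_edges_subset[of E "detach E ?w K"]
    Union_mono[OF detach_subset[of E ?w K]] unfolding represents_def by (simp add: subset_trans)
qed

section \<open>Exhaustive reduction\<close>

text \<open>The hull is examined only if the greedy matching has at most \<open>k\<close> pairs.
  With \<open>k = 0\<close> a forced deletion proves a no-instance. The tests on \<open>N t\<close>
  compare constants and select the variant of the problem.\<close>

definition reduce_edge_prog :: "nat \<Rightarrow> prog" where
  "reduce_edge_prog t = PIf (Pos (Adj ''u'' ''v''))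
     (PSeq match_prog (PIf (Less (Var ''k'') (Var ''cnt''))
       (PIf (Pos (Var ''k''))
         (PSeq (PAsg ''adj'' [Var ''u'', Var ''v''] (N 0)) (PSeq (PAsg ''adj'' [Var ''v'', Var ''u''] (N 0))
           (PSeq (PAsg ''k'' [] (Minus (Var ''k'') (N 1))) (PAsg ''changed'' [] (N 1)))))
         (PAsg ''no'' [] (N 1)))
       (PSeq hull_prog (PSeq count_prog
         (PIf (Conj (Pos (Var ''clique'')) (Disj
             (Conj (Neg (Less (Var ''cS'') (Var ''cK''))) (Disj (Eql (N t) (N 0)) (Less (Var ''cK'') (N t))))
             (Conj (Eql (N t) (N 0)) (Neg (Less (Var ''cS'') (Plus (Plus (Var ''k'') (Var ''k'')) (N 4)))))))
           (PSeq detach_prog (PAsg ''changed'' [] (N 1))) PSkip)))))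
     PSkip"

lemma reduce_edge_mods: "mods (reduce_edge_prog t) = {''a'', ''b'', ''used'', ''cnt'', ''adj'', ''k'', ''changed'', ''no'',
    ''hull'', ''z'', ''simplicial'', ''clique'', ''cK'', ''cS'', ''w''}"
  by (auto simp: reduce_edge_prog_def)

definition valid_state :: "nat \<Rightarrow> nat set set \<Rightarrow> nat \<Rightarrow> state \<Rightarrow> nat set set \<Rightarrow> nat \<Rightarrow> bool" where
  "valid_state t E0 k0 s E k \<longleftrightarrow> represents s E k \<and> k \<le> k0 \<and> (solvable t E k \<longleftrightarrow> solvable t E0 k0) \<and>
     (s ''no'' [] \<noteq> 0 \<longrightarrow> \<not> solvable t E0 k0)"

lemma valid_state_cong:
  "valid_state t E0 k0 s E k \<Longrightarrow> s' ''adj'' = s ''adj'' \<Longrightarrow> s' ''k'' = s ''k'' \<Longrightarrow> s' ''N'' = s ''N'' \<Longrightarrow>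
    s' ''no'' = s ''no'' \<Longrightarrow> valid_state t E0 k0 s' E k"
  unfolding valid_state_def using represents_cong[of s E k s'] by simp

lemma represents_delete_edge:
  assumes R: "represents s E k"
  shows "represents (store (store (store s ''adj'' [u, v] 0) ''adj'' [v, u] 0) ''k'' [] k') (E - {{u, v}}) k'"
  using R simple_edges_subset[of E "E - {{u, v}}"] unfolding represents_def
  by (auto simp: store_apply doubleton_eq_iff)

text \<open>Either the instance is a no-instance, where nothing more need be tracked, or an edge is
  lost and the flag is raised, or nothing happens because neither rule applies. The strict loss of
  edges drives termination.\<close>

lemma reduce_edge_correct:
  assumes V: "valid_state t E0 k0 s E k" and t: "t = 0 \<or> 4 \<le> t"
  defines "s' \<equiv> den (reduce_edge_prog t) s"
  shows "\<exists>E' k'. valid_state t E0 k0 s' E' k' \<and> card E' \<le> card E \<and>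
    (\<not> solvable t E0 k0 \<or> s' ''changed'' [] \<noteq> 0 \<and> card E' < card E \<or>
     s' ''changed'' [] = s ''changed'' [] \<and> E' = E \<and> k' = k \<and> reduced_at t E k (s ''u'' []) (s ''v'' []))"
proof -
  let ?u = "s ''u'' []" and ?v = "s ''v'' []"
  have R: "represents s E k" using V unfolding valid_state_def by simp
  have sE: "simple_edges E" and fE: "finite E" using R unfolding represents_def simple_edges_def by simp_all
  show ?thesis
  proof (cases "{?u, ?v} \<in> E")
    case False
    then have "s' = s" unfolding s'_def reduce_edge_prog_def by (simp add: represents_adj[OF R])
    moreover have "reduced_at t E k ?u ?v" using False unfolding reduced_at_def by simp
    ultimately show ?thesis using V by auto
  next
    case True
    define s1 where "s1 = den match_prog s"
    have eq1: "s1 y = s y" if "y \<notin> {''a'', ''b'', ''used'', ''cnt''}" for y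
      unfolding s1_def using that by (intro den_frame) simp
    have R1: "represents s1 E k" by (rule represents_cong[OF R]) (simp_all add: eq1)
    have k1: "s1 ''k'' [] = k" using R1 unfolding represents_def by simp
    have V1: "valid_state t E0 k0 s1 E k" by (rule valid_state_cong[OF V]) (simp_all add: eq1)
    obtain M where M: "nonedge_matching E ?u ?v M" "card M = s1 ''cnt'' []"
      "is_clique E (common_nbrs E ?u ?v - \<Union>M)"
      using match_prog_correct[OF R] unfolding s1_def by metis
    show ?thesis
    proof (cases "k < card M")
      case forced: True
      have "solvable t E k \<longleftrightarrow> k > 0 \<and> solvable t (E - {{?u, ?v}}) (k - 1)"
        using M(1) unfolding nonedge_matching_def
        by (intro solvable_forced_edge[OF sE True _ _ forced]) auto
      note sol = this
      show ?thesis
      proof (cases "k = 0")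
        case True
        have "s' = store s1 ''no'' [] 1"
          unfolding s'_def reduce_edge_prog_def using \<open>{?u, ?v} \<in> E\<close> forced True M(2) k1
          by (simp add: represents_adj[OF R] s1_def[symmetric])
        moreover have "represents (store s1 ''no'' [] 1) E k"
          by (rule represents_cong[OF R1]) (simp_all add: store_other)
        ultimately show ?thesis using V sol True unfolding valid_state_def
          by (auto simp: store_apply)
      next
        case False
        define s2 where "s2 = store (store (store s1 ''adj'' [?u, ?v] 0) ''adj'' [?v, ?u] 0) ''k'' [] (k - 1)"
        have s': "s' = store s2 ''changed'' [] 1"
          unfolding s'_def reduce_edge_prog_def using \<open>{?u, ?v} \<in> E\<close> forced False M(2) k1
          by (simp add: represents_adj[OF R] s1_def[symmetric] s2_def store_apply eq1)
        have R2: "represents s2 (E - {{?u, ?v}}) (k - 1)"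
          unfolding s2_def by (rule represents_delete_edge[OF R1])
        have "represents s' (E - {{?u, ?v}}) (k - 1)"
          unfolding s' by (rule represents_cong[OF R2]) (simp_all add: store_other)
        moreover have "s' ''no'' = s ''no''" "s' ''changed'' [] = 1"
          unfolding s' s2_def by (simp_all add: store_other store_apply eq1)
        moreover have "card (E - {{?u, ?v}}) < card E" using True fE by (metis card_Diff1_less)
        ultimately show ?thesis using V sol False unfolding valid_state_def
          by (intro exI[of _ "E - {{?u, ?v}}"] exI[of _ "k - 1"]) auto
      qed
    next
      case few: False
      define K where "K = edge_hull E ?u ?v"
      define S where "S = simplicial_verts E K"
      define s2 where "s2 = den hull_prog s1"
      define s3 where "s3 = den count_prog s2"
      have eq2: "s2 y = s1 y" if "y \<notin> {''a'', ''hull''}" for y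
        unfolding s2_def using that by (intro den_frame) simp
      have eq3: "s3 y = s2 y" if "y \<notin> {''a'', ''b'', ''z'', ''simplicial'', ''clique'', ''cK'', ''cS'', ''w''}" for y
        unfolding s3_def using that by (intro den_frame) simp
      have R2: "represents s2 E k" by (rule represents_cong[OF R1]) (simp_all add: eq2)
      have R3: "represents s3 E k" by (rule represents_cong[OF R2]) (simp_all add: eq3)
      have V3: "valid_state t E0 k0 s3 E k" by (rule valid_state_cong[OF V1]) (simp_all add: eq2 eq3)
      have hull: "\<forall>x<s2 ''N'' []. s2 ''hull'' [x] = of_bool (x \<in> K)"
        using hull_prog_correct[OF R1] unfolding s2_def[symmetric] K_def by (simp add: eq1 eq2)
      have hull3: "\<forall>x<s3 ''N'' []. s3 ''hull'' [x] = of_bool (x \<in> K)" using hull by (simp add: eq3)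
      have KB: "K \<subseteq> {..<s2 ''N'' []}" and KB3: "K \<subseteq> {..<s3 ''N'' []}"
        unfolding K_def edge_hull_def using common_nbrs_lt[OF R2, of ?u ?v] represents_lt[OF R2 True]
        by (auto simp: eq3)
      have fK: "finite K" using KB finite_subset by blast
      have SK: "S \<subseteq> K" unfolding S_def simplicial_verts_def by auto
      have fS: "finite S" using SK fK by (rule finite_subset)
      have cnt: "s3 ''clique'' [] \<noteq> 0 \<longleftrightarrow> is_clique E K" "s3 ''cK'' [] = card K" "s3 ''cS'' [] = card S"
        "card S \<noteq> 0 \<longrightarrow> s3 ''w'' [] \<in> S"
        using count_prog_correct[OF R2 hull KB] unfolding s3_def S_def by simp_all
      have k3: "s3 ''k'' [] = k" using R3 unfolding represents_def by simp
      have card_eq: "\<not> card S < card K \<longleftrightarrow> S = K"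
        using SK fK card_mono[OF fK SK] card_subset_eq[OF fK SK] by auto
      have det: "detachable t E k K \<longleftrightarrow> is_clique E K \<and>
          (\<not> card S < card K \<and> (t = 0 \<or> card K < t) \<or> t = 0 \<and> \<not> card S < k + k + 4)"
        unfolding detachable_def S_def[symmetric] card_eq by auto
      have s': "s' = (if detachable t E k K then store (den detach_prog s3) ''changed'' [] 1 else s3)"
        unfolding s'_def reduce_edge_prog_def det using \<open>{?u, ?v} \<in> E\<close> few M(2) k1 cnt k3
        by (simp add: represents_adj[OF R] s1_def[symmetric] s2_def[symmetric] s3_def[symmetric]) auto
      show ?thesis
      proof (cases "detachable t E k K")
        case D: True
        let ?w = "s3 ''w'' []"
        \<comment> \<open>A hull has two distinct vertices, so it contains a simplicial one whenever
          it is detachable, and detaching really removes an edge.\<close>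
        have K2: "?u \<in> K" "?v \<in> K" "?u \<noteq> ?v" unfolding K_def edge_hull_def using edge_neq[OF sE True] by auto
        have "card K \<noteq> 0" using K2 fK by auto
        then have "card S \<noteq> 0" using D unfolding det by auto
        then have w: "?w \<in> S" using cnt(4) by simp
        let ?E = "detach E ?w K"
        have Rd: "represents (den detach_prog s3) ?E k" by (rule detach_prog_correct[OF R3 hull3 KB3])
        have "represents s' ?E k" unfolding s' if_P[OF D]
          by (rule represents_cong[OF Rd]) (simp_all add: store_other)
        moreover have "s' ''no'' = s ''no''" "s' ''changed'' [] = 1" unfolding s' if_P[OF D]
          using den_frame[of "''no''" detach_prog s3] by (simp_all add: store_other store_apply eq1 eq2 eq3)
        moreover have "solvable t ?E k \<longleftrightarrow> solvable t E k"
          using solvable_detach[OF sE t D fK] w unfolding S_def by simp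
        moreover have "card ?E < card E"
        proof -
          obtain x where x: "x \<in> K" "x \<noteq> ?w" using K2 by metis
          have "{?w, x} \<in> E" using is_cliqueD[of E K ?w x] D w SK x unfolding detachable_def by auto
          moreover have "{?w, x} \<notin> ?E" using x unfolding mem_detach by simp
          ultimately have "?E \<subset> E" using detach_subset[of E ?w K] by auto
          then show ?thesis by (rule psubset_card_mono[OF fE])
        qed
        ultimately show ?thesis using V unfolding valid_state_def
          by (intro exI[of _ "?E"] exI[of _ k]) auto
      next
        case D: False
        have sM: "simple_edges M" using M(1) unfolding nonedge_matching_def simple_edges_def by simp
        have "card (\<Union>M) \<le> 2 * k" using card_Union_edges_le[OF sM] few by linarith
        then have "reduced_at t E k ?u ?v"
          unfolding reduced_at_def using D M(3) simple_edges_finite[OF sM] unfolding K_def by auto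
        moreover have "s' ''no'' = s ''no''" "s' ''changed'' = s ''changed''" unfolding s' if_not_P[OF D]
          by (simp_all add: eq1 eq2 eq3)
        ultimately show ?thesis using V3 s' D by (intro exI[of _ E] exI[of _ k]) auto
      qed
    qed
  qed
qed

text \<open>A change may make a pair examined earlier reducible again, so reducedness is claimed
  only as long as the pass has changed nothing.\<close>

definition pass_inv :: "nat \<Rightarrow> nat set set \<Rightarrow> nat \<Rightarrow> nat set set \<Rightarrow> nat \<Rightarrow> (nat \<Rightarrow> nat \<Rightarrow> bool) \<Rightarrow> state \<Rightarrow> bool" where
  "pass_inv t E0 k0 E k D s \<longleftrightarrow> (\<exists>E' k'. valid_state t E0 k0 s E' k' \<and>
     (\<not> solvable t E0 k0 \<or> s ''changed'' [] \<noteq> 0 \<and> card E' < card E \<or>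
      s ''changed'' [] = 0 \<and> E' = E \<and> k' = k \<and> (\<forall>u v. D u v \<longrightarrow> reduced_at t E k u v)))"

lemma pass_inv_cong:
  assumes "pass_inv t E0 k0 E k D s" "s' ''adj'' = s ''adj''" "s' ''k'' = s ''k''" "s' ''N'' = s ''N''"
    "s' ''no'' = s ''no''" "s' ''changed'' = s ''changed''" "\<And>u v. D' u v \<Longrightarrow> D u v"
  shows "pass_inv t E0 k0 E k D' s'"
proof -
  obtain E' k' where 1: "valid_state t E0 k0 s E' k'" "\<not> solvable t E0 k0 \<or> s ''changed'' [] \<noteq> 0 \<and> card E' < card E \<or>
      s ''changed'' [] = 0 \<and> E' = E \<and> k' = k \<and> (\<forall>u v. D u v \<longrightarrow> reduced_at t E k u v)"
    using assms(1) unfolding pass_inv_def by metis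
  have "valid_state t E0 k0 s' E' k'" by (rule valid_state_cong[OF 1(1) assms(2-5)])
  then show ?thesis unfolding pass_inv_def using 1(2) assms(5-7) by (intro exI[of _ E'] exI[of _ k']) auto
qed

lemma pass_inv_step:
  assumes I: "pass_inv t E0 k0 E k D s" and t: "t = 0 \<or> 4 \<le> t"
  shows "pass_inv t E0 k0 E k (\<lambda>u v. D u v \<or> u = s ''u'' [] \<and> v = s ''v'' []) (den (reduce_edge_prog t) s)"
proof -
  obtain E1 k1 where 1: "valid_state t E0 k0 s E1 k1" "\<not> solvable t E0 k0 \<or> s ''changed'' [] \<noteq> 0 \<and> card E1 < card E \<or>
      s ''changed'' [] = 0 \<and> E1 = E \<and> k1 = k \<and> (\<forall>u v. D u v \<longrightarrow> reduced_at t E k u v)"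
    using I unfolding pass_inv_def by metis
  let ?s = "den (reduce_edge_prog t) s"
  obtain E2 k2 where 2: "valid_state t E0 k0 ?s E2 k2" "card E2 \<le> card E1"
    "\<not> solvable t E0 k0 \<or> ?s ''changed'' [] \<noteq> 0 \<and> card E2 < card E1 \<or>
     ?s ''changed'' [] = s ''changed'' [] \<and> E2 = E1 \<and> k2 = k1 \<and> reduced_at t E1 k1 (s ''u'' []) (s ''v'' [])"
    using reduce_edge_correct[OF 1(1) t] by metis
  show ?thesis unfolding pass_inv_def
    using 1(2) 2 by (intro exI[of _ E2] exI[of _ k2]) auto
qed

definition pass_prog :: "nat \<Rightarrow> prog" where
  "pass_prog t = PSeq (PAsg ''changed'' [] (N 0)) (PFor ''u'' (PFor ''v'' (reduce_edge_prog t)))"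

lemma pass_prog_correct:
  assumes V: "valid_state t E0 k0 s E k" and t: "t = 0 \<or> 4 \<le> t"
  shows "pass_inv t E0 k0 E k (\<lambda>u v. True) (den (pass_prog t) s)"
proof -
  define s1 where "s1 = store s ''changed'' [] 0"
  define B where "B = s ''N'' []"
  have V1: "valid_state t E0 k0 s1 E k" unfolding s1_def by (rule valid_state_cong[OF V]) (simp_all add: store_other)
  have I0: "pass_inv t E0 k0 E k (\<lambda>u v. u < (0::nat)) s1"
    unfolding pass_inv_def using V1 by (intro exI[of _ E] exI[of _ k]) (simp add: s1_def store_apply)
  have I: "pass_inv t E0 k0 E k (\<lambda>u v. u < B \<and> v < B) (den (PFor ''u'' (PFor ''v'' (reduce_edge_prog t))) s1)"
  proof (rule for_invariant[where B = B and Inv = "\<lambda>i. pass_inv t E0 k0 E k (\<lambda>u v. u < i \<and> v < B)"], goal_cases)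
    case 1
    show ?case by (simp add: reduce_edge_mods)
  next
    case 2
    show ?case unfolding s1_def B_def by (simp add: store_apply)
  next
    case 3
    show ?case by (rule pass_inv_cong[OF I0]) (simp_all add: store_other)
  next
    case (4 i s2)
    have "pass_inv t E0 k0 E k (\<lambda>u v. u < i \<and> v < B \<or> u = i \<and> v < B) (den (PFor ''v'' (reduce_edge_prog t)) s2)"
    proof (rule for_invariant[where B = B and
        Inv = "\<lambda>j. pass_inv t E0 k0 E k (\<lambda>u v. u < i \<and> v < B \<or> u = i \<and> v < j)"], goal_cases)
      case 1
      show ?case by (simp add: reduce_edge_mods)
    next
      case 2
      show ?case using 4(3)[of "''N''"] unfolding s1_def B_def by (simp add: store_apply reduce_edge_mods)
    next
      case 3
      show ?case by (rule pass_inv_cong[OF 4(4)]) (simp_all add: store_other)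
    next
      case inner: (4 j s3)
      have "s3 ''u'' = s2 ''u''" by (rule inner(3)) (simp_all add: reduce_edge_mods)
      then have "s3 ''u'' [] = i" using 4(2) by simp
      then show ?case using pass_inv_step[OF inner(4) t] inner(2)
        by (intro pass_inv_cong[OF pass_inv_step[OF inner(4) t]]) (auto simp: store_other)
    qed
    then show ?case by (rule pass_inv_cong) (auto simp: store_other)
  qed
  have eq: "den (pass_prog t) s = den (PFor ''u'' (PFor ''v'' (reduce_edge_prog t))) s1"
    unfolding pass_prog_def s1_def by (simp only: den.simps aval.simps list.map)
  obtain E' k' where E': "valid_state t E0 k0 (den (pass_prog t) s) E' k'" and
    or: "\<not> solvable t E0 k0 \<or> den (pass_prog t) s ''changed'' [] \<noteq> 0 \<and> card E' < card E \<or>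
      den (pass_prog t) s ''changed'' [] = 0 \<and> E' = E \<and> k' = k \<and> (\<forall>u v. u < B \<and> v < B \<longrightarrow> reduced_at t E k u v)"
    using I unfolding pass_inv_def eq by metis
  have "reduced_at t E k u v" if "\<forall>u v. u < B \<and> v < B \<longrightarrow> reduced_at t E k u v" for u v
  proof (cases "{u, v} \<in> E")
    case True
    then show ?thesis using that V represents_lt[of s E k u v] unfolding B_def valid_state_def by simp
  qed (simp add: reduced_at_def)
  then show ?thesis unfolding pass_inv_def using E' or by (intro exI[of _ E'] exI[of _ k']) auto
qed

text \<open>Two nested loops provide as many passes as there are ordered pairs of vertices, which is
  at least the number of edges. Passes after a stable one are skipped.\<close>

definition main_prog :: "nat \<Rightarrow> prog" where
  "main_prog t = PSeq (PAsg ''changed'' [] (N 1))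
     (PFor ''p'' (PFor ''q'' (PIf (Pos (Var ''changed'')) (pass_prog t) PSkip)))"

text \<open>As long as the flag stays up, each of the \<open>j\<close> rounds has cost at least one
  edge.\<close>

definition main_inv :: "nat \<Rightarrow> nat set set \<Rightarrow> nat \<Rightarrow> nat \<Rightarrow> state \<Rightarrow> bool" where
  "main_inv t E0 k0 j s \<longleftrightarrow> (\<exists>E k. valid_state t E0 k0 s E k \<and>
     (\<not> solvable t E0 k0 \<or> s ''changed'' [] = 0 \<and> (\<forall>u v. reduced_at t E k u v) \<or>
      s ''changed'' [] \<noteq> 0 \<and> card E + j \<le> card E0))"

lemma main_inv_cong:
  assumes "main_inv t E0 k0 j s" "s' ''adj'' = s ''adj''" "s' ''k'' = s ''k''" "s' ''N'' = s ''N''"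
    "s' ''no'' = s ''no''" "s' ''changed'' = s ''changed''"
  shows "main_inv t E0 k0 j s'"
proof -
  obtain E k where 1: "valid_state t E0 k0 s E k" "\<not> solvable t E0 k0 \<or>
      s ''changed'' [] = 0 \<and> (\<forall>u v. reduced_at t E k u v) \<or> s ''changed'' [] \<noteq> 0 \<and> card E + j \<le> card E0"
    using assms(1) unfolding main_inv_def by metis
  have "valid_state t E0 k0 s' E k" by (rule valid_state_cong[OF 1(1) assms(2-5)])
  then show ?thesis unfolding main_inv_def using 1(2) assms(5,6) by (intro exI[of _ E] exI[of _ k]) simp
qed

lemma main_inv_step:
  assumes I: "main_inv t E0 k0 j s" and t: "t = 0 \<or> 4 \<le> t"
  shows "main_inv t E0 k0 (Suc j) (den (PIf (Pos (Var ''changed'')) (pass_prog t) PSkip) s)"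
proof -
  obtain E k where 1: "valid_state t E0 k0 s E k" "\<not> solvable t E0 k0 \<or>
      s ''changed'' [] = 0 \<and> (\<forall>u v. reduced_at t E k u v) \<or> s ''changed'' [] \<noteq> 0 \<and> card E + j \<le> card E0"
    using I unfolding main_inv_def by metis
  show ?thesis
  proof (cases "s ''changed'' [] = 0")
    case True
    then show ?thesis unfolding main_inv_def using 1 by (intro exI[of _ E] exI[of _ k]) simp
  next
    case False
    let ?s = "den (pass_prog t) s"
    obtain E' k' where 2: "valid_state t E0 k0 ?s E' k'" "\<not> solvable t E0 k0 \<or> ?s ''changed'' [] \<noteq> 0 \<and> card E' < card E \<or>
      ?s ''changed'' [] = 0 \<and> E' = E \<and> k' = k \<and> (\<forall>u v. reduced_at t E k u v)"
      using pass_prog_correct[OF 1(1) t] unfolding pass_inv_def by metis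
    have "den (PIf (Pos (Var ''changed'')) (pass_prog t) PSkip) s = ?s" using False by simp
    then show ?thesis unfolding main_inv_def using 1(2) 2 False by (intro exI[of _ E'] exI[of _ k']) auto
  qed
qed

lemma card_edges_le: "represents s E k \<Longrightarrow> card E \<le> s ''N'' [] * s ''N'' []"
proof -
  assume R: "represents s E k"
  let ?B = "{..<s ''N'' []}"
  have "E \<subseteq> (\<lambda>(x, y). {x, y}) ` (?B \<times> ?B)"
  proof
    fix e assume e: "e \<in> E"
    then obtain x y where "e = {x, y}" using R unfolding represents_def simple_edges_def by (metis card_2_iff)
    then show "e \<in> (\<lambda>(x, y). {x, y}) ` (?B \<times> ?B)" using represents_lt[OF R, of x y] e by auto
  qed
  then have "card E \<le> card (?B \<times> ?B)" by (rule surj_card_le[rotated]) simp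
  then show ?thesis by simp
qed

lemma main_prog_mods:
  "mods (pass_prog t) = {''u'', ''v'', ''a'', ''b'', ''used'', ''cnt'', ''adj'', ''k'', ''changed'', ''no'',
    ''hull'', ''z'', ''simplicial'', ''clique'', ''cK'', ''cS'', ''w''}"
  "mods (main_prog t) = {''p'', ''q'', ''u'', ''v'', ''a'', ''b'', ''used'', ''cnt'', ''adj'', ''k'', ''changed'', ''no'',
    ''hull'', ''z'', ''simplicial'', ''clique'', ''cK'', ''cS'', ''w''}"
  unfolding pass_prog_def main_prog_def by (auto simp: reduce_edge_mods)

lemma main_prog_correct:
  assumes R: "represents s E0 k0" and no: "s ''no'' [] = 0" and t: "t = 0 \<or> 4 \<le> t"
  shows "\<exists>E k. valid_state t E0 k0 (den (main_prog t) s) E k \<and>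
    (\<not> solvable t E0 k0 \<or> (\<forall>u v. reduced_at t E k u v))"
proof -
  define s1 where "s1 = store s ''changed'' [] 1"
  define B where "B = s ''N'' []"
  let ?q = "PFor ''q'' (PIf (Pos (Var ''changed'')) (pass_prog t) PSkip)"
  have "represents s1 E0 k0" unfolding s1_def by (rule represents_cong[OF R]) (simp_all add: store_other)
  then have I0: "main_inv t E0 k0 0 s1"
    unfolding main_inv_def valid_state_def using no
    by (intro exI[of _ E0] exI[of _ k0]) (simp add: s1_def store_apply)
  have I: "main_inv t E0 k0 (B * B) (den (PFor ''p'' ?q) s1)"
  proof (rule for_invariant[where B = B and Inv = "\<lambda>i. main_inv t E0 k0 (i * B)"], goal_cases)
    case 1
    show ?case by (simp add: main_prog_mods)
  next
    case 2
    show ?case unfolding s1_def B_def by (simp add: store_apply)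
  next
    case 3
    show ?case using main_inv_cong[OF I0, of "store s1 ''p'' [] 0"] by (simp add: store_other)
  next
    case (4 i s2)
    have "main_inv t E0 k0 (i * B + B) (den ?q s2)"
    proof (rule for_invariant[where B = B and Inv = "\<lambda>j. main_inv t E0 k0 (i * B + j)"], goal_cases)
      case 1
      show ?case by (simp add: main_prog_mods)
    next
      case 2
      show ?case using 4(3)[of "''N''"] unfolding s1_def B_def by (simp add: store_apply main_prog_mods)
    next
      case 3
      show ?case using main_inv_cong[OF 4(4), of "store s2 ''q'' [] 0"] by (simp add: store_other)
    next
      case inner: (4 j s3)
      show ?case
        using main_inv_cong[OF main_inv_step[OF inner(4) t],
            of "store (den (PIf (Pos (Var ''changed'')) (pass_prog t) PSkip) s3) ''q'' [] (Suc j)"]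
        by (simp add: store_other)
    qed
    then have "main_inv t E0 k0 (i * B + B) (store (den ?q s2) ''p'' [] (Suc i))"
      by (rule main_inv_cong) (simp_all add: store_other)
    then show ?case by (simp add: add.commute)
  qed
  have "den (main_prog t) s = den (PFor ''p'' ?q) s1"
    unfolding main_prog_def s1_def by (simp only: den.simps aval.simps list.map)
  then obtain E k where E: "valid_state t E0 k0 (den (main_prog t) s) E k" and
    or: "\<not> solvable t E0 k0 \<or> (\<forall>u v. reduced_at t E k u v) \<or> card E + B * B \<le> card E0"
    using I unfolding main_inv_def by metis
  have "finite E" using E unfolding valid_state_def represents_def simple_edges_def by simp
  \<comment> \<open>If every pass changed something, all edges are gone, and an edgeless instance is
    reduced.\<close>
  have "reduced_at t E k u v" if "card E + B * B \<le> card E0" for u v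
  proof -
    have "card E = 0" using that card_edges_le[OF R] unfolding B_def by linarith
    then have "E = {}" using \<open>finite E\<close> by simp
    then show ?thesis unfolding reduced_at_def by simp
  qed
  then show ?thesis using E or by metis
qed

section \<open>Renaming vertices\<close>

lemma obstruction_free_iff: "obstruction_free t E \<longleftrightarrow> (\<nexists>Q. obstruction t E Q)"
  unfolding obstruction_free_def obstruction_def by metis

text \<open>The condition on \<open>t\<close> ensures that every vertex of an obstruction lies on an
  edge, which is where \<open>f\<close> is known to be injective.\<close>

lemma obstruction_image:
  assumes Q: "obstruction t E Q" and t: "t = 0 \<or> 4 \<le> t" and inj: "inj_on f (\<Union>E)"
  shows "obstruction t ((`) f ` E) (f ` Q)"
proof -
  have QE: "Q \<subseteq> \<Union>E" by (rule obstruction_subset[OF Q t])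
  have mem: "{f x, f y} \<in> (`) f ` E \<longleftrightarrow> {x, y} \<in> E" if "x \<in> \<Union>E" "y \<in> \<Union>E" for x y
  proof
    assume "{f x, f y} \<in> (`) f ` E"
    then obtain e where e: "e \<in> E" "f ` {x, y} = f ` e" by auto
    have "{x, y} \<subseteq> \<Union>E" "e \<subseteq> \<Union>E" using that e(1) by auto
    then have "{x, y} = e" using inj_on_image_eq_iff[OF inj, of "{x, y}" e] e(2) by simp
    then show "{x, y} \<in> E" using e(1) by simp
  next
    assume "{x, y} \<in> E"
    then have "f ` {x, y} \<in> (`) f ` E" by (rule imageI)
    then show "{f x, f y} \<in> (`) f ` E" by simp
  qed
  show ?thesis
    using Q unfolding obstruction_def
  proof
    assume "\<exists>a b c d. diamond_at E a b c d \<and> Q = {a, b, c, d}"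
    then obtain a b c d where D: "diamond_at E a b c d" "Q = {a, b, c, d}" by metis
    have V: "a \<in> \<Union>E" "b \<in> \<Union>E" "c \<in> \<Union>E" "d \<in> \<Union>E" using QE D(2) by simp_all
    have "f a \<noteq> f b" using D(1) V inj_onD[OF inj, of a b] unfolding diamond_at_def by metis
    then have "diamond_at ((`) f ` E) (f a) (f b) (f c) (f d)"
      using D(1) unfolding diamond_at_def mem[OF V(1,2)] mem[OF V(1,3)] mem[OF V(1,4)] mem[OF V(2,3)]
        mem[OF V(2,4)] mem[OF V(3,4)] by simp
    moreover have "f ` Q = {f a, f b, f c, f d}" using D(2) by simp
    ultimately show "(\<exists>a b c d. diamond_at ((`) f ` E) a b c d \<and> f ` Q = {a, b, c, d}) \<or>
      t \<noteq> 0 \<and> card (f ` Q) = t \<and> is_clique ((`) f ` E) (f ` Q)" by metis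
  next
    assume K: "t \<noteq> 0 \<and> card Q = t \<and> is_clique E Q"
    have "card (f ` Q) = card Q" using inj QE by (meson card_image inj_on_subset)
    moreover have "is_clique ((`) f ` E) (f ` Q)"
      unfolding is_clique_def
    proof (intro ballI impI)
      fix a b assume "a \<in> f ` Q" "b \<in> f ` Q" "a \<noteq> b"
      then obtain x y where "a = f x" "b = f y" "x \<in> Q" "y \<in> Q" "x \<noteq> y" by auto
      then show "{a, b} \<in> (`) f ` E" using mem[of x y] is_cliqueD[of E Q x y] K QE by auto
    qed
    ultimately show "(\<exists>a b c d. diamond_at ((`) f ` E) a b c d \<and> f ` Q = {a, b, c, d}) \<or>
      t \<noteq> 0 \<and> card (f ` Q) = t \<and> is_clique ((`) f ` E) (f ` Q)" using K by simp
  qed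
qed

lemma inj_on_image_edges: "inj_on f (\<Union>E) \<Longrightarrow> inj_on ((`) f) E"
  by (meson inj_on_image)

lemma solvable_imageD:
  assumes inj: "inj_on f (\<Union>E)" and t: "t = 0 \<or> 4 \<le> t" and sol: "solvable t ((`) f ` E) k"
  shows "solvable t E k"
proof -
  obtain F where F: "F \<subseteq> (`) f ` E" "card F \<le> k" "obstruction_free t ((`) f ` E - F)"
    using sol unfolding solvable_def by metis
  obtain F' where F': "F' \<subseteq> E" "F = (`) f ` F'" using F(1) by (meson subset_imageE)
  have injE: "inj_on ((`) f) E" by (rule inj_on_image_edges[OF inj])
  have "card F' = card F" unfolding F'(2) using injE F'(1) by (metis card_image inj_on_subset)
  moreover have "(`) f ` E - F = (`) f ` (E - F')"
    unfolding F'(2) using inj_on_image_set_diff[OF injE, of E F'] F'(1) by auto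
  moreover have "inj_on f (\<Union>(E - F'))" by (rule inj_on_subset[OF inj]) auto
  ultimately have "obstruction_free t (E - F')"
    using F(3) obstruction_image[OF _ t, of "E - F'" _ f] unfolding obstruction_free_iff by metis
  then show ?thesis unfolding solvable_def using F' F(2) \<open>card F' = card F\<close> by auto
qed

lemma solvable_image:
  assumes inj: "inj_on f (\<Union>E)" and t: "t = 0 \<or> 4 \<le> t"
  shows "solvable t ((`) f ` E) k \<longleftrightarrow> solvable t E k"
proof
  \<comment> \<open>The converse is the same implication applied to the inverse renaming.\<close>
  let ?g = "inv_into (\<Union>E) f"
  assume "solvable t E k"
  moreover have "(`) ?g ` ((`) f ` E) = E"
  proof -
    have "?g ` (f ` e) = e" if "e \<in> E" for e
      using inv_into_image_cancel[OF inj, of e] that by auto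
    then show ?thesis by (simp add: image_image)
  qed
  moreover have "inj_on ?g (\<Union>((`) f ` E))"
    by (rule inj_on_subset[OF inj_on_inv_into[OF subset_refl]]) auto
  ultimately show "solvable t ((`) f ` E) k"
    using solvable_imageD[OF _ t, of ?g "(`) f ` E" k] by simp
qed (rule solvable_imageD[OF inj t])

section \<open>Removing isolated vertices\<close>

definition index_prog :: prog where
  "index_prog = PSeq (PAsg ''m'' [] (N 0)) (PFor ''a'' (PSeq (PAsg ''deg'' [] (N 0))
     (PSeq (PFor ''b'' (PIf (Pos (Adj ''a'' ''b'')) (PAsg ''deg'' [] (N 1)) PSkip))
       (PIf (Pos (Var ''deg'')) (PSeq (PAsg ''idx'' [Var ''m''] (Var ''a''))
         (PAsg ''m'' [] (Plus (Var ''m'') (N 1)))) PSkip))))"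

text \<open>The renamed matrix is built in a separate array, since writing into
  \<open>''adj''\<close> directly could overwrite entries still to be read.\<close>

definition copy_prog :: prog where
  "copy_prog = PSeq
     (PFor ''a'' (PFor ''b'' (PAsg ''new'' [Var ''a'', Var ''b''] (Cell ''adj'' [Arr ''idx'' ''a'', Arr ''idx'' ''b'']))))
     (PSeq (PFor ''a'' (PFor ''b'' (PAsg ''adj'' [Var ''a'', Var ''b''] (Cell ''new'' [Var ''a'', Var ''b'']))))
       (PAsg ''n'' [] (Var ''m'')))"

lemma compress_mods [simp]:
  "mods index_prog = {''m'', ''a'', ''b'', ''deg'', ''idx''}"
  "mods copy_prog = {''a'', ''b'', ''new'', ''adj'', ''n''}"
  by (auto simp: index_prog_def copy_prog_def)

lemma edge_otherE:
  assumes "simple_edges E" "e \<in> E" "a \<in> e"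
  obtains b where "e = {a, b}"
proof -
  obtain x y where "e = {x, y}" using assms(1,2) unfolding simple_edges_def by (meson card_2_iff)
  then show ?thesis using that[of x] that[of y] assms(3) by auto
qed

lemma degree_loop:
  assumes R: "represents s E k"
  shows "den (PFor ''b'' (PIf (Pos (Adj ''a'' ''b'')) (PAsg ''deg'' [] (N 1)) PSkip)) s ''deg'' [] \<noteq> 0 \<longleftrightarrow>
    s ''deg'' [] \<noteq> 0 \<or> s ''a'' [] \<in> \<Union>E"
proof -
  let ?a = "s ''a'' []"
  have "den (PFor ''b'' (PIf (Pos (Adj ''a'' ''b'')) (PAsg ''deg'' [] (N 1)) PSkip)) s ''deg'' [] \<noteq> 0 \<longleftrightarrow>
    s ''deg'' [] \<noteq> 0 \<or> (\<exists>b<s ''N'' []. {?a, b} \<in> E)"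
  proof (rule for_invariant[where B = "s ''N'' []" and Inv = "\<lambda>i s'. s' ''deg'' [] \<noteq> 0 \<longleftrightarrow>
      s ''deg'' [] \<noteq> 0 \<or> (\<exists>b<i. {?a, b} \<in> E)"], goal_cases)
    case (4 i s')
    have eq: "s' ''a'' = s ''a''" "s' ''adj'' = s ''adj''" using 4(3) by simp_all
    show ?case using 4(2,4) by (auto simp: store_apply eq represents_adj[OF R] less_Suc_eq)
  qed (simp_all add: store_apply)
  moreover have "(\<exists>b<s ''N'' []. {?a, b} \<in> E) \<longleftrightarrow> ?a \<in> \<Union>E"
  proof
    assume "?a \<in> \<Union>E"
    then obtain e where e: "e \<in> E" "?a \<in> e" by auto
    then obtain b where "e = {?a, b}" using R unfolding represents_def by (meson edge_otherE)
    then show "\<exists>b<s ''N'' []. {?a, b} \<in> E" using e represents_lt[OF R, of ?a b] by auto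
  qed auto
  ultimately show ?thesis by simp
qed

lemma index_prog_correct:
  assumes R: "represents s E k"
  defines "s' \<equiv> den index_prog s"
  shows "s' ''m'' [] = card (\<Union>E) \<and> bij_betw (\<lambda>j. s' ''idx'' [j]) {..<s' ''m'' []} (\<Union>E)"
proof -
  define s1 where "s1 = store s ''m'' [] 0"
  let ?deg = "PFor ''b'' (PIf (Pos (Adj ''a'' ''b'')) (PAsg ''deg'' [] (N 1)) PSkip)"
  let ?upd = "PIf (Pos (Var ''deg'')) (PSeq (PAsg ''idx'' [Var ''m''] (Var ''a''))
         (PAsg ''m'' [] (Plus (Var ''m'') (N 1)))) PSkip"
  let ?body = "PSeq (PAsg ''deg'' [] (N 0)) (PSeq ?deg ?upd)"
  let ?Inv = "\<lambda>i s'. inj_on (\<lambda>j. s' ''idx'' [j]) {..<s' ''m'' []} \<and>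
    (\<lambda>j. s' ''idx'' [j]) ` {..<s' ''m'' []} = {a \<in> \<Union>E. a < i}"
  have I: "?Inv (s ''N'' []) (den (PFor ''a'' ?body) s1)"
  proof (rule for_invariant[where B = "s ''N'' []" and Inv = ?Inv], goal_cases)
    case (4 i s2)
    have eq: "s2 ''N'' = s ''N''" "s2 ''adj'' = s ''adj''" "s2 ''k'' = s ''k''"
      using 4(3) by (simp_all add: s1_def store_other)
    define s3 where "s3 = store s2 ''deg'' [] 0"
    define s4 where "s4 = den ?deg s3"
    have R3: "represents s3 E k" by (rule represents_cong[OF R]) (simp_all add: s3_def store_other eq)
    have eq4: "s4 y = s2 y" if "y \<notin> {''b'', ''deg''}" for y
      unfolding s4_def using that den_frame[of y ?deg s3] by (simp add: s3_def store_other)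
    have deg: "s4 ''deg'' [] \<noteq> 0 \<longleftrightarrow> i \<in> \<Union>E"
      unfolding s4_def using degree_loop[OF R3] 4(2) by (simp add: s3_def store_apply)
    have d: "den ?body s2 = (if i \<in> \<Union>E then
        store (store s4 ''idx'' [s2 ''m'' []] i) ''m'' [] (s2 ''m'' [] + 1) else s4)"
    proof -
      have "den ?body s2 = den ?upd s4"
        unfolding s4_def s3_def by (simp only: den.simps aval.simps list.map)
      then show ?thesis using deg 4(2) by (auto simp: eq4 store_apply)
    qed
    show ?case
    proof (cases "i \<in> \<Union>E")
      case False
      have "{a \<in> \<Union>E. a < Suc i} = {a \<in> \<Union>E. a < i}" using False by (auto simp: less_Suc_eq)
      then show ?thesis unfolding d if_not_P[OF False] using 4(4) by (simp add: store_apply eq4)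
    next
      case True
      have "{a \<in> \<Union>E. a < Suc i} = insert i {a \<in> \<Union>E. a < i}" using True by (auto simp: less_Suc_eq)
      moreover have "i \<notin> (\<lambda>j. s2 ''idx'' [j]) ` {..<s2 ''m'' []}" using 4(4) by auto
      ultimately show ?thesis unfolding d if_P[OF True] using 4(4)
        by (auto simp: store_apply eq4 lessThan_Suc inj_on_def)
    qed
  qed (simp_all add: store_apply s1_def)
  have s': "s' = den (PFor ''a'' ?body) s1"
    unfolding s'_def index_prog_def s1_def by (simp only: den.simps aval.simps list.map)
  have "{a \<in> \<Union>E. a < s ''N'' []} = \<Union>E" using R unfolding represents_def by auto
  then have b: "bij_betw (\<lambda>j. s' ''idx'' [j]) {..<s' ''m'' []} (\<Union>E)"
    using I unfolding s'[symmetric] bij_betw_def by simp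
  then show ?thesis using bij_betw_same_card[OF b] by simp
qed

text \<open>By \<open>frame\<close> the value of \<open>e\<close> depends only on the two counters
  and on cells left alone by the loops, so each entry can be evaluated as in the initial
  state.\<close>

lemma double_loop_store:
  assumes xy: "x \<noteq> y" "z \<noteq> x" "z \<noteq> y" "x \<noteq> ''N''" "y \<noteq> ''N''" "z \<noteq> ''N''"
    and frame: "\<And>s' i j. (\<And>w. w \<notin> {x, y, z} \<Longrightarrow> s' w = s w) \<Longrightarrow> s' x [] = i \<Longrightarrow> s' y [] = j \<Longrightarrow> aval e s' = f i j"
  shows "\<forall>i<s ''N'' []. \<forall>j<s ''N'' []. den (PFor x (PFor y (PAsg z [Var x, Var y] e))) s z [i, j] = f i j"
proof (rule for_invariant[where B = "s ''N'' []" and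
    Inv = "\<lambda>i s'. \<forall>i'<i. \<forall>j<s ''N'' []. s' z [i', j] = f i' j"], goal_cases)
  case (4 i s2)
  let ?p = "PFor y (PAsg z [Var x, Var y] e)"
  have N2: "s2 ''N'' [] = s ''N'' []" using 4(3)[of "''N''"] xy by simp
  have "(\<forall>i'<i. \<forall>j<s ''N'' []. den ?p s2 z [i', j] = f i' j) \<and> (\<forall>j<s ''N'' []. den ?p s2 z [i, j] = f i j)"
  proof (rule for_invariant[where B = "s ''N'' []" and
      Inv = "\<lambda>j s'. (\<forall>i'<i. \<forall>j<s ''N'' []. s' z [i', j] = f i' j) \<and> (\<forall>j'<j. s' z [i, j'] = f i j')"], goal_cases)
    case inner: (4 j s3)
    have x3: "s3 x [] = i" using inner(3)[of x] 4(2) xy by simp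
    have "aval e s3 = f i j" using inner(2,3) 4(3) x3 by (intro frame) auto
    then show ?case using inner(2,4) x3 xy by (auto simp: store_apply less_Suc_eq)
  qed (use 4(4) xy N2 in \<open>auto simp: store_apply\<close>)
  then show ?case using xy by (auto simp: store_apply less_Suc_eq)
qed (use xy in auto)

lemma copy_prog_correct:
  defines "B s \<equiv> s ''N'' []"
  shows "\<forall>i<B s. \<forall>j<B s. den copy_prog s ''adj'' [i, j] = s ''adj'' [s ''idx'' [i], s ''idx'' [j]]"
    and "den copy_prog s ''n'' [] = s ''m'' []"
proof -
  define s1 where "s1 = den (PFor ''a'' (PFor ''b'' (PAsg ''new'' [Var ''a'', Var ''b'']
    (Cell ''adj'' [Arr ''idx'' ''a'', Arr ''idx'' ''b''])))) s"
  define s2 where "s2 = den (PFor ''a'' (PFor ''b'' (PAsg ''adj'' [Var ''a'', Var ''b'']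
    (Cell ''new'' [Var ''a'', Var ''b''])))) s1"
  have d: "den copy_prog s = store s2 ''n'' [] (s2 ''m'' [])"
    unfolding copy_prog_def s1_def s2_def by (simp only: den.simps aval.simps list.map aval_bval_derived)
  have eq1: "s1 y = s y" if "y \<notin> {''a'', ''b'', ''new''}" for y
    unfolding s1_def using that by (intro den_frame) simp
  have eq2: "s2 y = s1 y" if "y \<notin> {''a'', ''b'', ''adj''}" for y
    unfolding s2_def using that by (intro den_frame) simp
  have "\<forall>i<B s. \<forall>j<B s. s1 ''new'' [i, j] = s ''adj'' [s ''idx'' [i], s ''idx'' [j]]"
    unfolding s1_def B_def by (rule double_loop_store) simp_all
  moreover have "\<forall>i<s1 ''N'' []. \<forall>j<s1 ''N'' []. s2 ''adj'' [i, j] = s1 ''new'' [i, j]"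
    unfolding s2_def by (rule double_loop_store) simp_all
  ultimately show "\<forall>i<B s. \<forall>j<B s. den copy_prog s ''adj'' [i, j] = s ''adj'' [s ''idx'' [i], s ''idx'' [j]]"
    unfolding d B_def by (simp add: store_apply eq1)
  show "den copy_prog s ''n'' [] = s ''m'' []" unfolding d by (simp add: store_apply eq1 eq2)
qed

section \<open>Evaluating the size bound\<close>

text \<open>The machine cannot multiply, so c times the d-th power of k is obtained by adding
  \<open>c\<close> in \<open>d\<close> nested loops. Each runs to \<open>''N''\<close> but acts only
  while its counter is below \<open>''k''\<close>. The counters are named i, ii, iii to keep them
  distinct.\<close>

fun power_prog :: "nat \<Rightarrow> nat \<Rightarrow> prog" where
  "power_prog 0 c = PAsg ''bound'' [] (Plus (Var ''bound'') (N c))"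
| "power_prog (Suc d) c = PFor (replicate (Suc d) CHR ''i'')
     (PIf (Less (Var (replicate (Suc d) CHR ''i'')) (Var ''k'')) (power_prog d c) PSkip)"

lemma power_mods: "mods (power_prog d c) = insert ''bound'' ((\<lambda>e. replicate (Suc e) CHR ''i'') ` {..<d})"
  by (induction d) (auto simp: lessThan_Suc)

lemma power_wf: "wf_prog (power_prog d c)"
  by (induction d) (auto simp: power_mods replicate_eq_replicate)

lemma power_prog_correct: "s ''k'' [] \<le> s ''N'' [] \<Longrightarrow>
    den (power_prog d c) s ''bound'' [] = s ''bound'' [] + c * s ''k'' [] ^ d"
proof (induction d arbitrary: s)
  case 0
  show ?case by (simp add: store_apply)
next
  case (Suc d)
  let ?x = "replicate (Suc d) CHR ''i''"
  let ?k = "s ''k'' []"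
  have x: "?x \<notin> mods (PIf (Less (Var ?x) (Var ''k'')) (power_prog d c) PSkip)"
    by (auto simp: power_mods replicate_eq_replicate)
  have "den (PFor ?x (PIf (Less (Var ?x) (Var ''k'')) (power_prog d c) PSkip)) s ''bound'' [] =
      s ''bound'' [] + min (s ''N'' []) ?k * (c * ?k ^ d)"
  proof (rule for_invariant[where B = "s ''N'' []" and Inv = "\<lambda>i s'. s' ''bound'' [] = s ''bound'' [] + min i ?k * (c * ?k ^ d)"],
      goal_cases)
    case 1
    show ?case by (rule x)
  next
    case (4 i s')
    have eq: "s' ''k'' = s ''k''" "s' ''N'' = s ''N''" by (rule 4(3); auto simp: power_mods)+
    show ?case
    proof (cases "i < ?k")
      case True
      have "den (power_prog d c) s' ''bound'' [] = s' ''bound'' [] + c * ?k ^ d"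
        using Suc.IH[of s'] Suc.prems by (simp add: eq)
      then show ?thesis using True 4(2,4) by (simp add: store_apply eq)
    next
      case False
      then show ?thesis using 4(2,4) by (simp add: store_apply eq)
    qed
  qed (simp_all add: store_apply)
  then show ?case using Suc.prems by (simp add: min_absorb2 algebra_simps)
qed

section \<open>Graphs and edge sets\<close>

lemma doubleton_in_nsets: "{x, y} \<in> nsets A 2 \<longleftrightarrow> x \<in> A \<and> y \<in> A \<and> x \<noteq> y"
  unfolding nsets_def by (auto simp: card_insert_if)

lemma simple_graph_edges:
  assumes "simple_graph G"
  shows "simple_edges (edges G)" "\<Union>(edges G) \<subseteq> verts G"
proof -
  have *: "finite (verts G)" "edges G \<subseteq> nsets (verts G) 2" using assms unfolding simple_graph_def by auto
  then have "finite (edges G)" using finite_imp_finite_nsets finite_subset by metis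
  then show "simple_edges (edges G)" "\<Union>(edges G) \<subseteq> verts G"
    using * unfolding simple_edges_def nsets_def by auto
qed

lemma simple_graph_delete_edges: "simple_graph G \<Longrightarrow> simple_graph (delete_edges G F)"
  unfolding simple_graph_def delete_edges_def by auto

lemma edges_delete_edges: "edges (delete_edges G F) = edges G - F"
  unfolding delete_edges_def by simp

lemma lessThan_4: "{..<4::nat} = {0, 1, 2, 3}"
  by auto

lemma edge_diamond: "{x, y} \<in> edges diamond \<longleftrightarrow> x < 4 \<and> y < 4 \<and> x \<noteq> y \<and> {x, y} \<noteq> {0, 1}"
  unfolding diamond_def edges_delete_edges complete_graph_def by (simp add: doubleton_in_nsets)

lemma diamond_free_iff:
  assumes G: "simple_graph G"
  shows "diamond_free G \<longleftrightarrow> (\<nexists>a b c d. diamond_at (edges G) a b c d)"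
proof -
  let ?E = "edges G"
  note sE = simple_graph_edges[OF G]
  have V: "verts diamond = {..<4}" unfolding diamond_def delete_edges_def complete_graph_def by simp
  have "\<exists>a b c d. diamond_at ?E a b c d" if W: "W \<subseteq> verts G" and iso: "graph_iso (induced_subgraph G W) diamond" for W
  proof -
    obtain h where h: "bij_betw h W {..<4}"
      "\<And>u v. u \<in> W \<Longrightarrow> v \<in> W \<Longrightarrow> {u, v} \<in> ?E \<longleftrightarrow> {h u, h v} \<in> edges diamond"
      using iso unfolding graph_iso_def induced_subgraph_def V by auto
    define g where "g = inv_into W h"
    have g: "g i \<in> W" "h (g i) = i" if "i < 4" for i
      using that h(1) unfolding g_def bij_betw_def
      by (metis inv_into_into lessThan_iff, metis f_inv_into_f lessThan_iff)
    have e: "{g i, g j} \<in> ?E \<longleftrightarrow> i \<noteq> j \<and> {i, j} \<noteq> {0, 1}" if "i < 4" "j < 4" for i j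
      using h(2)[of "g i" "g j"] g that by (simp add: edge_diamond)
    have "g 0 \<noteq> g 1" using g(2)[of 0] g(2)[of 1] by auto
    then have "diamond_at ?E (g 0) (g 1) (g 2) (g 3)"
      unfolding diamond_at_def by (simp add: e doubleton_eq_iff)
    then show ?thesis by metis
  qed
  moreover have "\<exists>W\<subseteq>verts G. graph_iso (induced_subgraph G W) diamond" if D: "diamond_at ?E a b c d" for a b c d
  proof -
    \<comment> \<open>The edge missing from \<open>diamond\<close> is \<open>{0, 1}\<close>, so the
      two nonadjacent vertices go to 0 and 1; the last case is \<open>d\<close>.\<close>
    define h :: "'a \<Rightarrow> nat" where "h x = (if x = a then 0 else if x = b then 1 else if x = c then 2 else 3)" for x
    have e: "{a, c} \<in> ?E" "{a, d} \<in> ?E" "{b, c} \<in> ?E" "{b, d} \<in> ?E" "{c, d} \<in> ?E" "{a, b} \<notin> ?E" "a \<noteq> b"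
      using D unfolding diamond_at_def by simp_all
    have ne: "a \<noteq> c" "a \<noteq> d" "b \<noteq> c" "b \<noteq> d" "c \<noteq> d" using e edge_neq[OF sE(1)] by metis+
    have irr: "{x} \<notin> ?E" for x using edge_neq[OF sE(1), of x x] by auto
    have hv: "h a = 0" "h b = 1" "h c = 2" "h d = 3" unfolding h_def using e ne by simp_all
    have bij: "bij_betw h {a, b, c, d} {..<4}"
      unfolding bij_betw_def lessThan_4 using e(7) ne by (auto simp: hv inj_on_def)
    have "{u, v} \<in> ?E \<longleftrightarrow> {h u, h v} \<in> edges diamond" if "u \<in> {a, b, c, d}" "v \<in> {a, b, c, d}" for u v
      using that e by (auto simp: hv edge_diamond doubleton_eq_iff irr insert_commute)
    then have "graph_iso (induced_subgraph G {a, b, c, d}) diamond"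
      using bij unfolding graph_iso_def induced_subgraph_def V by (intro exI[of _ h]) auto
    moreover have "{a, c} \<subseteq> verts G" "{b, d} \<subseteq> verts G" using e sE(2) by auto
    ultimately show ?thesis by (intro exI[of _ "{a, b, c, d}"]) auto
  qed
  ultimately show ?thesis unfolding diamond_free_def by metis
qed

lemma complete_free_iff:
  assumes G: "simple_graph G" and t: "4 \<le> t"
  shows "complete_free t G \<longleftrightarrow> (\<nexists>S. card S = t \<and> is_clique (edges G) S)"
proof -
  let ?E = "edges G"
  have "\<exists>S. card S = t \<and> is_clique ?E S" if H: "subgraph H G" "graph_iso H (complete_graph t)" for H
  proof -
    obtain h where h: "bij_betw h (verts H) {..<t}"
      "\<And>u v. u \<in> verts H \<Longrightarrow> v \<in> verts H \<Longrightarrow> {u, v} \<in> edges H \<longleftrightarrow> {h u, h v} \<in> nsets {..<t} 2"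
      using H(2) unfolding graph_iso_def complete_graph_def by auto
    have "card (verts H) = t" using bij_betw_same_card[OF h(1)] by simp
    moreover have "is_clique ?E (verts H)"
      unfolding is_clique_def
    proof (intro ballI impI)
      fix a b assume ab: "a \<in> verts H" "b \<in> verts H" "a \<noteq> b"
      then have "h a \<in> {..<t}" "h b \<in> {..<t}" "h a \<noteq> h b" using h(1) unfolding bij_betw_def inj_on_def by auto
      then have "{a, b} \<in> edges H" using h(2)[OF ab(1,2)] by (simp add: doubleton_in_nsets)
      then show "{a, b} \<in> ?E" using H(1) unfolding subgraph_def by auto
    qed
    ultimately show ?thesis by metis
  qed
  moreover have "\<exists>H. subgraph H G \<and> graph_iso H (complete_graph t)" if S: "card S = t" "is_clique ?E S" for S
  proof -
    have fS: "finite S" using S(1) t by (metis card.infinite not_numeral_le_zero)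
    \<comment> \<open>Each vertex of a clique of size at least 4 lies on an edge and hence belongs
      to the graph.\<close>
    have "obstruction t ?E S" unfolding obstruction_def using S t by auto
    then have SV: "S \<subseteq> verts G" using obstruction_subset[of t ?E S] t simple_graph_edges(2)[OF G] by auto
    obtain h where h: "bij_betw h S {..<t}"
      using fS S(1) by (metis bij_betw_iff_card card_lessThan finite_lessThan)
    let ?H = "Graph S (nsets S 2)"
    have "nsets S 2 \<subseteq> ?E"
    proof
      fix e assume "e \<in> nsets S 2"
      then obtain x y where "e = {x, y}" "x \<noteq> y" "x \<in> S" "y \<in> S" unfolding nsets_def by (auto simp: card_2_iff)
      then show "e \<in> ?E" using is_cliqueD[OF S(2)] by simp
    qed
    then have "subgraph ?H G" unfolding subgraph_def simple_graph_def using fS SV by simp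
    moreover have "{u, v} \<in> nsets S 2 \<longleftrightarrow> {h u, h v} \<in> nsets {..<t} 2" if "u \<in> S" "v \<in> S" for u v
      using that h unfolding bij_betw_def inj_on_def doubleton_in_nsets by auto
    then have "graph_iso ?H (complete_graph t)"
      unfolding graph_iso_def complete_graph_def using h by (intro exI[of _ h]) simp
    ultimately show ?thesis by metis
  qed
  ultimately show ?thesis unfolding complete_free_def by metis
qed

lemma diamond_free_edge_deletion_iff:
  "simple_graph G \<Longrightarrow> diamond_free_edge_deletion G k \<longleftrightarrow> solvable 0 (edges G) k"
  unfolding diamond_free_edge_deletion_def solvable_def obstruction_free_def
  by (simp add: diamond_free_iff simple_graph_delete_edges edges_delete_edges)

lemma diamond_complete_free_edge_deletion_iff:
  "simple_graph G \<Longrightarrow> 4 \<le> t \<Longrightarrow> diamond_complete_free_edge_deletion t G k \<longleftrightarrow> solvable t (edges G) k"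
  unfolding diamond_complete_free_edge_deletion_def solvable_def obstruction_free_def
  by (simp add: diamond_free_iff complete_free_iff simple_graph_delete_edges edges_delete_edges)

section \<open>The kernelization\<close>

text \<open>The final test compares the number of non-isolated vertices with the bound for the
  current parameter, so an oversized output is turned into the answer no.\<close>

definition kernel_prog :: "nat \<Rightarrow> prog" where
  "kernel_prog t = PSeq (main_prog t) (PSeq index_prog (PSeq copy_prog (PSeq (PAsg ''bound'' [] (N 0))
     (PSeq (if t = 0 then power_prog 3 388 else power_prog 2 (5 * t ^ 3))
       (PIf (Less (Var ''bound'') (Var ''m'')) (PAsg ''no'' [] (N 1)) PSkip)))))"

text \<open>The common loop limit has to exceed all vertex numbers and to be at least the parameter,
  since \<open>power_prog\<close> counts up to \<open>''k''\<close>; the sum achieves both.\<close>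

definition kernel_com :: "nat \<Rightarrow> com" where
  "kernel_com t = Seq (Assign ''N'' [] (Plus (Var ''n'') (Var ''k''))) (compile (kernel_prog t))"

lemma kernel_wf: "wf_prog (kernel_prog t)"
proof -
  have "wf_prog match_prog" "wf_prog hull_prog" "wf_prog count_prog" "wf_prog detach_prog"
    by (simp_all add: match_prog_def match_init_def match_step_def hull_prog_def count_prog_def test_prog_def
        nbrs_prog_def detach_prog_def)
  then have "wf_prog (reduce_edge_prog t)" by (simp add: reduce_edge_prog_def)
  then have "wf_prog (pass_prog t)" by (simp add: pass_prog_def reduce_edge_mods)
  then have "wf_prog (main_prog t)" by (simp add: main_prog_def main_prog_mods)
  moreover have "wf_prog index_prog" "wf_prog copy_prog" by (simp_all add: index_prog_def copy_prog_def)
  ultimately show ?thesis by (simp add: kernel_prog_def power_wf)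
qed

lemma kernel_prog_correct:
  assumes R: "represents s E0 k0" and no: "s ''no'' [] = 0" and t: "t = 0 \<or> 4 \<le> t" and kN: "k0 \<le> s ''N'' []"
  defines "s' \<equiv> den (kernel_prog t) s"
  shows "if s' ''no'' [] \<noteq> 0 then \<not> solvable t E0 k0
    else \<exists>G k. stores_instance s' G k \<and> (solvable t (edges G) k \<longleftrightarrow> solvable t E0 k0) \<and>
      card (verts G) \<le> kernel_bound t k0 \<and> k \<le> k0"
proof -
  define s1 where "s1 = den (main_prog t) s"
  define s2 where "s2 = den index_prog s1"
  define s3 where "s3 = den copy_prog s2"
  let ?pow = "if t = 0 then power_prog 3 388 else power_prog 2 (5 * t ^ 3)"
  define s4 where "s4 = den ?pow (store s3 ''bound'' [] 0)"
  obtain E k where V: "valid_state t E0 k0 s1 E k" and red: "\<not> solvable t E0 k0 \<or> (\<forall>u v. reduced_at t E k u v)"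
    using main_prog_correct[OF R no t] unfolding s1_def by metis
  have R1: "represents s1 E k" and k: "k \<le> k0" and sol: "solvable t E k \<longleftrightarrow> solvable t E0 k0"
    and no1: "s1 ''no'' [] \<noteq> 0 \<longrightarrow> \<not> solvable t E0 k0"
    using V unfolding valid_state_def by simp_all
  have sE: "simple_edges E" and EB: "\<Union>E \<subseteq> {..<s1 ''N'' []}" and k1: "s1 ''k'' [] = k"
    using R1 unfolding represents_def by simp_all
  define m where "m = s2 ''m'' []"
  define f where "f j = s2 ''idx'' [j]" for j
  have m: "m = card (\<Union>E)" and bij: "bij_betw f {..<m} (\<Union>E)"
    using index_prog_correct[OF R1] unfolding s2_def[symmetric] m_def f_def by (metis, metis)
  have eq1: "s1 ''N'' = s ''N''" unfolding s1_def by (rule den_frame) (simp add: main_prog_mods)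
  have eq2: "s2 y = s1 y" if "y \<notin> {''m'', ''a'', ''b'', ''deg'', ''idx''}" for y
    unfolding s2_def using that by (intro den_frame) simp
  have eq3: "s3 y = s2 y" if "y \<notin> {''a'', ''b'', ''new'', ''adj'', ''n''}" for y
    unfolding s3_def using that by (intro den_frame) simp
  have eq4: "s4 y = s3 y" if "y \<noteq> ''bound''" "y = [] \<or> hd y \<noteq> CHR ''i''" for y
  proof -
    have "y \<notin> mods ?pow" using that by (auto simp: power_mods)
    then show ?thesis unfolding s4_def using that(1) by (simp add: den_frame store_other)
  qed
  have bound: "s4 ''bound'' [] = kernel_bound t k"
  proof -
    let ?s = "store s3 ''bound'' [] 0"
    have "?s ''k'' [] = k" "?s ''N'' [] = s ''N'' []" "?s ''bound'' [] = 0"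
      using k1 by (simp_all add: store_apply eq1 eq2 eq3)
    then show ?thesis unfolding s4_def kernel_bound_def
      using power_prog_correct[of ?s] k kN by simp
  qed
  have m4: "s4 ''m'' [] = m" by (simp add: eq4 eq3 m_def)
  have no4: "s4 ''no'' = s1 ''no''" by (simp add: eq4 eq3 eq2)
  have s': "s' = (if kernel_bound t k < m then store s4 ''no'' [] 1 else s4)"
  proof -
    have "s' = den (PIf (Less (Var ''bound'') (Var ''m'')) (PAsg ''no'' [] (N 1)) PSkip) s4"
      unfolding s'_def kernel_prog_def s4_def s3_def s2_def s1_def
      by (simp only: den.simps aval.simps list.map)
    then show ?thesis using bound m4 by simp
  qed
  show ?thesis
  proof (cases "kernel_bound t k < m")
    case True
    \<comment> \<open>A yes-instance would be reduced by now and would therefore satisfy the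
      bound.\<close>
    have "\<not> solvable t E0 k0"
    proof
      assume S: "solvable t E0 k0"
      then have "card (\<Union>E) \<le> kernel_bound t k"
        using reduced_card_verts[OF sE t, of k] sol red by simp
      then show False using True m by simp
    qed
    moreover have "s' ''no'' [] = 1" unfolding s' if_P[OF True] by (simp add: store_apply)
    ultimately show ?thesis by simp
  next
    case False
    have s'4: "s' = s4" unfolding s' if_not_P[OF False] ..
    \<comment> \<open>The edges are pulled back along the numbering \<open>f\<close> of the
      non-isolated vertices; solvability transfers since the image of \<open>E'\<close> under
      \<open>f\<close> is \<open>E\<close>.\<close>
    define E' where "E' = {{i, j} |i j. i < m \<and> j < m \<and> {f i, f j} \<in> E}"
    define G where "G = Graph {..<m} E'"
    have mem: "{i, j} \<in> E' \<longleftrightarrow> {f i, f j} \<in> E" if "i < m" "j < m" for i j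
      unfolding E'_def using that by (auto simp: doubleton_eq_iff insert_commute)
    have mN: "m \<le> s1 ''N'' []" unfolding m using card_mono[OF _ EB] by simp
    have adj: "s4 ''adj'' [i, j] = of_bool ({i, j} \<in> E')" if ij: "i < m" "j < m" for i j
    proof -
      have "s4 ''adj'' [i, j] = s3 ''adj'' [i, j]" by (simp add: eq4)
      also have "\<dots> = s2 ''adj'' [f i, f j]"
        using copy_prog_correct(1)[of s2] ij mN unfolding s3_def[symmetric] f_def by (simp add: eq2)
      also have "\<dots> = of_bool ({f i, f j} \<in> E)" using represents_adj[OF R1] by (simp add: eq2)
      finally show ?thesis using mem[OF ij] by simp
    qed
    have "{x} \<notin> E" for x using edge_neq[OF sE, of x x] by auto
    then have "E' \<subseteq> nsets {..<m} 2"
      unfolding E'_def by (auto simp: doubleton_in_nsets)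
    then have sG: "simple_graph G" unfolding G_def simple_graph_def by simp
    have "s4 ''n'' [] = m"
      using copy_prog_correct(2)[of s2] unfolding s3_def[symmetric] m_def by (simp add: eq4)
    moreover have "s4 ''k'' [] = k" using k1 by (simp add: eq2 eq3 eq4)
    ultimately have st: "stores_instance s' G k"
      unfolding stores_instance_def s'4 using sG adj unfolding G_def by simp
    have "(`) f ` E' = E"
    proof
      show "(`) f ` E' \<subseteq> E" unfolding E'_def by auto
      show "E \<subseteq> (`) f ` E'"
      proof
        fix e assume e: "e \<in> E"
        obtain x y where xy: "e = {x, y}" using sE e unfolding simple_edges_def by (meson card_2_iff)
        have "x \<in> f ` {..<m}" "y \<in> f ` {..<m}" using bij e xy unfolding bij_betw_def by auto
        then obtain i j where ij: "x = f i" "y = f j" "i < m" "j < m" by auto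
        then have "{i, j} \<in> E'" using mem e xy by simp
        moreover have "e = f ` {i, j}" using xy ij by simp
        ultimately show "e \<in> (`) f ` E'" by (metis imageI)
      qed
    qed
    moreover have "inj_on f (\<Union>E')"
      using bij inj_on_subset[of f "{..<m}" "\<Union>E'"] unfolding bij_betw_def E'_def by auto
    ultimately have "solvable t E' k \<longleftrightarrow> solvable t E0 k0" using solvable_image[of f E' t k] t sol by simp
    moreover have "m \<le> kernel_bound t k0" using False kernel_bound_mono[OF k, of t] by simp
    moreover have "s' ''no'' [] \<noteq> 0 \<longrightarrow> \<not> solvable t E0 k0" unfolding s'4 no4 by (rule no1)
    ultimately show ?thesis using st k by (auto simp: G_def intro!: exI[of _ G] exI[of _ k])
  qed
qed

lemma kernelization_kernel_com:
  assumes P: "\<And>G k. simple_graph G \<Longrightarrow> P G k \<longleftrightarrow> solvable t (edges G) k" and t: "t = 0 \<or> 4 \<le> t"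
  shows "kernelization P (kernel_bound t) (kernel_com t)"
  unfolding kernelization_def
proof (intro exI[of _ "1 + time_poly (kernel_prog t)"] allI impI)
  fix n :: nat and G k
  assume "simple_graph G \<and> verts G = {..<n}"
  then have G: "simple_graph G" "verts G = {..<n}" by simp_all
  define s where "s = store (input_state G k) ''N'' [] (n + k)"
  have R: "represents s (edges G) k"
    using simple_graph_edges[OF G(1)] G(2) unfolding represents_def s_def
    by (auto simp: store_apply input_state_def)
  have no: "s ''no'' [] = 0" and N: "s ''N'' [] = n + k" unfolding s_def by (simp_all add: store_apply input_state_def)
  have e0: "exec (Assign ''N'' [] (Plus (Var ''n'') (Var ''k''))) (input_state G k) 1 s"
    using exec.Assign[of "''N''" "[]" "Plus (Var ''n'') (Var ''k'')" "input_state G k"] G(2)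
    unfolding s_def by (simp add: input_state_def)
  obtain T where T: "exec (compile (kernel_prog t)) s T (den (kernel_prog t) s)"
    "T \<le> poly (time_poly (kernel_prog t)) (n + k)"
    using exec_compile[OF kernel_wf, of t s] unfolding N by metis
  have "n \<le> graph_size G" unfolding graph_size_def G(2) by simp
  then have "1 + T \<le> poly (1 + time_poly (kernel_prog t)) (graph_size G + k)"
    using T(2) poly_nat_mono[of "n + k" "graph_size G + k" "time_poly (kernel_prog t)"] by simp
  moreover have "exec (kernel_com t) (input_state G k) (1 + T) (den (kernel_prog t) s)"
    unfolding kernel_com_def by (rule exec.Seq[OF e0 T(1)])
  moreover have "if den (kernel_prog t) s ''no'' [] \<noteq> 0 then \<not> P G k
    else \<exists>G' k'. stores_instance (den (kernel_prog t) s) G' k' \<and> (P G' k' \<longleftrightarrow> P G k) \<and>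
      card (verts G') \<le> kernel_bound t k \<and> k' \<le> k"
  proof -
    have inst: "P G' k' \<longleftrightarrow> solvable t (edges G') k'" if "stores_instance s' G' k'" for s' G' k'
      using that P unfolding stores_instance_def by simp
    have "k \<le> s ''N'' []" using N by simp
    then show ?thesis using kernel_prog_correct[OF R no t] inst P[OF G(1)] by metis
  qed
  ultimately show "\<exists>T s. exec (kernel_com t) (input_state G k) T s \<and>
      T \<le> poly (1 + time_poly (kernel_prog t)) (graph_size G + k) \<and>
      (if s ''no'' [] \<noteq> 0 then \<not> P G k
       else \<exists>G' k'. stores_instance s G' k' \<and> (P G' k' \<longleftrightarrow> P G k) \<and>
         card (verts G') \<le> kernel_bound t k \<and> k' \<le> k)"
    by metis
qed

theorem theorem1:
  shows "(\<exists>c f. kernelization diamond_free_edge_deletion f c \<and>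
            (\<lambda>k. real (f k)) \<in> O(\<lambda>k. real k ^ 3)) \<and>
         (\<forall>t\<ge>4. \<exists>c f. kernelization (diamond_complete_free_edge_deletion t) f c \<and>
            (\<lambda>k. real (f k)) \<in> O(\<lambda>k. real k ^ 2))"
proof (intro conjI allI impI)
  have "kernelization diamond_free_edge_deletion (kernel_bound 0) (kernel_com 0)"
    by (rule kernelization_kernel_com) (simp_all add: diamond_free_edge_deletion_iff)
  moreover have "(\<lambda>k. real (kernel_bound 0 k)) \<in> O(\<lambda>k. real k ^ 3)"
    unfolding kernel_bound_def by simp
  ultimately show "\<exists>c f. kernelization diamond_free_edge_deletion f c \<and> (\<lambda>k. real (f k)) \<in> O(\<lambda>k. real k ^ 3)"
    by metis
next
  fix t :: nat
  assume t: "4 \<le> t"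
  have "kernelization (diamond_complete_free_edge_deletion t) (kernel_bound t) (kernel_com t)"
    by (rule kernelization_kernel_com) (simp_all add: diamond_complete_free_edge_deletion_iff t)
  moreover have "(\<lambda>k. real (kernel_bound t k)) \<in> O(\<lambda>k. real k ^ 2)"
    unfolding kernel_bound_def using t by simp
  ultimately show "\<exists>c f. kernelization (diamond_complete_free_edge_deletion t) f c \<and> (\<lambda>k. real (f k)) \<in> O(\<lambda>k. real k ^ 2)"
    by metis
qed

end
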